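(* Let $k\ge 1$, $n\ge 0$, $n+k\ge 2$, and let $m_1,\dots,m_{n+k}$ be positive integers, $\mathbf{m}=(m_1,\dots,m_{n+k})$. Then the torsion in $\bar B_1(A_{n,k}(\mathbb{Z}))[\mathbf{m}]$ is isomorphic to $(\mathbb{Z}/2)^{2^{n+k-2}}$ if all $m_i$ are even, and is zero otherwise.
   Context: $A=A_{n,k}(\mathbb{Z})$ is the free associative unital ring on $n$ even generators $x_1,\dots,x_n$ and $k$ odd generators $y_1,\dots,y_k$, graded by multidegree in the $n+k$ generators (even ones first); $[\mathbf{m}]$ denotes the component of multidegree $\mathbf{m}$. The (super)commutator is the bilinear extension of $[a,b]=ab-(-1)^{d_ad_b}ba$ for words $a,b$, where $d_a$ is the number of odd generators $y_j$ in the word $a$, counted with multiplicity. With this bracket, $L_1=A$, $L_{i+1}=[A,L_i]$ (the $\mathbb{Z}$-span of the brackets), $M_3=A\,L_3$, and $\bar B_1(A)=A/(L_2+M_3)$. *)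

theory Defs
  imports "HOL-Algebra.Algebra"
begin

(* Letters: the numbers below n are the even generators x_1, ..., x_n, and n, ..., n+k-1 are the
   odd generators y_1, ..., y_k.  Words are lists of letters. *)

definition bilinear_extension ::
    "('a \<Rightarrow> 'b \<Rightarrow> 'c \<Rightarrow>\<^sub>0 int) \<Rightarrow> ('a \<Rightarrow>\<^sub>0 int) \<Rightarrow> ('b \<Rightarrow>\<^sub>0 int) \<Rightarrow> 'c \<Rightarrow>\<^sub>0 int" where
  "bilinear_extension f a b = frag_extend (\<lambda>u. frag_extend (f u) b) a"

definition free_superring :: "nat \<Rightarrow> nat \<Rightarrow> (nat list \<Rightarrow>\<^sub>0 int) ring" where
  "free_superring n k =
    \<lparr>carrier = {a. Poly_Mapping.keys a \<subseteq> lists {..<n + k}},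
     monoid.mult = bilinear_extension (\<lambda>u v. frag_of (u @ v)),
     monoid.one = frag_of [],
     ring.zero = 0,
     ring.add = (+)\<rparr>"

definition odd_count :: "nat \<Rightarrow> nat list \<Rightarrow> nat" where
  "odd_count n w = length (filter (\<lambda>i. n \<le> i) w)"

definition supercommutator ::
    "nat \<Rightarrow> (nat list \<Rightarrow>\<^sub>0 int) \<Rightarrow> (nat list \<Rightarrow>\<^sub>0 int) \<Rightarrow> nat list \<Rightarrow>\<^sub>0 int" where
  "supercommutator n = bilinear_extension
    (\<lambda>u v. frag_of (u @ v) - frag_cmul ((-1) ^ (odd_count n u * odd_count n v)) (frag_of (v @ u)))"

definition additive_span :: "('a, 'b) ring_scheme \<Rightarrow> 'a set \<Rightarrow> 'a set" where
  "additive_span R S = generate (add_monoid R) S"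

(* The series starts at index 1; the value at index 0 is irrelevant. *)
fun lower_central :: "nat \<Rightarrow> nat \<Rightarrow> nat \<Rightarrow> (nat list \<Rightarrow>\<^sub>0 int) set" where
  "lower_central n k 0 = carrier (free_superring n k)"
| "lower_central n k (Suc 0) = carrier (free_superring n k)"
| "lower_central n k (Suc (Suc i)) = additive_span (free_superring n k)
     {supercommutator n a b |a b. a \<in> carrier (free_superring n k) \<and> b \<in> lower_central n k (Suc i)}"

definition lower_central_ideal :: "nat \<Rightarrow> nat \<Rightarrow> nat \<Rightarrow> (nat list \<Rightarrow>\<^sub>0 int) set" where
  "lower_central_ideal n k i = additive_span (free_superring n k)
     {a \<otimes>\<^bsub>free_superring n k\<^esub> b |a b. a \<in> carrier (free_superring n k) \<and> b \<in> lower_central n k i}"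

definition B1_relations :: "nat \<Rightarrow> nat \<Rightarrow> (nat list \<Rightarrow>\<^sub>0 int) set" where
  "B1_relations n k = lower_central n k 2 <+>\<^bsub>free_superring n k\<^esub> lower_central_ideal n k 3"

definition B1_bar :: "nat \<Rightarrow> nat \<Rightarrow> (nat list \<Rightarrow>\<^sub>0 int) set monoid" where
  "B1_bar n k = add_monoid (free_superring n k) Mod B1_relations n k"

definition multidegree_component ::
    "nat \<Rightarrow> nat \<Rightarrow> (nat \<Rightarrow> nat) \<Rightarrow> (nat list \<Rightarrow>\<^sub>0 int) set" where
  "multidegree_component n k m = {a \<in> carrier (free_superring n k).
     \<forall>w \<in> Poly_Mapping.keys a. \<forall>i<n + k. count_list w i = m i}"

(* The image in the quotient of the multidegree m part of the free superring; L_2 and M_3 being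
   spanned by multihomogeneous elements, these images are the graded pieces of the quotient. *)
definition B1_bar_component :: "nat \<Rightarrow> nat \<Rightarrow> (nat \<Rightarrow> nat) \<Rightarrow> (nat list \<Rightarrow>\<^sub>0 int) set monoid" where
  "B1_bar_component n k m = (B1_bar n k)
     \<lparr>carrier := {B1_relations n k +>\<^bsub>free_superring n k\<^esub> a |a. a \<in> multidegree_component n k m}\<rparr>"

definition torsion_group :: "('a, 'b) monoid_scheme \<Rightarrow> ('a, 'b) monoid_scheme" where
  "torsion_group G = G\<lparr>carrier := {x \<in> carrier G. \<exists>d::nat. d > 0 \<and> x [^]\<^bsub>G\<^esub> d = \<one>\<^bsub>G\<^esub>}\<rparr>"

end

theory Submission
  imports Defs "HOL-Library.Z2" "HOL-Library.Function_Algebras" "HOL-Library.Multiset"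
begin

text \<open>Let \<open>Q\<close> be the quotient of the free superring by \<open>M\<^sub>3\<close>. In \<open>Q\<close> the bracket \<open>[a, b]\<close> of two letters is
supercentral, and \<open>[v, a] [z, b] = \<plusminus> [v, z] [a, b]\<close>. So \<open>[a, b]\<close> behaves like a product \<open>da db\<close> of
differentials, and \<open>Q\<close> like the ring of differential forms of even degree with a noncommutative
product. Pulling one letter \<open>z\<close> to the left, an element of \<open>z\<close>-degree \<open>c\<close> becomes \<open>z\<^sup>c f + z\<^sup>c\<^sup>-\<^sup>1 w\<close>, where
\<open>w\<close> is a ``one-form'', a combination of elements \<open>[z, a] g\<close>, and neither \<open>f\<close> nor \<open>a\<close> and \<open>g\<close> contain \<open>z\<close>
(lemmas \<open>word_span_in_expansions\<close> and \<open>oneforms_in_oneform_expansions\<close>).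

Two representations show that nothing more collapses. The first sends an even letter \<open>a\<close> to \<open>1 + \<eta>\<^sub>a\<close> and an
odd letter to \<open>(1 + \<eta>\<^sub>a) \<theta>\<close>, acting on the exterior algebra over the integers; the second, in
characteristic two, sends a word to the product of the factors \<open>1 + t\<^sub>a t\<^sub>b\<close> over its inversions,
where \<open>t\<^sub>a\<^sup>2 = 0\<close>. Both are compatible with the expansion in a letter \<open>z\<close>, so induction on the set of
letters (lemma \<open>kernel_detection\<close>) gives that, on elements of one multidegree with positive
exponents, the first has kernel \<open>M\<^sub>3\<close> and the second has kernel \<open>M\<^sub>3 + 2A\<close> (lemmas \<open>symbol_faithful\<close> and
\<open>mod2_symbol_faithful\<close>).

Half of the first representation is a trace: the components of exterior degree of the parity opposite
to the number of odd letters vanish on \<open>L\<^sub>2 + M\<^sub>3\<close>. They take values in a torsion-free group, hence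
vanish on every element \<open>x\<close> that represents torsion. Let \<open>y\<close> be an odd letter, of degree \<open>c\<close> in \<open>x\<close>, and
note that \<open>y\<^sup>2\<close> is central in \<open>Q\<close>.

If \<open>c\<close> is odd, cyclic rotation removes the one-form, so \<open>x = y\<^sup>c f\<close> modulo \<open>L\<^sub>2 + M\<^sub>3\<close>; the trace of
\<open>y\<^sup>c f\<close> determines the whole image of \<open>f\<close>, and \<open>x\<close> is zero (lemma \<open>odd_exponent_no_torsion\<close>).

If \<open>c\<close> is even, then \<open>2 y\<^sup>c f = y\<^sup>c\<^sup>-\<^sup>1 [y, f]\<close> modulo \<open>L\<^sub>2\<close>, and the trace is injective on the elements
\<open>y\<^sup>c\<^sup>-\<^sup>1 w\<close>. So \<open>x = y\<^sup>c f + y\<^sup>c\<^sup>-\<^sup>1 w\<close> is torsion exactly if \<open>[y, f] = - 2 w\<close> modulo \<open>M\<^sub>3\<close>, and it is then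
zero as soon as \<open>f\<close> lies in \<open>2A + L\<^sub>2 + M\<^sub>3\<close> (lemma \<open>even_exponent_criterion\<close>). In other words, the torsion
is the even cohomology, with coefficients modulo two, of the de Rham complex of the letters other than
\<open>y\<close>. In a fixed multidegree \<open>m\<close> this complex is the exterior algebra on the \<open>t\<^sub>i\<close> whose differential is
multiplication by \<open>\<Sum> m\<^sub>i t\<^sub>i\<close>. If some \<open>m\<^sub>i\<close> is odd, it is exact and there is no torsion (lemma
\<open>even_exponent_no_torsion\<close>). If all \<open>m\<^sub>i\<close> are even, the differential is zero, and the torsion is the
space of all even elements, with one basis vector for each subset of even size of the \<open>n + k - 1\<close> letters
other than \<open>y\<close> (lemma \<open>torsion_basis\<close>).\<close>

section \<open>The free ring and additive spans\<close>

text \<open>With words as an additive monoid under concatenation, finitely supported functions on words inherit the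
convolution product, so that the free ring on all letters becomes an instance of the class of rings.
The restriction to finitely many letters is postponed to the end.\<close>

instantiation list :: (type) monoid_add
begin
definition "zero_list = ([] :: 'a list)"
definition "plus_list = (append :: 'a list \<Rightarrow> _)"
instance by standard (auto simp: zero_list_def plus_list_def)
end

type_synonym free_ring = "nat list \<Rightarrow>\<^sub>0 int"

lemma frag_of_mult: "frag_of u * frag_of v = frag_of (u @ v)"
  by (simp add: mult_single plus_list_def)

lemma frag_of_Nil: "frag_of [] = (1 :: 'a list \<Rightarrow>\<^sub>0 int)"
  by (simp flip: single_one add: zero_list_def)

lemma frag_induct [case_names zero word diff]:
  assumes "P 0" "\<And>w. P (frag_of w)" "\<And>x y. P x \<Longrightarrow> P y \<Longrightarrow> P (x - y)"
  shows "P x"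
  using frag_induction[of x UNIV P] assms by auto

definition linear_ext :: "('a \<Rightarrow> 'b::ring_1) \<Rightarrow> ('a \<Rightarrow>\<^sub>0 int) \<Rightarrow> 'b" where
  "linear_ext F x = (\<Sum>k\<in>Poly_Mapping.keys x. of_int (Poly_Mapping.lookup x k) * F k)"

lemma linear_ext_frag_of [simp]: "linear_ext F (frag_of w) = F w"
  by (simp add: linear_ext_def)

lemma linear_ext_superset:
  assumes "finite K" "Poly_Mapping.keys x \<subseteq> K"
  shows "linear_ext F x = (\<Sum>k\<in>K. of_int (Poly_Mapping.lookup x k) * F k)"
  unfolding linear_ext_def
  by (rule sum.mono_neutral_left) (use assms in \<open>auto simp: in_keys_iff\<close>)

lemma additive_linear_ext: "additive (linear_ext F)"
proof
  fix x y :: "'a \<Rightarrow>\<^sub>0 int"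
  let ?K = "Poly_Mapping.keys x \<union> Poly_Mapping.keys y"
  have "Poly_Mapping.keys (x + y) \<subseteq> ?K"
    by (rule keys_add)
  then show "linear_ext F (x + y) = linear_ext F x + linear_ext F y"
    by (simp add: linear_ext_superset[of ?K] lookup_add distrib_right sum.distrib)
qed

lemma linear_ext_mult:
  assumes "\<And>u v. F (u @ v) = F u * F v"
  shows "linear_ext F (x * y) = linear_ext F x * linear_ext F y"
proof -
  interpret additive "linear_ext F" by (rule additive_linear_ext)
  have "linear_ext F (frag_of u * y) = F u * linear_ext F y" for u
    by (induction y rule: frag_induct) (simp_all add: zero diff frag_of_mult assms algebra_simps)
  then show ?thesis
    by (induction x rule: frag_induct) (simp_all add: zero diff algebra_simps)
qed

inductive_set zspan :: "'a::ab_group_add set \<Rightarrow> 'a set" for S where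
  zero: "0 \<in> zspan S"
| base: "x \<in> S \<Longrightarrow> x \<in> zspan S"
| diff: "x \<in> zspan S \<Longrightarrow> y \<in> zspan S \<Longrightarrow> x - y \<in> zspan S"

definition add_closed :: "'a::ab_group_add set \<Rightarrow> bool" where
  "add_closed H \<longleftrightarrow> 0 \<in> H \<and> (\<forall>x\<in>H. \<forall>y\<in>H. x - y \<in> H)"

lemma add_closedD:
  assumes "add_closed H"
  shows "0 \<in> H" "x \<in> H \<Longrightarrow> y \<in> H \<Longrightarrow> x - y \<in> H" "x \<in> H \<Longrightarrow> - x \<in> H"
    "x \<in> H \<Longrightarrow> y \<in> H \<Longrightarrow> x + y \<in> H"
proof -
  show 0: "0 \<in> H" and d: "\<And>x y. x \<in> H \<Longrightarrow> y \<in> H \<Longrightarrow> x - y \<in> H"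
    using assms by (auto simp: add_closed_def)
  show m: "- x \<in> H" if "x \<in> H" for x using d[OF 0 that] by simp
  show "x \<in> H \<Longrightarrow> y \<in> H \<Longrightarrow> x + y \<in> H" using d[OF _ m[of y], of x] by simp
qed

lemma add_closed_zspan: "add_closed (zspan S)"
  by (auto simp: add_closed_def intro: zspan.intros)

lemma zspan_least: "x \<in> zspan S \<Longrightarrow> add_closed H \<Longrightarrow> S \<subseteq> H \<Longrightarrow> x \<in> H"
  by (induction rule: zspan.induct) (auto dest: add_closedD)

lemma zspan_image:
  assumes "x \<in> zspan S" "additive h" "add_closed H" "\<And>s. s \<in> S \<Longrightarrow> h s \<in> H"
  shows "h x \<in> H"
proof -
  interpret additive h by fact
  show ?thesis
    using assms(1) by induction (use assms(3,4) in \<open>auto simp: zero diff dest: add_closedD\<close>)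
qed

lemma add_closed_kernel: "additive h \<Longrightarrow> add_closed {x. h x = 0}"
  by (simp add: add_closed_def additive.zero additive.diff)

lemma zspan_kernel: "x \<in> zspan S \<Longrightarrow> additive h \<Longrightarrow> (\<And>s. s \<in> S \<Longrightarrow> h s = 0) \<Longrightarrow> h x = 0"
  using zspan_least[OF _ add_closed_kernel[of h], of x S] by auto

lemma add_closed_scale:
  fixes H :: "'a::ring_1 set"
  assumes "add_closed H" "x \<in> H" shows "of_int c * x \<in> H"
proof (induction c rule: int_induct[of _ 0])
  case base then show ?case using assms by (simp add: add_closedD)
next
  case (step1 i) then show ?case using add_closedD(4)[OF assms(1) _ assms(2), of "of_int i * x"]
    by (simp add: algebra_simps)
next
  case (step2 i) then show ?case using add_closedD(2)[OF assms(1) _ assms(2), of "of_int i * x"]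
    by (simp add: algebra_simps)
qed

lemma add_closed_sign:
  fixes H :: "'a::ring_1 set"
  assumes "add_closed H" "x \<in> H" shows "(-1) ^ k * x \<in> H"
  using add_closed_scale[OF assms, of "(-1) ^ k"] by simp

lemma additive_left: "additive (\<lambda>x. a * x :: 'a::ring)"
  and additive_right: "additive (\<lambda>x. x * a :: 'a::ring)"
  by (auto simp: additive_def algebra_simps)

definition two_sided :: "'a::ring_1 set \<Rightarrow> bool" where
  "two_sided I \<longleftrightarrow> add_closed I \<and> (\<forall>a. \<forall>x\<in>I. a * x \<in> I \<and> x * a \<in> I)"

lemma two_sidedD:
  assumes "two_sided I"
  shows "add_closed I" "x \<in> I \<Longrightarrow> a * x \<in> I" "x \<in> I \<Longrightarrow> x * a \<in> I"
  using assms by (auto simp: two_sided_def)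

lemma two_sided_zspan:
  fixes S :: "free_ring set"
  assumes "\<And>u x. x \<in> S \<Longrightarrow> frag_of u * x \<in> zspan S" "\<And>u x. x \<in> S \<Longrightarrow> x * frag_of u \<in> zspan S"
  shows "two_sided (zspan S)"
  unfolding two_sided_def
proof (intro conjI add_closed_zspan allI ballI)
  fix a x assume x: "x \<in> zspan S"
  have l: "frag_of u * x \<in> zspan S" and r: "x * frag_of u \<in> zspan S" for u
    using zspan_image[OF x additive_left add_closed_zspan] assms(1)
      zspan_image[OF x additive_right add_closed_zspan] assms(2) by blast+
  show "a * x \<in> zspan S"
    by (induction a rule: frag_induct) (auto simp: l algebra_simps intro: zspan.intros)
  show "x * a \<in> zspan S"
    by (induction a rule: frag_induct) (auto simp: r algebra_simps intro: zspan.intros)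
qed

text \<open>Congruence up to sign. Most arguments below only ask whether an element lies in an additive subgroup, for
which a sign does not matter; tracking congruences up to sign avoids the bookkeeping of the sign rule.\<close>

definition sign_cong :: "'a::ring_1 set \<Rightarrow> 'a \<Rightarrow> 'a \<Rightarrow> bool" where
  "sign_cong I x y \<longleftrightarrow> x - y \<in> I \<or> x + y \<in> I"

lemma sign_cong_sign: "add_closed I \<Longrightarrow> x - (-1) ^ k * y \<in> I \<Longrightarrow> sign_cong I x y"
  by (cases "even k") (auto simp: sign_cong_def)

lemma sign_cong_sign_eq: "add_closed I \<Longrightarrow> sign_cong I ((-1) ^ k * y) y"
  by (cases "even k") (auto simp: sign_cong_def dest: add_closedD)

lemma sign_cong_sym: "add_closed I \<Longrightarrow> sign_cong I x y \<Longrightarrow> sign_cong I y x"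
  using add_closedD(3)[of I "x - y"] by (auto simp: sign_cong_def add.commute)

lemma sign_cong_trans:
  assumes "add_closed I" "sign_cong I x y" "sign_cong I y z" shows "sign_cong I x z"
proof -
  note c = add_closedD(2,4)[OF assms(1)]
  consider "x - y \<in> I" "y - z \<in> I" | "x - y \<in> I" "y + z \<in> I" | "x + y \<in> I" "y - z \<in> I"
    | "x + y \<in> I" "y + z \<in> I"
    using assms(2,3) by (auto simp: sign_cong_def)
  then show ?thesis
    unfolding sign_cong_def
  proof cases
    case 1 show "x - z \<in> I \<or> x + z \<in> I" using c(2)[OF 1] by simp
  next
    case 2 show "x - z \<in> I \<or> x + z \<in> I" using c(2)[OF 2] by simp
  next
    case 3 show "x - z \<in> I \<or> x + z \<in> I" using c(1)[OF 3] by simp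
  next
    case 4 show "x - z \<in> I \<or> x + z \<in> I" using c(1)[OF 4] by simp
  qed
qed

lemma sign_cong_mult: "two_sided I \<Longrightarrow> sign_cong I x y \<Longrightarrow> sign_cong I (a * x * b) (a * y * b)"
proof -
  assume I: "two_sided I" and "sign_cong I x y"
  then consider "x - y \<in> I" | "x + y \<in> I" by (auto simp: sign_cong_def)
  then show ?thesis
  proof cases
    case 1
    then have "a * (x - y) * b \<in> I" using I by (intro two_sidedD)
    then show ?thesis by (simp add: sign_cong_def algebra_simps)
  next
    case 2
    then have "a * (x + y) * b \<in> I" using I by (intro two_sidedD)
    then show ?thesis by (simp add: sign_cong_def algebra_simps)
  qed
qed

lemma sign_cong_mem:
  assumes "add_closed H" "I \<subseteq> H" "sign_cong I x y" "y \<in> H" shows "x \<in> H"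
  using assms(3)[unfolded sign_cong_def]
proof
  assume "x - y \<in> I" then show ?thesis using add_closedD(4)[OF assms(1) _ assms(4), of "x - y"] assms(2) by auto
next
  assume "x + y \<in> I" then show ?thesis using add_closedD(2)[OF assms(1) _ assms(4), of "x + y"] assms(2) by auto
qed

section \<open>Brackets and the ideal \<open>M\<^sub>3\<close>\<close>

lemma odd_count_Nil [simp]: "odd_count n [] = 0"
  and odd_count_append [simp]: "odd_count n (u @ v) = odd_count n u + odd_count n v"
  and odd_count_Cons2 [simp]: "odd_count n (a # b # w) = odd_count n [a] + odd_count n (b # w)"
  by (auto simp: odd_count_def)

definition bracket :: "nat \<Rightarrow> nat list \<Rightarrow> nat list \<Rightarrow> free_ring" where
  "bracket n u v = frag_of (u @ v) - (-1) ^ (odd_count n u * odd_count n v) * frag_of (v @ u)"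

definition triple_bracket :: "nat \<Rightarrow> nat list \<Rightarrow> nat list \<Rightarrow> nat list \<Rightarrow> free_ring" where
  "triple_bracket n a b c = frag_of a * bracket n b c
     - (-1) ^ (odd_count n a * (odd_count n b + odd_count n c)) * (bracket n b c * frag_of a)"

definition L2 :: "nat \<Rightarrow> free_ring set" where
  "L2 n = zspan {bracket n u v |u v. True}"

abbreviation triple_products :: "nat \<Rightarrow> free_ring set" where
  "triple_products n \<equiv> {frag_of p * triple_bracket n a b c * frag_of q |p a b c q. True}"

text \<open>All words over the infinite alphabet are used, and the span is a two-sided ideal by construction. For
finitely many letters it agrees with the left ideal generated by \<open>L\<^sub>3\<close>, because a right
factor can be moved to the left at the cost of a further bracket.\<close>

definition M3 :: "nat \<Rightarrow> free_ring set" where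
  "M3 n = zspan (triple_products n)"

lemma two_sided_M3: "two_sided (M3 n)"
  unfolding M3_def
proof (rule two_sided_zspan)
  fix u and x assume "x \<in> triple_products n"
  then obtain p a b c q where x: "x = frag_of p * triple_bracket n a b c * frag_of q" by auto
  have "frag_of u * x = frag_of (u @ p) * triple_bracket n a b c * frag_of q"
    by (simp add: x frag_of_mult[symmetric] mult.assoc)
  then show "frag_of u * x \<in> zspan (triple_products n)"
    by (intro zspan.base) blast
  have "x * frag_of u = frag_of p * triple_bracket n a b c * frag_of (q @ u)"
    by (simp add: x frag_of_mult[symmetric] mult.assoc)
  then show "x * frag_of u \<in> zspan (triple_products n)"
    by (intro zspan.base) blast
qed

lemmas add_closed_M3 = two_sidedD(1)[OF two_sided_M3]

lemma triple_bracket_in_M3: "triple_bracket n a b c \<in> M3 n"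
proof -
  have "triple_bracket n a b c = frag_of [] * triple_bracket n a b c * frag_of []"
    by (simp add: frag_of_Nil)
  then show ?thesis unfolding M3_def by (intro zspan.base) blast
qed

lemma bracket_swap: "bracket n [a] [b] = - ((-1) ^ (odd_count n [a] * odd_count n [b]) * bracket n [b] [a])"
proof -
  show ?thesis by (simp add: bracket_def algebra_simps minus_one_power_iff)
qed

lemma bracket_central: "sign_cong (M3 n) (bracket n u v * frag_of w) (frag_of w * bracket n u v)"
  by (rule sign_cong_sym[OF add_closed_M3], rule sign_cong_sign[OF add_closed_M3])
     (use triple_bracket_in_M3 in \<open>auto simp: triple_bracket_def\<close>)

lemma sign_cong_bracket_swap: "sign_cong (M3 n) (bracket n [a] [b]) (bracket n [b] [a])"
proof -
  have "bracket n [a] [b] = (-1) ^ Suc (odd_count n [a] * odd_count n [b]) * bracket n [b] [a]"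
    using bracket_swap[of n a b] by simp
  then show ?thesis using sign_cong_sign_eq[OF add_closed_M3] by metis
qed

text \<open>Expand \<open>[b, [v, a z]]\<close> with the Leibniz rule: the brackets of letters being supercentral, only
\<open>\<plusminus> [v, a] [b, z] \<plusminus> [b, a] [v, z]\<close> remains. This is the antisymmetry of a product of four differentials.
With \<open>v = z\<close> it also evaluates \<open>[z, a] [z, b]\<close> as \<open>\<plusminus> [z, z] [a, b]\<close>, which is zero for even \<open>z\<close> and
\<open>\<plusminus> 2 z\<^sup>2 [a, b]\<close> for odd \<open>z\<close>.\<close>

lemma sign_cong_bracket_exchange:
  "sign_cong (M3 n) (bracket n [v] [a] * bracket n [z] [b]) (bracket n [v] [z] * bracket n [a] [b])"
proof -
  let ?I = "M3 n"
  let ?V = "frag_of [v]" and ?A = "frag_of [a]" and ?Z = "frag_of [z]" and ?B = "frag_of [b]"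
  let ?u = "\<lambda>i j. bracket n [i] [j]"
  define s where "s i j = (-1::free_ring) ^ (odd_count n [i] * odd_count n [j])" for i j
  have br: "?u i j = frag_of [i] * frag_of [j] - s i j * (frag_of [j] * frag_of [i])" for i j
    by (simp add: bracket_def s_def frag_of_mult)
  have t: "?B * bracket n [v] [a, z] - s b v * s b a * s b z * (bracket n [v] [a, z] * ?B) \<in> ?I"
    using triple_bracket_in_M3[of n "[b]" "[v]" "[a,z]"]
    by (cases "even (odd_count n [b])"; cases "even (odd_count n [v])"; cases "even (odd_count n [a])"; cases "even (odd_count n [z])")
      (simp_all add: triple_bracket_def s_def minus_one_power_iff)
  have e: "bracket n [v] [a, z] = ?u v a * ?Z + s v a * (?A * ?u v z)"
    by (simp add: bracket_def s_def frag_of_mult algebra_simps power_add minus_one_power_iff)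
  have c1: "?B * ?u v a - s b v * s b a * (?u v a * ?B) \<in> ?I"
    using triple_bracket_in_M3[of n "[b]" "[v]" "[a]"]
    by (cases "even (odd_count n [b])"; cases "even (odd_count n [v])"; cases "even (odd_count n [a])")
      (simp_all add: triple_bracket_def s_def minus_one_power_iff)
  have c2: "?B * ?u v z - s b v * s b z * (?u v z * ?B) \<in> ?I"
    using triple_bracket_in_M3[of n "[b]" "[v]" "[z]"]
    by (cases "even (odd_count n [b])"; cases "even (odd_count n [v])"; cases "even (odd_count n [z])")
      (simp_all add: triple_bracket_def s_def minus_one_power_iff)
  note ts = two_sidedD[OF two_sided_M3[of n]]
  have c1': "(?B * ?u v a - s b v * s b a * (?u v a * ?B)) * ?Z \<in> ?I"
    by (rule ts(3)[OF c1])
  have c2': "s v a * s b a * ?A * (?B * ?u v z - s b v * s b z * (?u v z * ?B)) \<in> ?I"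
    by (rule ts(2)[OF c2])
  have main: "s b v * s b a * (?u v a * ?u b z) + s v a * (?u b a * ?u v z) \<in> ?I"
  proof -
    have "s b v * s b a * (?u v a * ?u b z) + s v a * (?u b a * ?u v z)
      = (?B * bracket n [v] [a, z] - s b v * s b a * s b z * (bracket n [v] [a, z] * ?B))
        - (?B * ?u v a - s b v * s b a * (?u v a * ?B)) * ?Z
        - s v a * s b a * ?A * (?B * ?u v z - s b v * s b z * (?u v z * ?B))"
      unfolding e br[of b z] br[of b a]
      by (simp add: s_def minus_one_power_iff algebra_simps)
    then show ?thesis using t c1' c2' by (simp add: add_closedD[OF ts(1)])
  qed
  have "sign_cong ?I (?u v a * ?u b z) (?u b a * ?u v z)"
    using main unfolding s_def sign_cong_def
    by (auto simp: minus_one_power_iff add.commute split: if_splits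
         dest: add_closedD(3)[OF ts(1)])
  moreover have "sign_cong ?I (?u v a * ?u z b) (?u v a * ?u b z)"
    using sign_cong_mult[OF two_sided_M3 sign_cong_bracket_swap[of n z b], of "?u v a" 1] by simp
  moreover have "sign_cong ?I (?u b a * ?u v z) (?u a b * ?u v z)"
    using sign_cong_mult[OF two_sided_M3 sign_cong_bracket_swap[of n b a], of 1 "?u v z"] by simp
  moreover have "sign_cong ?I (?u a b * ?u v z) (?u v z * ?u a b)"
  proof -
    have "?u a b * ?u v z - (-1)^((odd_count n [a] + odd_count n [b]) * (odd_count n [v] + odd_count n [z])) * (?u v z * ?u a b) \<in> ?I"
    proof -
      let ?e = "\<lambda>w. frag_of w * ?u v z - (-1)^(odd_count n w * (odd_count n [v] + odd_count n [z])) * (?u v z * frag_of w)"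
      have w: "?e w \<in> ?I" for w
        using triple_bracket_in_M3[of n w "[v]" "[z]"] by (simp add: triple_bracket_def)
      have "?e [a,b] - s a b * ?e [b,a] \<in> ?I"
        by (rule add_closedD(2)[OF ts(1) w ts(2)[OF w]])
      also have "?e [a,b] - s a b * ?e [b,a] = ?u a b * ?u v z - (-1)^((odd_count n [a] + odd_count n [b]) * (odd_count n [v] + odd_count n [z])) * (?u v z * ?u a b)"
        by (simp add: bracket_def s_def frag_of_mult algebra_simps minus_one_power_iff)
      finally show ?thesis .
    qed
    then show ?thesis by (rule sign_cong_sign[OF ts(1)])
  qed
  ultimately show ?thesis using sign_cong_trans[OF ts(1)] by blast
qed

section \<open>Expansion in powers of a letter\<close>

lemma sign_left_comm: "(x::'a::ring_1) * ((-1) ^ k * y) = (-1) ^ k * (x * y)"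
  by (cases "even k") simp_all

definition words_of :: "nat set \<Rightarrow> (nat \<Rightarrow> nat) \<Rightarrow> nat list set" where
  "words_of zs m = {w. set w \<subseteq> zs \<and> (\<forall>i\<in>zs. count_list w i = m i)}"

definition word_span :: "nat set \<Rightarrow> (nat \<Rightarrow> nat) \<Rightarrow> free_ring set" where
  "word_span zs m = zspan (frag_of ` words_of zs m)"

abbreviation oneform_words :: "nat \<Rightarrow> nat set \<Rightarrow> nat \<Rightarrow> (nat \<Rightarrow> nat) \<Rightarrow> free_ring set" where
  "oneform_words n zs v m \<equiv> {bracket n [v] [a] * frag_of w |a w. a # w \<in> words_of zs m}"

text \<open>The one-forms: \<open>[v, a] g\<close> stands for \<open>dv da g\<close>, that is, for the form \<open>g da\<close> with values in multiples of
\<open>dv\<close>. The word \<open>a g\<close> carries the multidegree; the letter \<open>v\<close> serves as an auxiliary variable.\<close>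

definition oneforms :: "nat \<Rightarrow> nat set \<Rightarrow> nat \<Rightarrow> (nat \<Rightarrow> nat) \<Rightarrow> free_ring set" where
  "oneforms n zs v m = zspan (oneform_words n zs v m)"

definition mod_set :: "'a::ab_group_add set \<Rightarrow> 'a set \<Rightarrow> 'a set" where
  "mod_set H I = {x. \<exists>h\<in>H. x - h \<in> I}"

lemma add_closed_mod_set:
  assumes H: "add_closed H" and I: "add_closed I" shows "add_closed (mod_set H I)"
  unfolding add_closed_def
proof (intro conjI ballI)
  show "0 \<in> mod_set H I"
    using add_closedD(1)[OF H] add_closedD(1)[OF I] by (force simp: mod_set_def)
  fix x y assume "x \<in> mod_set H I" "y \<in> mod_set H I"
  then obtain h k where "h \<in> H" "x - h \<in> I" "k \<in> H" "y - k \<in> I" by (auto simp: mod_set_def)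
  then have "h - k \<in> H" "(x - y) - (h - k) \<in> I"
    using add_closedD(2)[OF H, of h k] add_closedD(2)[OF I, of "x - h" "y - k"]
    by (auto simp: algebra_simps)
  then show "x - y \<in> mod_set H I" by (auto simp: mod_set_def)
qed

lemma mod_set_left: "add_closed I \<Longrightarrow> h \<in> H \<Longrightarrow> h \<in> mod_set H I"
  by (force simp: mod_set_def dest: add_closedD)

lemma mod_set_right: "add_closed H \<Longrightarrow> x \<in> I \<Longrightarrow> x \<in> mod_set H I"
  by (force simp: mod_set_def dest: add_closedD(1))

lemma mod_set_image:
  assumes "x \<in> mod_set (zspan S) I" "additive h" "add_closed T"
    "\<And>y. y \<in> I \<Longrightarrow> h y \<in> T" "\<And>s. s \<in> S \<Longrightarrow> h s \<in> T"
  shows "h x \<in> T"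
proof -
  obtain k where k: "k \<in> zspan S" "x - k \<in> I" using assms(1) by (auto simp: mod_set_def)
  have "h k \<in> T" by (rule zspan_image[OF k(1) assms(2,3,5)])
  then have "h k + h (x - k) \<in> T" using k(2) assms(3,4) by (blast intro: add_closedD)
  then show ?thesis using assms(2) by (simp add: additive.diff)
qed

lemma words_of_cong: "(\<And>i. i \<in> zs \<Longrightarrow> m i = m' i) \<Longrightarrow> words_of zs m = words_of zs m'"
  by (auto simp: words_of_def)

lemma word_span_cong: "(\<And>i. i \<in> zs \<Longrightarrow> m i = m' i) \<Longrightarrow> word_span zs m = word_span zs m'"
  using words_of_cong[of zs m m'] by (simp add: word_span_def)

lemma oneforms_cong: "(\<And>i. i \<in> zs \<Longrightarrow> m i = m' i) \<Longrightarrow> oneforms n zs v m = oneforms n zs v m'"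
  using words_of_cong[of zs m m'] by (simp add: oneforms_def)

lemma add_closed_word_span: "add_closed (word_span zs m)" and add_closed_oneforms: "add_closed (oneforms n zs v m)"
  by (simp_all add: word_span_def oneforms_def add_closed_zspan)

lemma word_span_base: "w \<in> words_of zs m \<Longrightarrow> frag_of w \<in> word_span zs m"
  by (simp add: word_span_def zspan.base)

lemma oneforms_base: "a # g \<in> words_of zs m \<Longrightarrow> bracket n [v] [a] * frag_of g \<in> oneforms n zs v m"
  unfolding oneforms_def by (rule zspan.base) blast

lemma frag_of_Cons: "frag_of (a # w) = frag_of [a] * frag_of w"
  by (simp add: frag_of_mult)

lemma frag_of_snoc: "frag_of (w @ [a]) = frag_of w * frag_of [a]"
  by (simp add: frag_of_mult)

lemma word_span_bracket:
  assumes "a # b # g \<in> words_of zs m" shows "bracket n [a] [b] * frag_of g \<in> word_span zs m"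
proof -
  have "b # a # g \<in> words_of zs m" using assms by (auto simp: words_of_def)
  moreover have "bracket n [a] [b] * frag_of g
    = frag_of (a # b # g) - (-1) ^ (odd_count n [a] * odd_count n [b]) * frag_of (b # a # g)"
    by (simp add: bracket_def algebra_simps frag_of_mult)
  ultimately show ?thesis
    using assms by (simp add: add_closedD(2)[OF add_closed_word_span] add_closed_sign[OF add_closed_word_span] word_span_base)
qed

text \<open>The bracket with a letter is a superderivation, and its values on letters are central: this is the
differential of the word.\<close>

lemma bracket_letter_in_oneforms:
  assumes "set g \<subseteq> zs"
  shows "bracket n [z] g \<in> mod_set (oneforms n zs z (count_list g)) (M3 n)"
  using assms
proof (induction g)
  case Nil
  have "bracket n [z] [] = 0" by (simp add: bracket_def)
  then show ?case
    using add_closedD(1)[OF add_closed_mod_set[OF add_closed_oneforms add_closed_M3]] by metis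
next
  case (Cons b g)
  let ?T = "mod_set (oneforms n zs z (count_list (b # g))) (M3 n)"
  have T: "add_closed ?T" by (rule add_closed_mod_set[OF add_closed_oneforms add_closed_M3])
  have odd: "odd_count n (b # g) = odd_count n [b] + odd_count n g" using odd_count_append[of n "[b]" g] by simp
  have e: "bracket n [z] (b # g) = bracket n [z] [b] * frag_of g
    + (-1) ^ (odd_count n [z] * odd_count n [b]) * (frag_of [b] * bracket n [z] g)"
    by (simp add: bracket_def odd algebra_simps frag_of_mult minus_one_power_iff)
  have w: "b # g \<in> words_of zs (count_list (b # g))" using Cons.prems by (simp add: words_of_def)
  have "frag_of [b] * bracket n [z] g \<in> ?T"
  proof (rule mod_set_image[OF _ additive_left T])
    show "bracket n [z] g \<in> mod_set (zspan (oneform_words n zs z (count_list g))) (M3 n)"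
      using Cons by (simp add: oneforms_def)
    show "frag_of [b] * y \<in> ?T" if "y \<in> M3 n" for y
      using that two_sidedD(2)[OF two_sided_M3] mod_set_right[OF add_closed_oneforms] by blast
    fix s assume "s \<in> oneform_words n zs z (count_list g)"
    then obtain a h where s: "s = bracket n [z] [a] * frag_of h" and ah: "a # h \<in> words_of zs (count_list g)" by auto
    have "a # b # h \<in> words_of zs (count_list (b # g))" using ah Cons.prems by (auto simp: words_of_def)
    then have "bracket n [z] [a] * frag_of [b] * frag_of h \<in> ?T"
      using mod_set_left[OF add_closed_M3 oneforms_base] by (simp add: mult.assoc frag_of_mult)
    moreover have "sign_cong (M3 n) (1 * (frag_of [b] * bracket n [z] [a]) * frag_of h) (1 * (bracket n [z] [a] * frag_of [b]) * frag_of h)"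
      by (rule sign_cong_mult[OF two_sided_M3 sign_cong_sym[OF add_closed_M3 bracket_central]])
    ultimately show "frag_of [b] * s \<in> ?T"
      using sign_cong_mem[OF T, of "M3 n"] mod_set_right[OF add_closed_oneforms] by (simp add: s mult.assoc subset_iff)
  qed
  then show ?case unfolding e
    by (intro add_closedD(4)[OF T] add_closed_sign[OF T]) (auto intro: mod_set_left[OF add_closed_M3] oneforms_base[OF w])
qed

text \<open>The subtraction in \<open>c - 1\<close> is truncated, so the set is meaningful for positive \<open>c\<close> only.\<close>

definition expansions :: "nat \<Rightarrow> nat set \<Rightarrow> nat \<Rightarrow> nat \<Rightarrow> (nat \<Rightarrow> nat) \<Rightarrow> free_ring set" where
  "expansions n zs z c m = mod_set {frag_of (replicate c z) * f + frag_of (replicate (c - 1) z) * w |f w.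
     f \<in> word_span zs m \<and> w \<in> oneforms n zs z m} (M3 n)"

lemma add_closed_pair_sums:
  fixes a b :: "'a::ring_1"
  assumes F: "add_closed F" and G: "add_closed G"
  shows "add_closed {a * f + b * g |f g. f \<in> F \<and> g \<in> G}"
  unfolding add_closed_def
proof (intro conjI ballI)
  show "0 \<in> {a * f + b * g |f g. f \<in> F \<and> g \<in> G}"
    using add_closedD(1)[OF F] add_closedD(1)[OF G] by force
  fix x y assume "x \<in> {a * f + b * g |f g. f \<in> F \<and> g \<in> G}" "y \<in> {a * f + b * g |f g. f \<in> F \<and> g \<in> G}"
  then obtain f g f' g' where "f \<in> F" "g \<in> G" "f' \<in> F" "g' \<in> G" "x = a * f + b * g" "y = a * f' + b * g'"
    by auto
  then have "x - y = a * (f - f') + b * (g - g')" "f - f' \<in> F" "g - g' \<in> G"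
    using add_closedD(2)[OF F] add_closedD(2)[OF G] by (auto simp: algebra_simps)
  then show "x - y \<in> {a * f + b * g |f g. f \<in> F \<and> g \<in> G}" by blast
qed

lemma add_closed_expansions: "add_closed (expansions n zs z c m)"
  unfolding expansions_def by (intro add_closed_mod_set add_closed_pair_sums add_closed_word_span add_closed_oneforms add_closed_M3)

lemma M3_subset_expansions: "M3 n \<subseteq> expansions n zs z c m"
  unfolding expansions_def by (blast intro: mod_set_right add_closed_pair_sums add_closed_word_span add_closed_oneforms)

lemma expansions_word_span: "f \<in> word_span zs m \<Longrightarrow> frag_of (replicate c z) * f \<in> expansions n zs z c m"
  unfolding expansions_def
  by (rule mod_set_left[OF add_closed_M3]) (use add_closedD(1)[OF add_closed_oneforms] in force)

lemma expansions_oneforms: "w \<in> oneforms n zs z m \<Longrightarrow> frag_of (replicate (c - 1) z) * w \<in> expansions n zs z c m"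
  unfolding expansions_def
  by (rule mod_set_left[OF add_closed_M3]) (use add_closedD(1)[OF add_closed_word_span] in force)

lemma expansions_image:
  assumes x: "x \<in> expansions n zs z c m" and h: "additive h" and T: "add_closed T" "M3 n \<subseteq> T"
    and M: "\<And>y. y \<in> M3 n \<Longrightarrow> h y \<in> M3 n"
    and f: "\<And>g. g \<in> words_of zs m \<Longrightarrow> h (frag_of (replicate c z) * frag_of g) \<in> T"
    and w: "\<And>a g. a # g \<in> words_of zs m \<Longrightarrow>
              h (frag_of (replicate (c - 1) z) * (bracket n [z] [a] * frag_of g)) \<in> T"
  shows "h x \<in> T"
proof -
  interpret additive h by fact
  obtain f' w' where fw: "f' \<in> word_span zs m" "w' \<in> oneforms n zs z m"
    and d: "x - (frag_of (replicate c z) * f' + frag_of (replicate (c - 1) z) * w') \<in> M3 n"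
    using x by (auto simp: expansions_def mod_set_def)
  have a: "additive (\<lambda>y. h (b * y))" for b by standard (simp add: algebra_simps add)
  have "h (frag_of (replicate c z) * f') \<in> T"
    using fw(1) unfolding word_span_def by (rule zspan_image[OF _ a T(1)]) (use f in auto)
  moreover have "h (frag_of (replicate (c - 1) z) * w') \<in> T"
    using fw(2) unfolding oneforms_def by (rule zspan_image[OF _ a T(1)]) (use w in auto)
  moreover have "h (x - (frag_of (replicate c z) * f' + frag_of (replicate (c - 1) z) * w')) \<in> T"
    using M[OF d] T(2) by blast
  ultimately have "h (frag_of (replicate c z) * f') + h (frag_of (replicate (c - 1) z) * w')
     + h (x - (frag_of (replicate c z) * f' + frag_of (replicate (c - 1) z) * w')) \<in> T"
    by (intro add_closedD(4)[OF T(1)])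
  then show ?thesis by (simp add: diff add)
qed

lemma frag_of_snoc_bracket:
  "frag_of (g @ [z]) = (-1) ^ (odd_count n [z] * odd_count n g) * (frag_of (z # g) - bracket n [z] g)"
  by (simp add: bracket_def algebra_simps minus_one_power_iff)

lemma square_bracket:
  "frag_of (replicate c z) * bracket n [z] [z]
    = frag_of (replicate (c + 2) z) - (-1) ^ (odd_count n [z]) * frag_of (replicate (c + 2) z)"
proof -
  have "replicate c z @ [z, z] = replicate (c + 2) z"
    using replicate_add[of c 2 z] by (simp add: numeral_2_eq_2)
  then show ?thesis by (simp add: bracket_def algebra_simps frag_of_mult minus_one_power_iff)
qed

text \<open>Induction on the word, appending letters on the right. A letter of \<open>zs\<close> is absorbed by \<open>f\<close> and \<open>w\<close>. To
append \<open>z\<close>, move it to the left through \<open>f\<close> or through the coefficient of the one-form. The first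
creates a one-form. The second creates a product \<open>[z, a] [z, b]\<close>, which the exchange rule turns into
\<open>[z, z] [a, b]\<close>, a multiple of \<open>z\<^sup>2\<close> times an element free of \<open>z\<close>.\<close>

lemma word_in_expansions:
  assumes "z \<notin> zs" "set w \<subseteq> insert z zs" "z \<in> set w"
  shows "frag_of w \<in> expansions n zs z (count_list w z) (count_list w)"
  using assms(2,3)
proof (induction w rule: rev_induct)
  case (snoc b w)
  let ?m = "count_list (w @ [b])"
  let ?T = "expansions n zs z (?m z) ?m"
  note T = add_closed_expansions[of n zs z "?m z" ?m]
  note MT = M3_subset_expansions[of n zs z "?m z" ?m]
  note ts = two_sidedD[OF two_sided_M3[of n]]
  show ?case
  proof (cases "z \<in> set w")
    case False
    with snoc.prems have b: "b = z" and w: "set w \<subseteq> zs" by auto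
    have c: "?m z = 1" using False b by (simp add: count_list_0_iff)
    have "w \<in> words_of zs ?m" using w b assms(1) by (auto simp: words_of_def)
    then have 1: "frag_of (z # w) \<in> ?T"
      using expansions_word_span[OF word_span_base, of w zs ?m 1 z n] c by (simp add: frag_of_mult)
    have "oneforms n zs z (count_list w) = oneforms n zs z ?m"
      using b assms(1) by (intro oneforms_cong) auto
    then have "bracket n [z] w \<in> mod_set (oneforms n zs z ?m) (M3 n)"
      using bracket_letter_in_oneforms[OF w, of n z] by simp
    then have 2: "bracket n [z] w \<in> ?T"
      using expansions_oneforms[of _ n zs z ?m 1] c MT add_closedD(4)[OF T]
      by (fastforce simp: mod_set_def frag_of_Nil algebra_simps)
    show ?thesis
      unfolding b frag_of_snoc_bracket[of w z n]
      using 1 2 b by (intro add_closed_sign[OF T[unfolded b]] add_closedD(2)[OF T[unfolded b]]) auto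
  next
    case True
    have ws: "set w \<subseteq> insert z zs" using snoc.prems by auto
    have c0: "count_list w z > 0" using True by (metis count_list_0_iff gr0I)
    note IH = snoc.IH[OF ws True]
    have "(\<lambda>x. x * frag_of [b]) (frag_of w) \<in> ?T"
    proof (rule expansions_image[OF IH additive_right T MT])
      show "y * frag_of [b] \<in> M3 n" if "y \<in> M3 n" for y using ts(3)[OF that] .
    next
      fix g assume g: "g \<in> words_of zs (count_list w)"
      show "frag_of (replicate (count_list w z) z) * frag_of g * frag_of [b] \<in> ?T"
      proof (cases "b = z")
        case False
        have "g @ [b] \<in> words_of zs ?m" using g snoc.prems False by (auto simp: words_of_def)
        from expansions_word_span[OF word_span_base[OF this], of "?m z" z n] False show ?thesis
          by (simp add: mult.assoc frag_of_mult)
      next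
        case True
        have gm: "g \<in> words_of zs ?m" using g True assms(1) by (auto simp: words_of_def)
        have gs: "set g \<subseteq> zs" using g by (simp add: words_of_def)
        have "oneforms n zs z (count_list g) = oneforms n zs z ?m"
          using gm by (intro oneforms_cong) (auto simp: words_of_def)
        then obtain h where h: "h \<in> oneforms n zs z ?m" "bracket n [z] g - h \<in> M3 n"
          using bracket_letter_in_oneforms[OF gs, of n z] by (auto simp: mod_set_def)
        let ?Z = "frag_of (replicate (count_list w z) z)"
        have "?Z * h \<in> ?T" using expansions_oneforms[OF h(1), of "?m z"] True by simp
        moreover have "?Z * (bracket n [z] g - h) \<in> ?T" using ts(2)[OF h(2)] MT by blast
        ultimately have 2: "?Z * bracket n [z] g \<in> ?T"
          using add_closedD(4)[OF T] by (fastforce simp: algebra_simps)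
        have 1: "?Z * frag_of (z # g) \<in> ?T"
          using expansions_word_span[OF word_span_base[OF gm], of "?m z" z n] True
          by (simp add: frag_of_mult replicate_app_Cons_same)
        have e: "?Z * frag_of g * frag_of [b]
          = (-1) ^ (odd_count n [z] * odd_count n g) * (?Z * frag_of (z # g) - ?Z * bracket n [z] g)"
          using arg_cong[OF frag_of_snoc_bracket[of g z n], of "\<lambda>x. ?Z * x"] True
          by (simp add: sign_left_comm right_diff_distrib mult.assoc frag_of_snoc[of g])
        show ?thesis unfolding e by (intro add_closed_sign[OF T] add_closedD(2)[OF T] 1 2)
      qed
    next
      fix a g assume ag: "a # g \<in> words_of zs (count_list w)"
      let ?Z = "frag_of (replicate (count_list w z - 1) z)"
      show "?Z * (bracket n [z] [a] * frag_of g) * frag_of [b] \<in> ?T"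
      proof (cases "b = z")
        case False
        have "a # g @ [b] \<in> words_of zs ?m" using ag snoc.prems False by (auto simp: words_of_def)
        from expansions_oneforms[where n=n and c="?m z", OF oneforms_base[OF this]] False show ?thesis
          by (simp add: mult.assoc frag_of_mult)
      next
        case True
        have gm: "a # g \<in> words_of zs ?m" using ag True assms(1) by (auto simp: words_of_def)
        have gs: "set g \<subseteq> zs" using ag by (simp add: words_of_def)
        have ZZ: "?Z * frag_of [z] = frag_of (replicate (count_list w z) z)"
          using c0 by (cases "count_list w z") (simp_all add: frag_of_mult replicate_append_same)
        have 1: "?Z * bracket n [z] [a] * frag_of (z # g) \<in> ?T"
        proof (rule sign_cong_mem[OF T MT])
          have "sign_cong (M3 n) (?Z * (bracket n [z] [a] * frag_of [z]) * frag_of g)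
                  (?Z * (frag_of [z] * bracket n [z] [a]) * frag_of g)"
            by (rule sign_cong_mult[OF two_sided_M3 bracket_central])
          then show "sign_cong (M3 n) (?Z * bracket n [z] [a] * frag_of (z # g))
              (?Z * frag_of [z] * (bracket n [z] [a] * frag_of g))"
            by (simp add: frag_of_Cons[of z g] mult.assoc)
          show "?Z * frag_of [z] * (bracket n [z] [a] * frag_of g) \<in> ?T"
            unfolding ZZ using expansions_oneforms[where n=n and c="?m z", OF oneforms_base[OF gm]] True by simp
        qed
        have 2: "?Z * bracket n [z] [a] * bracket n [z] g \<in> ?T"
        proof (rule mod_set_image[OF _ additive_left T])
          show "bracket n [z] g \<in> mod_set (zspan (oneform_words n zs z (count_list g))) (M3 n)"
            using bracket_letter_in_oneforms[OF gs] by (simp add: oneforms_def)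
          show "?Z * bracket n [z] [a] * y \<in> ?T" if "y \<in> M3 n" for y using ts(2)[OF that] MT by blast
          fix s assume "s \<in> oneform_words n zs z (count_list g)"
          then obtain b' h where s: "s = bracket n [z] [b'] * frag_of h" and bh: "b' # h \<in> words_of zs (count_list g)" by auto
          have abh: "a # b' # h \<in> words_of zs ?m" using gm bh by (auto simp: words_of_def)
          have p: "frag_of (replicate (?m z) z) * (bracket n [a] [b'] * frag_of h) \<in> ?T"
            by (rule expansions_word_span[OF word_span_bracket[OF abh]])
          have "count_list w z - 1 + 2 = ?m z" using c0 True by simp
          then have q: "?Z * bracket n [z] [z] = frag_of (replicate (?m z) z) - (-1) ^ (odd_count n [z]) * frag_of (replicate (?m z) z)"
            using square_bracket[of "count_list w z - 1" z n] by simp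
          show "?Z * bracket n [z] [a] * s \<in> ?T"
          proof (rule sign_cong_mem[OF T MT])
            have "sign_cong (M3 n) (?Z * (bracket n [z] [a] * bracket n [z] [b']) * frag_of h)
                  (?Z * (bracket n [z] [z] * bracket n [a] [b']) * frag_of h)"
              by (rule sign_cong_mult[OF two_sided_M3 sign_cong_bracket_exchange])
            then show "sign_cong (M3 n) (?Z * bracket n [z] [a] * s) (?Z * bracket n [z] [z] * (bracket n [a] [b'] * frag_of h))"
              by (simp add: s mult.assoc)
            have "frag_of (replicate (?m z) z) * (bracket n [a] [b'] * frag_of h)
              - (-1) ^ (odd_count n [z]) * (frag_of (replicate (?m z) z) * (bracket n [a] [b'] * frag_of h)) \<in> ?T"
              by (intro add_closedD(2)[OF T] add_closed_sign[OF T] p)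
            then show "?Z * bracket n [z] [z] * (bracket n [a] [b'] * frag_of h) \<in> ?T"
              unfolding q by (simp add: left_diff_distrib mult.assoc)
          qed
        qed
        have e: "?Z * (bracket n [z] [a] * frag_of g) * frag_of [b]
          = (-1) ^ (odd_count n [z] * odd_count n g) * (?Z * bracket n [z] [a] * frag_of (z # g) - ?Z * bracket n [z] [a] * bracket n [z] g)"
          using arg_cong[OF frag_of_snoc_bracket[of g z n], of "\<lambda>x. ?Z * bracket n [z] [a] * x"] True
          by (simp add: sign_left_comm right_diff_distrib mult.assoc frag_of_snoc[of g])
        show ?thesis unfolding e by (intro add_closed_sign[OF T] add_closedD(2)[OF T] 1 2)
      qed
    qed
    then show ?thesis unfolding frag_of_mult .
  qed
qed simp

lemma word_span_in_expansions:
  assumes "z \<notin> zs" "x \<in> word_span (insert z zs) m" "m z > 0"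
  shows "x \<in> expansions n zs z (m z) m"
proof -
  have "frag_of w \<in> expansions n zs z (m z) m" if w: "w \<in> words_of (insert z zs) m" for w
  proof -
    have "expansions n zs z (count_list w z) (count_list w) = expansions n zs z (m z) m"
      using w word_span_cong[of zs "count_list w" m] oneforms_cong[of zs "count_list w" m]
      by (simp add: expansions_def words_of_def)
    moreover have "z \<in> set w" using w assms(3) by (auto simp: words_of_def count_list_0_iff intro: ccontr)
    ultimately show ?thesis using word_in_expansions[OF assms(1), of w n] w by (simp add: words_of_def)
  qed
  then show ?thesis using zspan_least[OF assms(2)[unfolded word_span_def] add_closed_expansions] by blast
qed

text \<open>The analogue for one-forms: one with respect to the remaining letters, plus a multiple of \<open>[v, z]\<close>.\<close>

definition oneform_expansions :: "nat \<Rightarrow> nat set \<Rightarrow> nat \<Rightarrow> nat \<Rightarrow> nat \<Rightarrow> (nat \<Rightarrow> nat) \<Rightarrow> free_ring set" where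
  "oneform_expansions n zs v z c m = mod_set {frag_of (replicate c z) * w + (frag_of (replicate (c - 1) z) * bracket n [v] [z]) * f |w f.
     w \<in> oneforms n zs v m \<and> f \<in> word_span zs m} (M3 n)"

text \<open>Expand the coefficient of \<open>[v, a]\<close> in powers of \<open>z\<close>. The one-form part contributes
\<open>[v, a] [z, b]\<close>, and the exchange rule gives \<open>[v, z] [a, b]\<close> if \<open>a \<noteq> z\<close>, and \<open>[z, z] [v, b]\<close> if \<open>a = z\<close>.\<close>

lemma oneforms_in_oneform_expansions:
  assumes z: "z \<notin> zs" and x: "x \<in> oneforms n (insert z zs) v m" and mz: "m z > 0"
  shows "x \<in> oneform_expansions n zs v z (m z) m"
proof -
  let ?T = "oneform_expansions n zs v z (m z) m"
  let ?P = "\<lambda>c. frag_of (replicate c z)"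
  let ?u = "\<lambda>a b. bracket n [a] [b]"
  note ts = two_sidedD[OF two_sided_M3[of n]]
  have T: "add_closed ?T" unfolding oneform_expansions_def
    by (intro add_closed_mod_set add_closed_pair_sums add_closed_word_span add_closed_oneforms add_closed_M3)
  have MT: "M3 n \<subseteq> ?T" unfolding oneform_expansions_def
    by (blast intro: mod_set_right add_closed_pair_sums add_closed_word_span add_closed_oneforms)
  have Tw: "?P (m z) * w \<in> ?T" if "w \<in> oneforms n zs v m" for w
    unfolding oneform_expansions_def
    by (rule mod_set_left[OF add_closed_M3]) (use that add_closedD(1)[OF add_closed_word_span] in force)
  have Tf: "?P (m z - 1) * ?u v z * f \<in> ?T" if "f \<in> word_span zs m" for f
    unfolding oneform_expansions_def
    by (rule mod_set_left[OF add_closed_M3]) (use that add_closedD(1)[OF add_closed_oneforms] in force)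
  have gen: "?u v a * frag_of g \<in> ?T" if ag: "a # g \<in> words_of (insert z zs) m" for a g
  proof -
    have gs: "set g \<subseteq> insert z zs" using ag by (auto simp: words_of_def)
    have move: "sign_cong (M3 n) (?u v a * (?P c * y)) (?P c * (?u v a * y))" for c a y
      using sign_cong_mult[OF two_sided_M3 bracket_central[of n "[v]" "[a]" "replicate c z"], of 1 y] by (simp add: mult.assoc)
    show ?thesis
    proof (cases "a = z")
      case True
      then have cg: "count_list g z = m z - 1" using ag by (auto simp: words_of_def)
      have cong: "count_list g i = m i" if "i \<in> zs" for i using that ag True z by (auto simp: words_of_def split: if_splits)
      show ?thesis
      proof (cases "z \<in> set g")
        case False
        then have "m z - 1 = 0" using cg by (simp add: count_list_0_iff)
        moreover have "g \<in> words_of zs m" using False gs cong by (auto simp: words_of_def)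
        ultimately show ?thesis using Tf[OF word_span_base, of g] True by (simp add: frag_of_Nil)
      next
        case zg: True
        then have m1: "m z - 1 > 0" using cg by (metis count_list_0_iff gr0I)
        show ?thesis unfolding True
        proof (rule expansions_image[OF word_in_expansions[OF z gs zg] additive_left T MT])
          show "?u v z * y \<in> M3 n" if "y \<in> M3 n" for y using ts(2)[OF that] .
        next
          fix g' assume "g' \<in> words_of zs (count_list g)"
          then have "frag_of g' \<in> word_span zs m" using words_of_cong[OF cong] by (simp add: word_span_base)
          then show "?u v z * (?P (count_list g z) * frag_of g') \<in> ?T"
            using sign_cong_mem[OF T MT move] Tf by (simp add: cg mult.assoc)
        next
          fix b g' assume "b # g' \<in> words_of zs (count_list g)"
          then have "b # g' \<in> words_of zs m" using words_of_cong[OF cong] by simp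
          note w = Tw[OF oneforms_base[OF this, of n v]]
          have "m z - 1 - 1 + 2 = m z" using m1 by simp
          then have q: "?P (m z - 1 - 1) * ?u z z = ?P (m z) - (-1) ^ (odd_count n [z]) * ?P (m z)"
            using square_bracket[of "m z - 1 - 1" z n] by simp
          have "?P (m z) * (?u v b * frag_of g') - (-1) ^ (odd_count n [z]) * (?P (m z) * (?u v b * frag_of g')) \<in> ?T"
            by (intro add_closedD(2)[OF T] add_closed_sign[OF T] w)
          then have 1: "?P (m z - 1 - 1) * ?u z z * (?u v b * frag_of g') \<in> ?T"
            unfolding q by (simp add: left_diff_distrib mult.assoc)
          have "sign_cong (M3 n) (?P (m z - 1 - 1) * (?u v z * ?u z b) * frag_of g') (?P (m z - 1 - 1) * (?u z z * ?u v b) * frag_of g')"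
          proof (rule sign_cong_mult[OF two_sided_M3])
            have "sign_cong (M3 n) (1 * ?u v z * ?u z b) (1 * ?u z v * ?u z b)"
              by (rule sign_cong_mult[OF two_sided_M3 sign_cong_bracket_swap])
            then show "sign_cong (M3 n) (?u v z * ?u z b) (?u z z * ?u v b)"
              using sign_cong_trans[OF add_closed_M3 _ sign_cong_bracket_exchange] by simp
          qed
          then have "sign_cong (M3 n) (?P (m z - 1 - 1) * (?u v z * (?u z b * frag_of g'))) (?P (m z - 1 - 1) * ?u z z * (?u v b * frag_of g'))"
            by (simp add: mult.assoc)
          from sign_cong_trans[OF add_closed_M3 move this]
          show "?u v z * (?P (count_list g z - 1) * (?u z b * frag_of g')) \<in> ?T"
            unfolding cg by (rule sign_cong_mem[OF T MT _ 1])
        qed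
      qed
    next
      case False
      then have az: "a \<in> zs" using ag by (auto simp: words_of_def)
      have cg: "count_list g z = m z" using ag False by (auto simp: words_of_def)
      have zg: "z \<in> set g" using cg mz by (metis count_list_0_iff less_numeral_extra(3))
      have cons: "a # h \<in> words_of zs m" if "h \<in> words_of zs (count_list g)" for h
        using that ag az z by (auto simp: words_of_def)
      show ?thesis
      proof (rule expansions_image[OF word_in_expansions[OF z gs zg] additive_left T MT])
        show "?u v a * y \<in> M3 n" if "y \<in> M3 n" for y using ts(2)[OF that] .
      next
        fix g' assume "g' \<in> words_of zs (count_list g)"
        from Tw[OF oneforms_base[OF cons[OF this], of n v]]
        show "?u v a * (?P (count_list g z) * frag_of g') \<in> ?T"
          unfolding cg by (rule sign_cong_mem[OF T MT move])
      next
        fix b g' assume "b # g' \<in> words_of zs (count_list g)"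
        note 1 = Tf[OF word_span_bracket[OF cons[OF this], of n]]
        have "sign_cong (M3 n) (?P (m z - 1) * (?u v a * ?u z b) * frag_of g') (?P (m z - 1) * (?u v z * ?u a b) * frag_of g')"
          by (rule sign_cong_mult[OF two_sided_M3 sign_cong_bracket_exchange])
        then have "sign_cong (M3 n) (?P (m z - 1) * (?u v a * (?u z b * frag_of g'))) (?P (m z - 1) * ?u v z * (?u a b * frag_of g'))"
          by (simp add: mult.assoc)
        from sign_cong_trans[OF add_closed_M3 move this]
        show "?u v a * (?P (count_list g z - 1) * (?u z b * frag_of g')) \<in> ?T"
          unfolding cg by (rule sign_cong_mem[OF T MT _ 1])
      qed
    qed
  qed
  show ?thesis
    using x unfolding oneforms_def by (rule zspan_least[OF _ T]) (use gen in auto)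
qed

section \<open>Induction on the letters\<close>

lemma zspan_one: "x \<in> zspan {1::'a::ring_1} \<Longrightarrow> \<exists>k. x = of_int k"
proof (induction rule: zspan.induct)
  case zero then show ?case by (intro exI[of _ 0]) simp
next
  case (base x) then show ?case by (intro exI[of _ 1]) simp
next
  case (diff x y) then show ?case by (metis of_int_diff)
qed

text \<open>A map that kills \<open>M\<^sub>3\<close> and separates the two terms of each expansion has its kernel in \<open>I\<close>, provided this is
true for constants. Elements and one-forms have to be treated together, since the expansion of
either contains both.\<close>

lemma kernel_detection:
  fixes \<Theta> :: "free_ring \<Rightarrow> 'v::ab_group_add"
  assumes add: "additive \<Theta>" and I: "two_sided I" "M3 n \<subseteq> I" and ker: "\<And>x. x \<in> M3 n \<Longrightarrow> \<Theta> x = 0"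
    and base: "\<And>k. \<Theta> (of_int k) = 0 \<Longrightarrow> of_int k \<in> I"
    and step_word_span: "\<And>zs z m c f w. finite zs \<Longrightarrow> z \<notin> zs \<Longrightarrow> c > 0 \<Longrightarrow> f \<in> word_span zs m \<Longrightarrow> w \<in> oneforms n zs z m \<Longrightarrow>
      \<Theta> (frag_of (replicate c z) * f + frag_of (replicate (c - 1) z) * w) = 0 \<Longrightarrow> \<Theta> f = 0 \<and> \<Theta> w = 0"
    and step_forms: "\<And>zs v z m c f w. finite zs \<Longrightarrow> z \<notin> zs \<Longrightarrow> v \<notin> insert z zs \<Longrightarrow> c > 0 \<Longrightarrow> w \<in> oneforms n zs v m \<Longrightarrow> f \<in> word_span zs m \<Longrightarrow>
      \<Theta> (frag_of (replicate c z) * w + frag_of (replicate (c - 1) z) * bracket n [v] [z] * f) = 0 \<Longrightarrow> \<Theta> w = 0 \<and> \<Theta> f = 0"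
    and "finite zs" and pos: "\<And>i. i \<in> zs \<Longrightarrow> m i > 0"
  shows "(\<forall>x\<in>word_span zs m. \<Theta> x = 0 \<longrightarrow> x \<in> I) \<and> (\<forall>v. v \<notin> zs \<longrightarrow> (\<forall>x\<in>oneforms n zs v m. \<Theta> x = 0 \<longrightarrow> x \<in> I))"
  using \<open>finite zs\<close> pos
proof (induction zs rule: finite_induct)
  case empty
  have "words_of {} m = {[]}" by (auto simp: words_of_def)
  then have "word_span {} m = zspan {1}" "oneforms n {} v m = zspan {}" for v
    by (simp_all add: word_span_def oneforms_def frag_of_Nil)
  moreover have "x = 0" if "x \<in> zspan {}" for x :: free_ring
    using that by (induction rule: zspan.induct) auto
  ultimately show ?case
    using base zspan_one add_closedD(1)[OF two_sidedD(1)[OF I(1)]] by fastforce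
next
  case (insert z zs)
  interpret additive \<Theta> by (rule add)
  note c = add_closedD(4)[OF two_sidedD(1)[OF I(1)]]
  note l = two_sidedD(2)[OF I(1)]
  have mz: "m z > 0" using insert.prems by simp
  have IH: "x \<in> word_span zs m \<Longrightarrow> \<Theta> x = 0 \<Longrightarrow> x \<in> I"
     "v \<notin> zs \<Longrightarrow> x \<in> oneforms n zs v m \<Longrightarrow> \<Theta> x = 0 \<Longrightarrow> x \<in> I" for x v
    using insert.IH insert.prems by auto
  show ?case
  proof (intro conjI ballI allI impI)
    fix x assume x: "x \<in> word_span (insert z zs) m" "\<Theta> x = 0"
    obtain f w where fw: "f \<in> word_span zs m" "w \<in> oneforms n zs z m"
      and d: "x - (frag_of (replicate (m z) z) * f + frag_of (replicate (m z - 1) z) * w) \<in> M3 n"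
      using word_span_in_expansions[OF insert.hyps(2) x(1) mz, of n] by (auto simp: expansions_def mod_set_def)
    have "\<Theta> (frag_of (replicate (m z) z) * f + frag_of (replicate (m z - 1) z) * w) = 0"
      using ker[OF d] x(2) by (simp add: diff)
    from step_word_span[OF insert.hyps mz fw this] have "f \<in> I" "w \<in> I"
      using IH fw insert.hyps(2) by auto
    then have "frag_of (replicate (m z) z) * f + frag_of (replicate (m z - 1) z) * w \<in> I"
      by (intro c l)
    from c[OF this] d I(2) show "x \<in> I" by fastforce
  next
    fix v x assume v: "v \<notin> insert z zs" and x: "x \<in> oneforms n (insert z zs) v m" "\<Theta> x = 0"
    obtain f w where fw: "w \<in> oneforms n zs v m" "f \<in> word_span zs m"
      and d: "x - (frag_of (replicate (m z) z) * w + frag_of (replicate (m z - 1) z) * bracket n [v] [z] * f) \<in> M3 n"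
      using oneforms_in_oneform_expansions[where m=m, OF insert.hyps(2) x(1) mz] by (auto simp: oneform_expansions_def mod_set_def)
    have "\<Theta> (frag_of (replicate (m z) z) * w + frag_of (replicate (m z - 1) z) * bracket n [v] [z] * f) = 0"
      using ker[OF d] x(2) by (simp add: diff)
    from step_forms[OF insert.hyps v mz fw this] have "f \<in> I" "w \<in> I"
      using IH fw v by auto
    then have "frag_of (replicate (m z) z) * w + frag_of (replicate (m z - 1) z) * bracket n [v] [z] * f \<in> I"
      by (intro c l)
    from c[OF this] d I(2) show "x \<in> I" by fastforce
  qed
qed



section \<open>Operators on the exterior algebra\<close>

type_synonym exterior = "nat set \<Rightarrow> int"

text \<open>Additive endomorphisms, made into a type so that the ring identities among the generating operators can
be handled by the simplifier.\<close>

typedef operator = "{f :: exterior \<Rightarrow> exterior. additive f}" morphisms app Operator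
  by (intro exI[of _ "\<lambda>x. x"]) (simp add: additive_def)

setup_lifting type_definition_operator

instantiation operator :: ring_1
begin
lift_definition zero_operator :: operator is "\<lambda>x. 0" by (simp add: additive_def)
lift_definition one_operator :: operator is "\<lambda>x. x" by (simp add: additive_def)
lift_definition plus_operator :: "operator \<Rightarrow> operator \<Rightarrow> operator" is "\<lambda>f g x. f x + g x"
  by (simp add: additive_def)
lift_definition minus_operator :: "operator \<Rightarrow> operator \<Rightarrow> operator" is "\<lambda>f g x. f x - g x"
  by (simp add: additive_def)
lift_definition uminus_operator :: "operator \<Rightarrow> operator" is "\<lambda>f x. - f x"
  by (simp add: additive_def)
lift_definition times_operator :: "operator \<Rightarrow> operator \<Rightarrow> operator" is "\<lambda>f g x. f (g x)"
  by (simp add: additive_def)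
instance
proof
  show "(0::operator) \<noteq> 1"
  proof transfer
    show "(\<lambda>x::exterior. 0) \<noteq> (\<lambda>x. x)"
    proof
      assume "(\<lambda>x::exterior. 0) = (\<lambda>x. x)"
      from fun_cong[OF this, of "\<lambda>S. 1"] have "(0::exterior) = (\<lambda>S. 1)" .
      from fun_cong[OF this, of "{}"] show False by simp
    qed
  qed
qed (transfer; simp add: fun_eq_iff additive_def)+
end

lemma app_simps [simp]:
  "app 0 x = 0" "app 1 x = x" "app (a + b) x = app a x + app b x" "app (a - b) x = app a x - app b x"
  "app (- a) x = - app a x" "app (a * b) x = app a (app b x)"
  by (transfer; simp)+

lemma app_additive [simp]: "app a (x + y) = app a x + app a y" "app a 0 = 0" "app a (x - y) = app a x - app a y" "app a (- x) = - app a x"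
proof -
  interpret additive "app a" using app[of a] by simp
  show "app a (x + y) = app a x + app a y" "app a 0 = 0" "app a (x - y) = app a x - app a y" "app a (- x) = - app a x"
    by (simp_all add: add zero diff minus)
qed

lemma operator_eqI: "(\<And>x S. app a x S = app b x S) \<Longrightarrow> a = b"
  by (metis app_inject ext)

text \<open>Left multiplication by the generator \<open>\<eta>\<^sub>a\<close> of the exterior algebra, a vector being the function of its
coefficients. Infinite sets are excluded because \<open>card\<close> is zero on them, and
the operator would not anticommute with the parity operator there.\<close>

lift_definition wedge :: "nat \<Rightarrow> operator" is
  "\<lambda>a x S. if a \<in> S \<and> finite S then (-1) ^ card {j \<in> S. j < a} * x (S - {a}) else 0"
  by (auto simp: additive_def fun_eq_iff algebra_simps)

lift_definition parity :: operator is "\<lambda>x S. (-1) ^ card S * x S"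
  by (auto simp: additive_def fun_eq_iff algebra_simps)

lemma app_wedge: "app (wedge a) x S = (if a \<in> S \<and> finite S then (-1) ^ card {j \<in> S. j < a} * x (S - {a}) else 0)"
  and app_parity: "app parity x S = (-1) ^ card S * x S"
  by (transfer; simp)+

lemma wedge_square: "wedge a * wedge a = 0"
  by (rule operator_eqI) (simp add: app_wedge)

lemma wedge_anticommute_less:
  assumes "a < b" shows "wedge a * wedge b = - (wedge b * wedge a)"
proof (rule operator_eqI)
  fix x S
  show "app (wedge a * wedge b) x S = app (- (wedge b * wedge a)) x S"
  proof (cases "a \<in> S \<and> b \<in> S \<and> finite S")
    case True
    have 1: "{j \<in> S - {b}. j < a} = {j \<in> S. j < a}" using assms by auto
    have 2: "{j \<in> S. j < b} = insert a {j \<in> S - {a}. j < b}" using assms True by auto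
    have "card {j \<in> S. j < b} = Suc (card {j \<in> S - {a}. j < b})"
      unfolding 2 by (rule card_insert_disjoint) auto
    moreover have "S - {b} - {a} = S - {a} - {b}" by auto
    ultimately show ?thesis using assms True 1 by (simp add: app_wedge)
  next
    case False
    then show ?thesis using assms by (auto simp: app_wedge)
  qed
qed

lemma wedge_anticommute: "wedge a * wedge b = - (wedge b * wedge a)"
  using wedge_anticommute_less[of a b] wedge_anticommute_less[of b a] wedge_square[of a]
  by (cases a b rule: linorder_cases) auto

lemma parity_square: "parity * parity = 1"
  by (rule operator_eqI) (simp add: app_parity flip: mult.assoc power_add)

lemma parity_wedge: "parity * wedge a = - (wedge a * parity)"
proof (rule operator_eqI)
  fix x S
  show "app (parity * wedge a) x S = app (- (wedge a * parity)) x S"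
  proof (cases "a \<in> S \<and> finite S")
    case True
    then obtain k where "card S = Suc k" by (metis card_Suc_Diff1)
    then show ?thesis using True by (simp add: app_parity app_wedge)
  qed (auto simp: app_parity app_wedge)
qed

text \<open>Classically an even variable is represented by \<open>x + dx \<theta>\<close> and an odd one by \<open>y + dy \<theta>\<close>, with \<open>\<theta>\<^sup>2 = 1\<close> odd. In a fixed
multidegree the polynomial variables \<open>x\<close> and \<open>dy\<close> can be set to \<open>1\<close>. This leaves \<open>1 + \<eta>\<close>
with \<open>\<eta> = dx \<theta>\<close> for an even variable, and \<open>y + \<theta> = (1 + \<eta>) \<theta>\<close> with \<open>\<eta> = y \<theta>\<close> for an odd one.\<close>

definition letter_op :: "nat \<Rightarrow> nat \<Rightarrow> operator" where
  "letter_op n a = (1 + wedge a) * (if a < n then 1 else parity)"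

definition word_op :: "nat \<Rightarrow> nat list \<Rightarrow> operator" where
  "word_op n w = prod_list (map (letter_op n) w)"

lemma word_op_simps [simp]: "word_op n [] = 1" "word_op n (a # w) = letter_op n a * word_op n w"
  and word_op_append: "word_op n (u @ v) = word_op n u * word_op n v"
  by (simp_all add: word_op_def)

abbreviation operator_rep :: "nat \<Rightarrow> free_ring \<Rightarrow> operator" where
  "operator_rep n \<equiv> linear_ext (word_op n)"

lemma operator_rep_mult: "operator_rep n (x * y) = operator_rep n x * operator_rep n y"
  by (rule linear_ext_mult) (rule word_op_append)

lemma odd_count_single: "odd_count n [a] = (if a < n then 0 else 1)"
  by (simp add: odd_count_def)

lemma odd_count_Cons: "odd_count n (a # w) = odd_count n [a] + odd_count n w"
  using odd_count_append[of n "[a]" w] by simp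

text \<open>Anticommutativity alone would only give \<open>2 p p = 0\<close>, so the square is followed along the span.\<close>

lemma wedge_span:
  assumes "p \<in> zspan (range wedge)"
  shows "parity * p = - (p * parity)" "r \<in> zspan (range wedge) \<Longrightarrow> p * r = - (r * p)" "p * p = 0"
proof -
  show "parity * p = - (p * parity)"
    using assms
  proof induction
    case (base x) then show ?case using parity_wedge by blast
  qed (simp_all add: algebra_simps)
  have 1: "q * wedge a = - (wedge a * q)" if "q \<in> zspan (range wedge)" for a q
    using that
  proof induction
    case (base x) then show ?case using wedge_anticommute by blast
  qed (simp_all add: algebra_simps)
  have 2: "p * r = - (r * p)" if "p \<in> zspan (range wedge)" "r \<in> zspan (range wedge)" for p r
    using that(2)
  proof induction
    case (base x) then show ?case using 1[OF that(1)] by auto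
  qed (simp_all add: algebra_simps)
  show "r \<in> zspan (range wedge) \<Longrightarrow> p * r = - (r * p)" by (rule 2[OF assms])
  show "p * p = 0" using assms
  proof induction
    case (base x) then show ?case by (auto simp: wedge_square)
  next
    case (diff x y) then show ?case using 2[of x y] by (simp add: algebra_simps)
  qed simp
qed

lemma wedge_span_sandwich:
  assumes "p \<in> zspan (range wedge)" "q \<in> zspan (range wedge)"
  shows "p * (q * p) = 0"
proof -
  have "p * (q * p) = (p * q) * p" by (rule mult.assoc[symmetric])
  also have "\<dots> = - (q * (p * p))" unfolding wedge_span(2)[OF assms] by (simp add: mult.assoc)
  finally show ?thesis using wedge_span(3)[OF assms(1)] by simp
qed

definition even_central :: "operator set" where
  "even_central = {x. (\<forall>a. x * wedge a = wedge a * x) \<and> x * parity = parity * x}"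

lemma even_central_closed:
  "1 \<in> even_central" "x \<in> even_central \<Longrightarrow> y \<in> even_central \<Longrightarrow> x + y \<in> even_central"
  "x \<in> even_central \<Longrightarrow> y \<in> even_central \<Longrightarrow> x * y \<in> even_central"
  "x \<in> even_central \<Longrightarrow> - x \<in> even_central"
  "p \<in> zspan (range wedge) \<Longrightarrow> r \<in> zspan (range wedge) \<Longrightarrow> p * r \<in> even_central"
proof -
  assume y: "x \<in> even_central" "y \<in> even_central"
  show "x + y \<in> even_central" using y by (simp add: even_central_def algebra_simps)
  have *: "x * y * c = c * (x * y)" if "x * c = c * x" "y * c = c * y" for c
    using that by (metis mult.assoc)
  show "x * y \<in> even_central" using y * by (simp add: even_central_def)
next
  assume p: "p \<in> zspan (range wedge)" "r \<in> zspan (range wedge)"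
  have *: "p * r * c = c * (p * r)" if "p * c = - (c * p)" "r * c = - (c * r)" for c
  proof -
    have "p * r * c = - (p * c * r)" using that(2) by (simp add: mult.assoc)
    also have "\<dots> = c * (p * r)" using that(1) by (simp add: mult.assoc)
    finally show ?thesis .
  qed
  show "p * r \<in> even_central"
    using * wedge_span(2)[OF p(1) zspan.base] wedge_span(2)[OF p(2) zspan.base] wedge_span(1)[OF p(1)] wedge_span(1)[OF p(2)]
    by (simp add: even_central_def)
qed (simp_all add: even_central_def)

text \<open>Products of factors \<open>1 + p r\<close> with \<open>p\<close> and \<open>r\<close> of exterior degree one. They are even elements of the exterior algebra, hence
commute with each other and with all generators.\<close>

inductive_set even_products :: "operator set" where
  one: "1 \<in> even_products"
| step: "p \<in> zspan (range wedge) \<Longrightarrow> r \<in> zspan (range wedge) \<Longrightarrow> e \<in> even_products \<Longrightarrow> (1 + p * r) * e \<in> even_products"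

lemma even_products_central: "e \<in> even_products \<Longrightarrow> e \<in> even_central"
  by (induction rule: even_products.induct) (auto intro: even_central_closed)

lemma even_products_commute_span:
  assumes "e \<in> even_products" "q \<in> zspan (range wedge)" shows "q * e = e * q"
  using assms(2)
proof induction
  case (base x) then show ?case using even_products_central[OF assms(1)] by (auto simp: even_central_def)
qed (simp_all add: algebra_simps)

lemma even_products_commute:
  assumes "e \<in> even_products" "f \<in> even_products" shows "e * f = f * e"
  using assms(1)
proof induction
  case (step p r e)
  note c = even_products_commute_span[OF assms(2)]
  have "p * r * f = f * (p * r)" using c[OF step.hyps(1)] c[OF step.hyps(2)] by (metis mult.assoc)
  then have "(1 + p * r) * f = f * (1 + p * r)" by (simp add: algebra_simps)
  then show ?case using step.IH by (metis mult.assoc)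
qed simp

text \<open>The identity \<open>(1 + h) (1 + p) = (1 + (h + p)) (1 + h p)\<close> collects the factors of a word.\<close>

lemma word_op_factorization:
  "\<exists>p\<in>zspan (range wedge). \<exists>e\<in>even_products. word_op n w = (1 + p) * e * parity ^ odd_count n w"
proof (induction w)
  case Nil
  show ?case by (rule bexI[of _ 0], rule bexI[of _ 1]) (auto intro: zspan.zero even_products.one)
next
  case (Cons a w)
  then obtain p e where p: "p \<in> zspan (range wedge)" and e: "e \<in> even_products"
    and w: "word_op n w = (1 + p) * e * parity ^ odd_count n w" by blast
  let ?h = "wedge a"
  have h: "?h \<in> zspan (range wedge)" by (rule zspan.base) simp
  have ep: "parity * e = e * parity" using even_products_central[OF e] by (simp add: even_central_def)
  show ?case
  proof (cases "a < n")
    case True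
    have "(1 + ?h) * (1 + p) = (1 + (?h + p)) * (1 + ?h * p)"
    proof -
      have "p * (?h * p) = 0" by (rule wedge_span_sandwich[OF p h])
      moreover have "?h * (?h * p) = 0" by (simp add: wedge_square flip: mult.assoc)
      ultimately show ?thesis by (simp add: algebra_simps)
    qed
    then have "word_op n (a # w) = (1 + (?h + p)) * ((1 + ?h * p) * e) * parity ^ odd_count n (a # w)"
      using True by (simp add: w letter_op_def odd_count_Cons[of n a] odd_count_single mult.assoc[symmetric])
    moreover have "?h + p \<in> zspan (range wedge)" using add_closedD(4)[OF add_closed_zspan h p] .
    moreover have "(1 + ?h * p) * e \<in> even_products"
      by (intro even_products.step e h p)
    ultimately show ?thesis by blast
  next
    case False
    have "(1 + ?h) * parity * ((1 + p) * e) = (1 + (?h - p)) * ((1 + - (?h * p)) * e) * parity"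
    proof -
      have 0: "p * (?h * p) = 0" by (rule wedge_span_sandwich[OF p h])
      have 1: "?h * (?h * p) = 0" by (simp add: wedge_square flip: mult.assoc)
      have "parity * ((1 + p) * e) = (1 - p) * e * parity"
      proof -
        have "parity * (p * e) = - (p * (parity * e))"
          using wedge_span(1)[OF p] by (metis mult.assoc mult_minus_left)
        then show ?thesis using ep by (simp add: algebra_simps)
      qed
      then have "(1 + ?h) * parity * ((1 + p) * e) = ((1 + ?h) * (1 - p)) * e * parity"
        by (simp add: mult.assoc)
      also have "(1 + ?h) * (1 - p) = (1 + (?h - p)) * (1 + - (?h * p))"
        using 0 1 by (simp add: algebra_simps)
      finally show ?thesis by (simp add: mult.assoc)
    qed
    then have "word_op n (a # w) = (1 + (?h - p)) * ((1 + - (?h * p)) * e) * parity ^ odd_count n (a # w)"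
      using False by (simp add: w letter_op_def odd_count_Cons[of n a] odd_count_single mult.assoc[symmetric])
    moreover have "?h - p \<in> zspan (range wedge)" using zspan.diff[OF h p] .
    moreover have "- p \<in> zspan (range wedge)" using add_closedD(3)[OF add_closed_zspan p] .
    then have "(1 + - (?h * p)) * e \<in> even_products"
      using even_products.step[OF h _ e] by fastforce
    ultimately show ?thesis by blast
  qed
qed

lemma parity_power: "parity ^ k = (if even k then 1 else parity)"
proof (induction k)
  case (Suc k) then show ?case by (simp add: parity_square)
qed simp

text \<open>Every superbracket lands in the subalgebra of even elements of the exterior algebra and
of odd elements times \<open>\<theta>\<close>, and this subalgebra is supercentral.\<close>

lemma bracket_op_forms:
  obtains g where "g \<in> even_central" "even (odd_count n u + odd_count n v)" "operator_rep n (bracket n u v) = 2 * g"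
  | q g where "q \<in> zspan (range wedge)" "g \<in> even_central" "odd (odd_count n u + odd_count n v)"
      "operator_rep n (bracket n u v) = 2 * (q * g * parity)"
proof -
  obtain p e where p: "p \<in> zspan (range wedge)" and e: "e \<in> even_products"
    and u: "word_op n u = (1 + p) * e * parity ^ odd_count n u" using word_op_factorization by blast
  obtain r f where r: "r \<in> zspan (range wedge)" and f: "f \<in> even_products"
    and v: "word_op n v = (1 + r) * f * parity ^ odd_count n v" using word_op_factorization by blast
  interpret additive "operator_rep n" by (rule additive_linear_ext)
  have sgn: "operator_rep n ((-1) ^ k * x) = (-1) ^ k * operator_rep n x" for k x
    by (cases "even k") (simp_all add: minus)
  have c: "operator_rep n (bracket n u v)
     = word_op n u * word_op n v - (-1) ^ (odd_count n u * odd_count n v) * (word_op n v * word_op n u)"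
    by (simp add: bracket_def diff sgn word_op_append)
  define g where "g = e * f"
  have g: "g \<in> even_central" unfolding g_def
    using e f by (intro even_central_closed even_products_central)
  have prod: "(1 + p) * e * P * ((1 + r) * f * Q) = (1 + p) * (1 + s * r) * g * (P * Q)"
    if "P = (if even k then 1 else parity)" "s = (-1) ^ k"
      "p \<in> zspan (range wedge)" "r \<in> zspan (range wedge)" "e \<in> even_products" "f \<in> even_products" "g = e * f"
    for p r e f g s P Q and k :: nat
  proof -
    have comm: "P * (1 + r) = (1 + s * r) * P" "P * f = f * P" "e * (1 + s * r) = (1 + s * r) * e"
    proof -
    show "P * (1 + r) = (1 + s * r) * P"
      using that(1,2) wedge_span(1)[OF that(4)] by (simp add: algebra_simps)
    show "P * f = f * P" using that(1) even_products_central[OF that(6)] by (auto simp: even_central_def)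
    show "e * (1 + s * r) = (1 + s * r) * e"
      using that(2) even_products_commute_span[OF that(5,4)] by (cases "even k") (simp_all add: algebra_simps)
    qed
    have "(1 + p) * e * P * ((1 + r) * f * Q) = (1 + p) * e * (P * (1 + r)) * f * Q" by (simp add: mult.assoc)
    also have "\<dots> = (1 + p) * (e * (1 + s * r)) * (P * f) * Q" unfolding comm(1) by (simp add: mult.assoc)
    also have "\<dots> = (1 + p) * (1 + s * r) * (e * f) * (P * Q)" unfolding comm(2,3) by (simp add: mult.assoc)
    finally show ?thesis unfolding that(7) .
  qed
  have rp: "r * p = - (p * r)" by (rule wedge_span(2)[OF r p])
  define su sv :: operator where "su = (-1) ^ odd_count n u" and "sv = (-1) ^ odd_count n v"
  have uv: "word_op n u * word_op n v = (1 + p) * (1 + su * r) * g * (parity ^ odd_count n u * parity ^ odd_count n v)"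
    unfolding u v by (rule prod) (auto simp: su_def parity_power g_def p r e f)
  have vu: "word_op n v * word_op n u = (1 + r) * (1 + sv * p) * g * (parity ^ odd_count n v * parity ^ odd_count n u)"
    unfolding u v by (rule prod) (auto simp: sv_def parity_power g_def p r e f intro: even_products_commute)
  note uv' = uv[unfolded su_def sv_def] and vu' = vu[unfolded su_def sv_def]
  consider "even (odd_count n u)" "even (odd_count n v)" | "odd (odd_count n u)" "odd (odd_count n v)"
    | "even (odd_count n u)" "odd (odd_count n v)" | "odd (odd_count n u)" "even (odd_count n v)" by blast
  then show ?thesis
  proof cases
    case 1
    then have "operator_rep n (bracket n u v) = 2 * (p * r * g)"
      by (simp add: c uv' vu' parity_power algebra_simps rp mult_2)
    then show ?thesis using that(1)[of "p * r * g"] 1 even_central_closed(3)[OF even_central_closed(5)[OF p r] g] by simp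
  next
    case 2
    then have "operator_rep n (bracket n u v) = 2 * g"
      by (simp add: c uv' vu' parity_power parity_square algebra_simps rp mult_2)
    then show ?thesis using that(1)[of g] 2 g by simp
  next
    case 3
    then have "operator_rep n (bracket n u v) = 2 * (p * g * parity)"
      by (simp add: c uv' vu' parity_power algebra_simps rp mult_2)
    then show ?thesis using that(2)[of p g] 3 g p by simp
  next
    case 4
    then have "operator_rep n (bracket n u v) = 2 * (- r * g * parity)"
      by (simp add: c uv' vu' parity_power algebra_simps rp mult_2)
    then show ?thesis using that(2)[of "- r" g] 4 g add_closedD(3)[OF add_closed_zspan r] by simp
  qed
qed

lemma bracket_op_supercentral:
  "operator_rep n (bracket n u v) * wedge a = wedge a * operator_rep n (bracket n u v)" (is ?A)
  "operator_rep n (bracket n u v) * parity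
     = (-1) ^ (odd_count n u + odd_count n v) * (parity * operator_rep n (bracket n u v))" (is ?B)
proof -
  have "?A \<and> ?B"
  proof (rule bracket_op_forms[of n u v])
    fix g assume "g \<in> even_central" "even (odd_count n u + odd_count n v)" "operator_rep n (bracket n u v) = 2 * g"
    then show ?thesis by (simp add: even_central_def mult_2 distrib_left distrib_right)
  next
    fix q g assume q: "q \<in> zspan (range wedge)" and g: "g \<in> even_central" and odd: "odd (odd_count n u + odd_count n v)"
      and c: "operator_rep n (bracket n u v) = 2 * (q * g * parity)"
    have 1: "parity * wedge a = - (wedge a * parity)" by (rule parity_wedge)
    have 2: "q * wedge a = - (wedge a * q)" by (rule wedge_span(2)[OF q zspan.base]) simp
    have 3: "g * wedge a = wedge a * g" "g * parity = parity * g" using g by (auto simp: even_central_def)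
    have 4: "parity * q = - (q * parity)" by (rule wedge_span(1)[OF q])
    have "q * g * parity * wedge a = - (q * (g * wedge a) * parity)" by (simp add: mult.assoc 1)
    also have "\<dots> = - (q * wedge a * g * parity)" by (simp add: 3 mult.assoc)
    also have "\<dots> = wedge a * (q * g * parity)" by (simp add: 2 mult.assoc)
    finally have A: "q * g * parity * wedge a = wedge a * (q * g * parity)" .
    have "parity * (q * g * parity) = (parity * q) * g * parity" by (simp add: mult.assoc)
    also have "\<dots> = - (q * (parity * g) * parity)" by (simp add: 4 mult.assoc)
    also have "\<dots> = - (q * g * parity * parity)" by (simp add: 3(2)[symmetric] mult.assoc)
    finally have B: "q * g * parity * parity = - (parity * (q * g * parity))" by simp
    show ?thesis using odd unfolding c mult_2 distrib_left distrib_right A B by simp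
  qed
  then show ?A ?B by auto
qed

section \<open>The integral symbol\<close>

lemma supercentral_word_op:
  assumes a: "\<And>a. c * wedge a = wedge a * c" and p: "c * parity = (-1) ^ d * (parity * c)"
  shows "word_op n w * c = (-1) ^ (odd_count n w * d) * (c * word_op n w)"
proof (induction w)
  case (Cons b w)
  have l: "letter_op n b * c = (-1) ^ (odd_count n [b] * d) * (c * letter_op n b)"
  proof -
    have "(1 + wedge b) * parity * c = (1 + wedge b) * (parity * c)" by (simp add: mult.assoc)
    also have "parity * c = (-1) ^ d * (c * parity)" using p by (cases "even d") simp_all
    also have "(1 + wedge b) * ((-1) ^ d * (c * parity)) = (-1) ^ d * (((1 + wedge b) * c) * parity)"
      by (simp add: sign_left_comm mult.assoc)
    also have "(1 + wedge b) * c = c * (1 + wedge b)" using a by (simp add: algebra_simps)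
    finally have "(1 + wedge b) * parity * c = (-1) ^ d * (c * ((1 + wedge b) * parity))" by (simp only: mult.assoc)
    moreover have "(1 + wedge b) * c = c * (1 + wedge b)" using a by (simp add: algebra_simps)
    ultimately show ?thesis by (simp add: letter_op_def odd_count_single)
  qed
  have "word_op n (b # w) * c = letter_op n b * (word_op n w * c)" by (simp add: mult.assoc)
  also have "\<dots> = (-1) ^ (odd_count n w * d) * ((letter_op n b * c) * word_op n w)"
    unfolding Cons by (simp add: sign_left_comm mult.assoc)
  also have "\<dots> = (-1) ^ (odd_count n (b # w) * d) * (c * word_op n (b # w))"
    unfolding l odd_count_Cons[of n b w] by (simp add: mult.assoc power_add distrib_right minus_one_power_iff)
  finally show ?case .
qed simp

lemma operator_rep_sign: "operator_rep n ((-1) ^ k * x) = (-1) ^ k * operator_rep n x"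
  by (cases "even k") (simp_all add: additive.minus[OF additive_linear_ext])

lemma operator_rep_sign_one: "operator_rep n ((-1) ^ k) = (-1) ^ k"
  using operator_rep_sign[of n k "frag_of []"] by (simp add: frag_of_Nil del: linear_ext_frag_of) (simp flip: frag_of_Nil)

lemma operator_rep_M3:
  assumes "x \<in> M3 n" shows "operator_rep n x = 0"
proof (rule zspan_kernel[OF assms[unfolded M3_def] additive_linear_ext])
  fix s assume "s \<in> triple_products n"
  then obtain p a b c q where s: "s = frag_of p * triple_bracket n a b c * frag_of q" by auto
  have "operator_rep n (triple_bracket n a b c) = 0"
    using supercentral_word_op[OF bracket_op_supercentral(1) bracket_op_supercentral(2)[of n b c], of n a]
    by (simp add: triple_bracket_def additive.diff[OF additive_linear_ext] operator_rep_mult operator_rep_sign_one)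
  then show "operator_rep n s = 0" by (simp add: s operator_rep_mult)
qed

definition vacuum :: exterior where "vacuum = (\<lambda>S. if S = {} then 1 else 0)"

text \<open>The image of the vacuum vector determines the operator of an element of given multidegree.\<close>

definition symbol :: "nat \<Rightarrow> free_ring \<Rightarrow> exterior" where
  "symbol n x = app (operator_rep n x) vacuum"

lemma additive_symbol: "additive (symbol n)"
  by (simp add: additive_def symbol_def additive.add[OF additive_linear_ext])

lemma symbol_mult: "symbol n (x * y) = app (operator_rep n x) (symbol n y)"
  by (simp add: symbol_def operator_rep_mult)

lemma symbol_word_mult: "symbol n (frag_of u * y) = app (word_op n u) (symbol n y)"
  by (simp add: symbol_mult)

lemma symbol_M3: "x \<in> M3 n \<Longrightarrow> symbol n x = 0"
  by (simp add: symbol_def operator_rep_M3)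

text \<open>The trace property: supercentral operators commute or anticommute with \<open>\<theta>\<close> according to their parity,
so they map the vacuum to a vector of the corresponding exterior parity.\<close>

lemma symbol_bracket_parity:
  assumes "even (card S) \<noteq> even (odd_count n u + odd_count n v)"
  shows "symbol n (bracket n u v) S = 0"
proof -
  let ?c = "operator_rep n (bracket n u v)"
  have "app parity vacuum = vacuum" by (auto simp: fun_eq_iff app_parity vacuum_def)
  then have "symbol n (bracket n u v) = app (?c * parity) vacuum" by (simp add: symbol_def)
  also have "\<dots> = app ((-1) ^ (odd_count n u + odd_count n v) * parity) (symbol n (bracket n u v))"
    unfolding bracket_op_supercentral(2) by (simp add: symbol_def)
  finally have "symbol n (bracket n u v) S = app ((-1) ^ (odd_count n u + odd_count n v) * parity) (symbol n (bracket n u v)) S"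
    by (rule fun_cong)
  then show ?thesis
    using assms by (cases "even (odd_count n u + odd_count n v)") (auto simp: app_parity minus_one_power_iff split: if_splits)
qed

definition supported :: "nat set \<Rightarrow> exterior set" where
  "supported zs = {x. \<forall>S. \<not> (finite S \<and> S \<subseteq> zs) \<longrightarrow> x S = 0}"

lemma add_closed_supported: "add_closed (supported zs)"
  unfolding add_closed_def
proof (intro conjI ballI)
  show "0 \<in> supported zs" unfolding supported_def by simp
  fix x y assume "x \<in> supported zs" "y \<in> supported zs"
  then have "(x - y) S = 0" if "\<not> (finite S \<and> S \<subseteq> zs)" for S
    using that unfolding supported_def mem_Collect_eq minus_apply by (metis diff_zero)
  then show "x - y \<in> supported zs" unfolding supported_def by blast
qed

lemma supportedI: "(\<And>S. x S \<noteq> 0 \<Longrightarrow> finite S \<and> S \<subseteq> zs) \<Longrightarrow> x \<in> supported zs"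
  and supportedD: "x \<in> supported zs \<Longrightarrow> x S \<noteq> 0 \<Longrightarrow> finite S \<and> S \<subseteq> zs"
  unfolding supported_def by blast+

lemma supported_mono: "zs \<subseteq> zs' \<Longrightarrow> x \<in> supported zs \<Longrightarrow> x \<in> supported zs'"
  by (rule supportedI) (blast dest: supportedD)

lemma supported_vacuum: "vacuum \<in> supported zs"
  by (rule supportedI) (simp add: vacuum_def split: if_splits)

lemma supported_parity: "app parity x \<in> supported zs \<longleftrightarrow> x \<in> supported zs"
proof -
  have "app parity x S \<noteq> 0 \<longleftrightarrow> x S \<noteq> 0" for S by (simp add: app_parity)
  then show ?thesis unfolding supported_def by blast
qed

lemma supported_wedge:
  assumes "x \<in> supported zs" "a \<in> zs" shows "app (wedge a) x \<in> supported zs"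
proof (rule supportedI)
  fix S assume "app (wedge a) x S \<noteq> 0"
  then have "a \<in> S" "finite S" "x (S - {a}) \<noteq> 0" unfolding app_wedge by (presburger, presburger, metis mult_zero_right)
  then show "finite S \<and> S \<subseteq> zs" using supportedD[OF assms(1), of "S - {a}"] assms(2) by blast
qed

lemma supported_of_nat: "x \<in> supported zs \<Longrightarrow> app (of_nat c) x \<in> supported zs"
  by (induction c) (auto intro: add_closedD[OF add_closed_supported])

lemma supported_numeral: "x \<in> supported zs \<Longrightarrow> app (numeral c) x \<in> supported zs"
  using supported_of_nat[of x zs "numeral c"] by simp

lemma supported_word_op: "set w \<subseteq> zs \<Longrightarrow> x \<in> supported zs \<Longrightarrow> app (word_op n w) x \<in> supported zs"
  by (induction w)
     (auto simp: letter_op_def supported_wedge supported_parity intro!: add_closedD(4)[OF add_closed_supported])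

lemma symbol_word_supported: "set w \<subseteq> zs \<Longrightarrow> symbol n (frag_of w) \<in> supported zs"
  unfolding symbol_def linear_ext_frag_of by (rule supported_word_op[OF _ supported_vacuum])

lemma symbol_word_span_supported: "x \<in> word_span zs m \<Longrightarrow> symbol n x \<in> supported zs"
  unfolding word_span_def
proof (erule zspan_image[OF _ additive_symbol add_closed_supported])
  fix s assume "s \<in> frag_of ` words_of zs m"
  then show "symbol n s \<in> supported zs" using symbol_word_supported by (auto simp: words_of_def)
qed

text \<open>Read off the coefficients at the sets that do not contain \<open>z\<close>, then at those that do.\<close>

lemma wedge_split:
  assumes "x \<in> supported zs" "y \<in> supported zs" "z \<notin> zs" "x + app (wedge z) y = 0"
  shows "x = 0" "y = 0"
proof -
  have *: "x S + app (wedge z) y S = 0" for S using fun_cong[OF assms(4), of S] by simp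
  have x: "x S = 0" for S
  proof (cases "z \<in> S")
    case True then show ?thesis using supportedD[OF assms(1), of S] assms(3) by blast
  next
    case False then show ?thesis using *[of S] by (simp add: app_wedge)
  qed
  have "y S = 0" for S
  proof (rule ccontr)
    assume "y S \<noteq> 0"
    then have S: "finite S" "S \<subseteq> zs" using supportedD[OF assms(2)] by blast+
    have "insert z S - {z} = S" using S assms(3) by auto
    then have "app (wedge z) y (insert z S) \<noteq> 0" using S \<open>y S \<noteq> 0\<close> by (simp add: app_wedge)
    then show False using *[of "insert z S"] x by simp
  qed
  with x show "x = 0" "y = 0" by auto
qed

lemma parity_eq_0: "app parity x = 0 \<Longrightarrow> x = 0"
  by (metis app_simps(2,6) app_additive(2) parity_square)

lemma two_eq_0: "app 2 x = 0 \<Longrightarrow> x = 0"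
proof -
  assume "app 2 x = 0"
  moreover have "app 2 x = x + x" using app_simps(3)[of 1 1 x] by (simp del: app_simps(3))
  ultimately have "x S + x S = 0" for S by (metis plus_fun_apply zero_fun_apply)
  then show "x = 0" by (simp add: fun_eq_iff)
qed

lemma word_op_power_even: "z < n \<Longrightarrow> word_op n (replicate c z) = 1 + wedge z * of_nat c"
proof (induction c)
  case (Suc c)
  have "wedge z * (wedge z * of_nat c) = 0" by (simp add: wedge_square flip: mult.assoc)
  with Suc show ?case by (simp add: letter_op_def algebra_simps)
qed simp

text \<open>The counterpart of the centrality of \<open>y\<^sup>2\<close> for an odd letter \<open>y\<close>.\<close>

lemma letter_op_odd_square: "n \<le> z \<Longrightarrow> letter_op n z * letter_op n z = 1"
proof -
  have "(1 + wedge z) * parity * ((1 + wedge z) * parity) = (1 + wedge z) * ((parity + parity * wedge z) * parity)"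
    by (simp add: mult.assoc distrib_left distrib_right)
  also have "\<dots> = (1 + wedge z) * ((1 - wedge z) * (parity * parity))"
    unfolding parity_wedge by (simp add: algebra_simps)
  also have "\<dots> = 1" by (simp add: parity_square algebra_simps wedge_square)
  finally show "n \<le> z \<Longrightarrow> letter_op n z * letter_op n z = 1" by (simp add: letter_op_def)
qed

lemma word_op_power_odd: "n \<le> z \<Longrightarrow> word_op n (replicate c z) = (if even c then 1 else (1 + wedge z) * parity)"
proof (induction c)
  case (Suc c)
  then show ?case using letter_op_odd_square[of n z] by (auto simp: letter_op_def)
qed simp

lemma operator_rep_letter_bracket:
  "operator_rep n (bracket n [v] [z]) =
    (if v < n then if z < n then 2 * (wedge v * wedge z) else 2 * (wedge v * parity)
     else if z < n then - (2 * (wedge z * parity)) else 2)"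
proof -
  have c: "operator_rep n (bracket n [v] [z]) = letter_op n v * letter_op n z
     - (-1) ^ (odd_count n [v] * odd_count n [z]) * (letter_op n z * letter_op n v)"
    using operator_rep_sign[of n _ "frag_of [z, v]"]
    by (simp add: bracket_def additive.diff[OF additive_linear_ext])
  have p: "parity * (wedge v * x) = - (wedge v * (parity * x))" "parity * (parity * x) = x" for v x
    using parity_wedge[of v] parity_square by (metis mult.assoc mult_minus_left, metis mult.assoc mult_1)
  have w: "wedge z * (wedge v * x) = - (wedge v * (wedge z * x))" for x
    using wedge_anticommute[of z v] by (metis mult.assoc mult_minus_left)
  show ?thesis unfolding c
    by (simp add: letter_op_def odd_count_single algebra_simps wedge_anticommute[of z v] w parity_wedge parity_square p mult_2)
qed

lemma symbol_oneforms:
  assumes "w \<in> oneforms n zs v m"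
  shows "v < n \<Longrightarrow> \<exists>x\<in>supported zs. symbol n w = app (wedge v) x"
    "n \<le> v \<Longrightarrow> symbol n w \<in> supported zs"
proof -
  have gen: "a \<in> zs \<and> symbol n (frag_of g) \<in> supported zs" if "a # g \<in> words_of zs m" for a g
  proof -
    show ?thesis using that symbol_word_supported[of g zs n] by (simp add: words_of_def)
  qed
  note c = add_closedD[OF add_closed_supported[of zs]]
  show "\<exists>x\<in>supported zs. symbol n w = app (wedge v) x" if v: "v < n"
  proof -
    have "symbol n w \<in> app (wedge v) ` supported zs"
    proof (rule zspan_image[OF assms[unfolded oneforms_def] additive_symbol])
      show "add_closed (app (wedge v) ` supported zs)"
        unfolding add_closed_def
      proof (intro conjI ballI)
        show "0 \<in> app (wedge v) ` supported zs" by (rule image_eqI[of _ _ 0]) (simp_all add: c)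
        fix x y assume "x \<in> app (wedge v) ` supported zs" "y \<in> app (wedge v) ` supported zs"
        then obtain x' y' where "x' \<in> supported zs" "y' \<in> supported zs" "x = app (wedge v) x'" "y = app (wedge v) y'" by auto
        then show "x - y \<in> app (wedge v) ` supported zs"
          by (intro image_eqI[of _ _ "x' - y'"]) (simp_all add: c)
      qed
      fix s assume "s \<in> oneform_words n zs v m"
      then obtain a g where s: "s = bracket n [v] [a] * frag_of g" and ag: "a # g \<in> words_of zs m" by auto
      have 2: "app 2 (app (wedge v) x) = app (wedge v) (app 2 x)" for x
        using mult_of_nat_commute[of 2 "wedge v"] by (metis app_simps(6) of_nat_numeral)
      show "symbol n s \<in> app (wedge v) ` supported zs"
        using gen[OF ag] v
        by (auto simp: s symbol_mult operator_rep_letter_bracket 2 supported_parity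
            intro!: imageI supported_numeral supported_wedge)
    qed
    then show ?thesis by auto
  qed
  show "symbol n w \<in> supported zs" if v: "n \<le> v"
  proof (rule zspan_image[OF assms[unfolded oneforms_def] additive_symbol add_closed_supported])
    fix s assume "s \<in> oneform_words n zs v m"
    then obtain a g where s: "s = bracket n [v] [a] * frag_of g" and ag: "a # g \<in> words_of zs m" by auto
    show "symbol n s \<in> supported zs"
      using gen[OF ag] v
      by (auto simp: s symbol_mult operator_rep_letter_bracket supported_parity
          intro!: supported_numeral supported_wedge c)
  qed
qed

text \<open>For even \<open>z\<close> the power \<open>z\<^sup>c\<close> acts as \<open>1 + c \<eta>\<^sub>z\<close>, and the one-form is a multiple of \<open>\<eta>\<^sub>z\<close>. For odd \<open>z\<close> exactly one of
\<open>z\<^sup>c\<close> and \<open>z\<^sup>c\<^sup>-\<^sup>1\<close> acts as the identity and the other one as \<open>(1 + \<eta>\<^sub>z) \<theta>\<close>, and the one-form is free of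
\<open>\<eta>\<^sub>z\<close>. In each case the term with \<open>\<eta>\<^sub>z\<close> can be split off.\<close>

lemma symbol_split_word_span:
  assumes z: "z \<notin> zs" and f: "f \<in> word_span zs m" and w: "w \<in> oneforms n zs z m"
    and eq: "symbol n (frag_of (replicate c z) * f + frag_of (replicate (c - 1) z) * w) = 0" and c: "c > 0"
  shows "symbol n f = 0 \<and> symbol n w = 0"
proof -
  note cl = add_closedD[OF add_closed_supported[of zs]]
  let ?F = "symbol n f" and ?W = "symbol n w"
  have F: "?F \<in> supported zs" by (rule symbol_word_span_supported[OF f])
  have eq': "app (word_op n (replicate c z)) ?F + app (word_op n (replicate (c - 1) z)) ?W = 0"
    using eq by (simp add: additive.add[OF additive_symbol] symbol_word_mult)
  show ?thesis
  proof (cases "z < n")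
    case True
    obtain x where x: "x \<in> supported zs" "?W = app (wedge z) x" using symbol_oneforms(1)[OF w True] by auto
    have "app (wedge z) (app (of_nat k) (app (wedge z) x)) = 0" for k
    proof -
      have "wedge z * (of_nat k * wedge z) = 0" unfolding mult_of_nat_commute by (simp add: wedge_square flip: mult.assoc)
      then show ?thesis by (metis app_simps(1,6))
    qed
    then have "?F + app (wedge z) (app (of_nat c) ?F + x) = 0"
      using eq' unfolding word_op_power_even[OF True] x(2) by (simp add: algebra_simps)
    from wedge_split[OF F cl(4)[OF supported_of_nat[OF F] x(1)] z this]
    have "?F = 0" "app (of_nat c) ?F + x = 0" .
    then show ?thesis using x(2) by simp
  next
    case False
    then have zn: "n \<le> z" by simp
    have W: "?W \<in> supported zs" by (rule symbol_oneforms(2)[OF w zn])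
    note pw = word_op_power_odd[OF zn]
    show ?thesis
    proof (cases "even c")
      case True
      have "(?F + app parity ?W) + app (wedge z) (app parity ?W) = 0"
        using eq' True c by (simp add: pw algebra_simps)
      moreover have "app parity ?W \<in> supported zs" using W by (simp add: supported_parity)
      ultimately have "?F + app parity ?W = 0" "app parity ?W = 0"
        using wedge_split[OF cl(4)[OF F] _ z] by blast+
      then show ?thesis using parity_eq_0 by auto
    next
      case False
      have "(app parity ?F + ?W) + app (wedge z) (app parity ?F) = 0"
        using eq' False c by (simp add: pw algebra_simps)
      moreover have "app parity ?F \<in> supported zs" using F by (simp add: supported_parity)
      ultimately have "app parity ?F + ?W = 0" "app parity ?F = 0"
        using wedge_split[OF cl(4)[OF _ W] _ z] by blast+
      then show ?thesis using parity_eq_0 by auto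
    qed
  qed
qed

lemma wedge_eq_0: "x \<in> supported zs \<Longrightarrow> z \<notin> zs \<Longrightarrow> app (wedge z) x = 0 \<Longrightarrow> x = 0"
  using wedge_split(2)[of 0 zs x z] by (simp add: add_closedD[OF add_closed_supported])

lemma symbol_split_forms:
  assumes z: "z \<notin> zs" and v: "v \<notin> insert z zs" and w: "w \<in> oneforms n zs v m" and f: "f \<in> word_span zs m"
    and eq: "symbol n (frag_of (replicate c z) * w + frag_of (replicate (c - 1) z) * bracket n [v] [z] * f) = 0" and c: "c > 0"
  shows "symbol n w = 0 \<and> symbol n f = 0"
proof -
  let ?zs = "insert v zs"
  note cl = add_closedD[OF add_closed_supported[of ?zs]]
  let ?F = "symbol n f" and ?W = "symbol n w" and ?U = "operator_rep n (bracket n [v] [z])"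
  have z': "z \<notin> ?zs" and v': "v \<notin> zs" using z v by auto
  have F0: "?F \<in> supported zs" by (rule symbol_word_span_supported[OF f])
  then have F: "?F \<in> supported ?zs" by (rule supported_mono[rotated]) auto
  have W: "?W \<in> supported ?zs"
  proof (cases "v < n")
    case True
    then obtain x where x: "x \<in> supported zs" "?W = app (wedge v) x" using symbol_oneforms(1)[OF w] by auto
    then show ?thesis using supported_mono[of zs ?zs x] by (auto intro: supported_wedge)
  next
    case False
    then show ?thesis using symbol_oneforms(2)[OF w] supported_mono[of zs ?zs ?W] by auto
  qed
  have eq': "app (word_op n (replicate c z)) ?W + app (word_op n (replicate (c - 1) z)) (app ?U ?F) = 0"
    using eq by (simp add: additive.add[OF additive_symbol] symbol_word_mult symbol_mult mult.assoc)
  show ?thesis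
  proof (cases "z < n")
    case True
    define G where "G = (if v < n then - app 2 (app (wedge v) ?F) else - app 2 (app parity ?F))"
    have G: "G \<in> supported ?zs" unfolding G_def using F
      by (auto intro!: cl supported_numeral supported_wedge simp: supported_parity)
    have U: "app ?U ?F = app (wedge z) G"
    proof -
      have "2 * (wedge v * wedge z) = wedge z * (- (2 * wedge v))"
        unfolding wedge_anticommute[of v z] by (simp add: mult_2 algebra_simps)
      moreover have "2 * (wedge z * parity) = wedge z * (2 * parity)"
        by (simp add: mult_2 algebra_simps)
      ultimately have "?U = wedge z * (if v < n then - (2 * wedge v) else - (2 * parity))"
        using True by (simp add: operator_rep_letter_bracket)
      then show ?thesis by (simp add: G_def)
    qed
    have "app (wedge z) (app (of_nat k) (app (wedge z) x)) = 0" for k x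
    proof -
      have "wedge z * (of_nat k * wedge z) = 0" unfolding mult_of_nat_commute by (simp add: wedge_square flip: mult.assoc)
      then show ?thesis by (metis app_simps(1,6))
    qed
    then have "?W + app (wedge z) (app (of_nat c) ?W + G) = 0"
      using eq' unfolding word_op_power_even[OF True] U by (simp add: algebra_simps)
    from wedge_split[OF W cl(4)[OF supported_of_nat[OF W] G] z' this]
    have "?W = 0" "app (of_nat c) ?W + G = 0" .
    then have W0: "?W = 0" and "G = 0" by auto
    then have "app (wedge v) ?F = 0 \<or> app parity ?F = 0"
      unfolding G_def using two_eq_0 by (auto split: if_splits)
    then show ?thesis using W0 wedge_eq_0[OF F0 v'] parity_eq_0 by auto
  next
    case False
    then have zn: "n \<le> z" by simp
    note pw = word_op_power_odd[OF zn]
    have U: "?U = (if v < n then 2 * (wedge v * parity) else 2)" using False by (simp add: operator_rep_letter_bracket)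
    have UF: "app ?U ?F \<in> supported ?zs"
      unfolding U using F by (auto intro!: supported_numeral supported_wedge simp: supported_parity)
    have U0: "?F = 0" if "app ?U ?F = 0"
    proof (cases "v < n")
      case True
      then have "app 2 (app (wedge v) (app parity ?F)) = 0" using that unfolding U by simp
      then have "app (wedge v) (app parity ?F) = 0" by (rule two_eq_0)
      moreover have "app parity ?F \<in> supported zs" using F0 by (simp only: supported_parity)
      ultimately show ?thesis using wedge_eq_0[OF _ v'] parity_eq_0 by blast
    next
      case False
      then have "app 2 ?F = 0" using that unfolding U by simp
      then show ?thesis by (rule two_eq_0)
    qed
    show ?thesis
    proof (cases "even c")
      case True
      have "(?W + app parity (app ?U ?F)) + app (wedge z) (app parity (app ?U ?F)) = 0"
        using eq' True c by (simp add: pw algebra_simps)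
      moreover have "app parity (app ?U ?F) \<in> supported ?zs" using UF by (simp add: supported_parity)
      ultimately have "?W + app parity (app ?U ?F) = 0" "app parity (app ?U ?F) = 0"
        using wedge_split[OF cl(4)[OF W] _ z'] by blast+
      then show ?thesis using parity_eq_0 U0 by auto
    next
      case False
      have "(app parity ?W + app ?U ?F) + app (wedge z) (app parity ?W) = 0"
        using eq' False c by (simp add: pw algebra_simps)
      moreover have "app parity ?W \<in> supported ?zs" using W by (simp add: supported_parity)
      ultimately have "app parity ?W + app ?U ?F = 0" "app parity ?W = 0"
        using wedge_split[OF cl(4)[OF _ UF] _ z'] by blast+
      then show ?thesis using parity_eq_0 U0 by auto
    qed
  qed
qed

lemma symbol_of_int: "symbol n (of_int k) {} = k"
proof -
  have "symbol n 1 {} = 1" by (simp add: symbol_def vacuum_def flip: frag_of_Nil)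
  then show ?thesis
    by (induction k rule: int_induct[of _ 0])
       (simp_all add: additive.zero[OF additive_symbol] additive.add[OF additive_symbol] additive.diff[OF additive_symbol])
qed

lemma symbol_faithful:
  assumes "finite zs" "\<And>i. i \<in> zs \<Longrightarrow> m i > 0"
  shows "x \<in> word_span zs m \<Longrightarrow> symbol n x = 0 \<Longrightarrow> x \<in> M3 n"
    "v \<notin> zs \<Longrightarrow> w \<in> oneforms n zs v m \<Longrightarrow> symbol n w = 0 \<Longrightarrow> w \<in> M3 n"
proof -
  have "(\<forall>x\<in>word_span zs m. symbol n x = 0 \<longrightarrow> x \<in> M3 n) \<and>
      (\<forall>v. v \<notin> zs \<longrightarrow> (\<forall>x\<in>oneforms n zs v m. symbol n x = 0 \<longrightarrow> x \<in> M3 n))"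
  proof (rule kernel_detection[OF additive_symbol two_sided_M3 order_refl symbol_M3])
    fix k assume "symbol n (of_int k) = 0"
    then have "k = 0" using symbol_of_int[of n k] by simp
    then show "of_int k \<in> M3 n" using add_closedD(1)[OF add_closed_M3] by simp
  next
    fix zs z m c f w
    assume "z \<notin> zs" "c > 0" "f \<in> word_span zs m" "w \<in> oneforms n zs z m"
      "symbol n (frag_of (replicate c z) * f + frag_of (replicate (c - 1) z) * w) = 0"
    then show "symbol n f = 0 \<and> symbol n w = 0" by (intro symbol_split_word_span)
  next
    fix zs v z m c f w
    assume "z \<notin> zs" "v \<notin> insert z zs" "c > 0" "w \<in> oneforms n zs v m" "f \<in> word_span zs m"
      "symbol n (frag_of (replicate c z) * w + frag_of (replicate (c - 1) z) * bracket n [v] [z] * f) = 0"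
    then show "symbol n w = 0 \<and> symbol n f = 0" by (intro symbol_split_forms)
  qed (assumption | fact assms)+
  then show "x \<in> word_span zs m \<Longrightarrow> symbol n x = 0 \<Longrightarrow> x \<in> M3 n"
    "v \<notin> zs \<Longrightarrow> w \<in> oneforms n zs v m \<Longrightarrow> symbol n w = 0 \<Longrightarrow> w \<in> M3 n" by auto
qed

section \<open>The symbol modulo two\<close>

type_synonym mod2_ring = "(nat \<Rightarrow>\<^sub>0 bit) \<Rightarrow>\<^sub>0 bit"

lemma bit_valued_double: "x + x = (0::'a \<Rightarrow>\<^sub>0 bit)"
proof (rule poly_mapping_eqI)
  have "b + b = 0" for b :: bit by (cases b) simp_all
  then show "Poly_Mapping.lookup (x + x) k = Poly_Mapping.lookup 0 k" for k
    by (simp only: lookup_add lookup_zero)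
qed

lemma mod2_double [simp]: "x + x = (0::mod2_ring)"
  by (rule bit_valued_double)

lemma mod2_two [simp]: "(2::mod2_ring) = 0"
  using mod2_double[of 1] by (simp only: one_add_one)

lemma mod2_uminus [simp]: "- x = (x::mod2_ring)"
  using mod2_double[of x] by (simp add: neg_eq_iff_add_eq_0)

lemma mod2_minus: "x - y = x + (y::mod2_ring)"
  by (metis diff_conv_add_uminus mod2_uminus)

lemma mod2_add_left [simp]: "x + (x + y) = (y::mod2_ring)"
  by (simp flip: add.assoc)

lemma mod2_of_int: "(of_int k :: mod2_ring) = (if even k then 0 else 1)"
  by (auto elim!: evenE oddE)

lemma mod2_of_nat: "(of_nat k :: mod2_ring) = (if even k then 0 else 1)"
  by (auto elim!: evenE oddE)

text \<open>The mod-two group algebra of an elementary abelian 2-group with generators \<open>g\<^sub>a\<close> contains the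
square-zero elements \<open>t\<^sub>a = 1 + g\<^sub>a\<close>, and they generate it freely subject to \<open>t\<^sub>a\<^sup>2 = 0\<close>. In
characteristic two this is the exterior algebra, and it comes as a commutative ring without further
construction.\<close>

definition nilp :: "nat \<Rightarrow> mod2_ring" where
  "nilp a = 1 + Poly_Mapping.single (Poly_Mapping.single a 1) 1"

lemma nilp_square [simp]: "nilp a * nilp a = 0"
proof -
  have "Poly_Mapping.single (Poly_Mapping.single a (1::bit)) (1::bit) * Poly_Mapping.single (Poly_Mapping.single a 1) 1 = 1"
    by (simp only: mult_single bit_valued_double single_one mult_1)
  then show ?thesis by (simp add: nilp_def algebra_simps)
qed

lemma nilp_square_left [simp]: "nilp a * (nilp a * x) = 0"
  by (simp flip: mult.assoc)

definition inversion :: "nat \<Rightarrow> nat \<Rightarrow> mod2_ring" where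
  "inversion a b = (if b < a then 1 + nilp a * nilp b else 1)"

definition inversions :: "nat list \<Rightarrow> nat list \<Rightarrow> mod2_ring" where
  "inversions u v = (\<Prod>a\<leftarrow>u. \<Prod>b\<leftarrow>v. inversion a b)"

text \<open>The product of \<open>1 + t\<^sub>a t\<^sub>b\<close> over all pairs of positions at which a larger letter \<open>a\<close> stands before a smaller
letter \<open>b\<close>. The coefficient at a set of letters is the Pfaffian of the matrix of inversion numbers.\<close>

fun mod2_word :: "nat list \<Rightarrow> mod2_ring" where
  "mod2_word [] = 1"
| "mod2_word (a # w) = mod2_word w * inversions [a] w"

lemma inversions_Nil [simp]:
  shows "inversions [] v = 1" "inversions u [] = 1"
proof -
  show "inversions [] v = 1" by (simp add: inversions_def)
  show "inversions u [] = 1" by (induction u) (simp_all add: inversions_def)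
qed

lemma inversions_append1: "inversions (u @ u') v = inversions u v * inversions u' v"
  by (simp add: inversions_def)

lemma inversions_append2: "inversions u (v @ v') = inversions u v * inversions u v'"
  by (induction u) (simp_all add: inversions_def algebra_simps)

lemma inversions_Cons1: "inversions (a # u) v = inversions [a] v * inversions u v"
  using inversions_append1[of "[a]" u] by simp

lemma inversions_Cons2: "inversions u (b # v) = inversions u [b] * inversions u v"
  using inversions_append2[of u "[b]" v] by simp

lemma inversions_single: "inversions [a] [b] = inversion a b"
  by (simp add: inversions_def)

lemma mod2_word_append: "mod2_word (u @ v) = mod2_word u * mod2_word v * inversions u v"
proof (induction u)
  case (Cons a u)
  then show ?case by (simp add: inversions_append2 inversions_Cons1[of a u] ac_simps)
qed simp

definition degree_sum :: "nat list \<Rightarrow> mod2_ring" where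
  "degree_sum w = (\<Sum>a\<leftarrow>w. nilp a)"

lemma degree_sum_simps [simp]: "degree_sum [] = 0" "degree_sum (a # w) = nilp a + degree_sum w"
  "degree_sum (u @ v) = degree_sum u + degree_sum v"
  by (simp_all add: degree_sum_def)

lemma degree_sum_square [simp]: "degree_sum w * degree_sum w = 0"
proof (induction w)
  case (Cons a w)
  have "degree_sum (a # w) * degree_sum (a # w)
    = nilp a * nilp a + degree_sum w * degree_sum w + (nilp a * degree_sum w + nilp a * degree_sum w)"
    unfolding degree_sum_simps by (simp only: algebra_simps)
  then show ?case using Cons by simp
qed simp

lemma degree_sum_square_left [simp]: "degree_sum w * (degree_sum w * x) = 0"
  by (simp flip: mult.assoc)

lemma inversion_square: "inversion a b * inversion a b = 1"
  by (simp add: inversion_def algebra_simps)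

lemma inversion_swap: "inversion a b * inversion b a = 1 + nilp a * nilp b"
  by (cases a b rule: linorder_cases) (simp_all add: inversion_def algebra_simps)

lemma inversions_square: "inversions u v * inversions u v = 1"
proof (induction u)
  case (Cons a u)
  have "inversions [a] v * inversions [a] v = 1"
  proof (induction v)
    case (Cons b v)
    have "inversions [a] (b # v) * inversions [a] (b # v)
      = (inversion a b * inversion a b) * (inversions [a] v * inversions [a] v)"
      unfolding inversions_Cons2[of _ b v] inversions_single by (simp only: ac_simps)
    then show ?case using Cons by (simp add: inversion_square)
  qed simp
  moreover have "inversions (a # u) v * inversions (a # u) v
      = (inversions [a] v * inversions [a] v) * (inversions u v * inversions u v)"
    unfolding inversions_Cons1[of a u] by (simp only: ac_simps)
  ultimately show ?case using Cons by simp
qed simp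

text \<open>The factors of a product of \<open>1 + t\<^sub>a t\<^sub>b\<close> with a common \<open>t\<^sub>a\<close> just add up, because \<open>t\<^sub>a\<^sup>2 = 0\<close>, and so do those
with a common sum of the \<open>t\<^sub>b\<close>, which has square zero in characteristic two.\<close>

lemma inversions_swap: "inversions u v * inversions v u = 1 + degree_sum u * degree_sum v"
proof (induction u)
  case (Cons a u)
  have 1: "inversions [a] v * inversions v [a] = 1 + nilp a * degree_sum v"
  proof (induction v)
    case (Cons b v)
    have "inversions [a] (b # v) * inversions (b # v) [a]
       = (inversion a b * inversion b a) * (inversions [a] v * inversions v [a])"
      unfolding inversions_Cons2[of _ b v] inversions_Cons1[of b v] inversions_single by (simp only: ac_simps)
    then show ?case unfolding Cons inversion_swap by (simp add: algebra_simps)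
  qed simp
  have 2: "degree_sum v * (degree_sum v * x) = 0" for x by (simp flip: mult.assoc)
  have "inversions (a # u) v * inversions v (a # u)
     = (inversions [a] v * inversions v [a]) * (inversions u v * inversions v u)"
    unfolding inversions_Cons2[of _ a u] inversions_Cons1[of a u] by (simp only: ac_simps)
  then show ?case unfolding 1 Cons by (simp add: algebra_simps 2)
qed simp

abbreviation mod2_symbol :: "free_ring \<Rightarrow> mod2_ring" where
  "mod2_symbol \<equiv> linear_ext mod2_word"

lemma additive_mod2_symbol: "additive mod2_symbol"
  by (rule additive_linear_ext)

lemmas mod2_symbol_add = additive.add[OF additive_mod2_symbol]
  and mod2_symbol_zero = additive.zero[OF additive_mod2_symbol]

lemma mod2_symbol_diff: "mod2_symbol (x - y) = mod2_symbol x + mod2_symbol y"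
  by (simp add: additive.diff[OF additive_mod2_symbol] mod2_minus)

lemma mod2_symbol_sign: "mod2_symbol ((-1) ^ k * x) = mod2_symbol x"
  by (cases "even k") (simp_all add: additive.minus[OF additive_mod2_symbol])

text \<open>By \<open>inversions_swap\<close>, interchanging two adjacent blocks multiplies the symbol by \<open>1 + t\<^sub>u t\<^sub>v\<close>, where \<open>t\<^sub>w\<close>
denotes the degree sum of a word \<open>w\<close>.\<close>

lemma mod2_symbol_bracket:
  "mod2_symbol (frag_of p * bracket n u v * frag_of q) = mod2_word (p @ u @ v @ q) * (degree_sum u * degree_sum v)"
proof -
  have e: "frag_of p * bracket n u v * frag_of q
    = frag_of (p @ u @ v @ q) - (-1) ^ (odd_count n u * odd_count n v) * frag_of (p @ v @ u @ q)"
    by (simp add: bracket_def left_diff_distrib right_diff_distrib frag_of_mult sign_left_comm mult.assoc)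
  have "inversions v u = inversions u v * (inversions u v * inversions v u)"
    using inversions_square[of u v] by (simp flip: mult.assoc)
  then have "inversions v u = inversions u v * (1 + degree_sum u * degree_sum v)"
    by (simp only: inversions_swap)
  then have "mod2_word (p @ v @ u @ q) = mod2_word (p @ u @ v @ q) * (1 + degree_sum u * degree_sum v)"
    by (simp add: mod2_word_append inversions_append1 inversions_append2 ac_simps)
  then show ?thesis unfolding e mod2_symbol_diff mod2_symbol_sign linear_ext_frag_of by (simp add: distrib_left)
qed

text \<open>A triple bracket of words \<open>a\<close>, \<open>b\<close>, \<open>c\<close> contributes a multiple of \<open>t\<^sub>b t\<^sub>c t\<^sub>a (t\<^sub>b + t\<^sub>c)\<close>, which
is zero.\<close>

lemma mod2_symbol_M3:
  assumes "x \<in> M3 n" shows "mod2_symbol x = 0"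
proof (rule zspan_kernel[OF assms[unfolded M3_def] additive_mod2_symbol])
  fix s assume "s \<in> triple_products n"
  then obtain p a b c q where s: "s = frag_of p * triple_bracket n a b c * frag_of q" by auto
  let ?k = "odd_count n a * (odd_count n b + odd_count n c)"
  have e: "s = frag_of (p @ a) * bracket n b c * frag_of q
     - (-1) ^ ?k * (frag_of p * bracket n b c * frag_of (a @ q))"
    by (simp add: s triple_bracket_def algebra_simps frag_of_mult[symmetric] sign_left_comm)
  have "mod2_symbol (frag_of p * bracket n a (b @ c) * frag_of q)
     = mod2_word (p @ a @ b @ c @ q) + mod2_word (p @ b @ c @ a @ q)"
    by (simp add: bracket_def left_diff_distrib right_diff_distrib frag_of_mult sign_left_comm mult.assoc
        mod2_symbol_diff mod2_symbol_sign)
  then have "mod2_word (p @ b @ c @ a @ q)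
     = mod2_word (p @ a @ b @ c @ q) + mod2_word (p @ a @ b @ c @ q) * (degree_sum a * degree_sum (b @ c))"
    unfolding mod2_symbol_bracket by (metis append.assoc mod2_add_left)
  then show "mod2_symbol s = 0"
    unfolding e mod2_symbol_diff mod2_symbol_sign mod2_symbol_bracket by (simp add: algebra_simps)
qed

lemma degree_sum_count:
  assumes "finite I" "set w \<subseteq> I"
  shows "degree_sum w = (\<Sum>i\<in>I. of_nat (count_list w i) * nilp i)"
  using assms(2)
proof (induction w)
  case (Cons a w)
  have "(\<Sum>i\<in>I. of_nat (count_list (a # w) i) * nilp i)
     = (\<Sum>i\<in>I. of_nat (count_list w i) * nilp i + (if i = a then nilp i else 0))"
    by (rule sum.cong) (auto simp: algebra_simps)
  also have "\<dots> = degree_sum w + nilp a" using Cons assms(1) by (simp add: sum.distrib)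
  finally show ?case by simp
qed simp

text \<open>If all letters occur an even number of times, then \<open>t\<^sub>u + t\<^sub>v = 0\<close>, so \<open>t\<^sub>u t\<^sub>v\<close> is a square and vanishes. It
is here that even exponents differ from others: modulo two the symbol becomes a trace.\<close>

lemma mod2_symbol_bracket_even:
  assumes "\<And>i. even (count_list (u @ v) i)"
  shows "mod2_symbol (bracket n u v) = 0"
proof -
  have "degree_sum (u @ v) = 0"
    using degree_sum_count[of "set (u @ v)" "u @ v"] assms by (simp add: mod2_of_nat del: degree_sum_simps count_list_append)
  then have "degree_sum v = degree_sum u" by (metis degree_sum_simps(3) mod2_add_left add.right_neutral)
  then show ?thesis using mod2_symbol_bracket[of "[]" n u v "[]"] by (simp add: frag_of_Nil)
qed

definition generated_by :: "nat set \<Rightarrow> mod2_ring set" where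
  "generated_by zs = {x. \<forall>k\<in>Poly_Mapping.keys x. Poly_Mapping.keys k \<subseteq> zs}"

lemma generated_by_closed:
  "0 \<in> generated_by zs" "1 \<in> generated_by zs"
  "x \<in> generated_by zs \<Longrightarrow> y \<in> generated_by zs \<Longrightarrow> x + y \<in> generated_by zs"
  "x \<in> generated_by zs \<Longrightarrow> y \<in> generated_by zs \<Longrightarrow> x * y \<in> generated_by zs"
  "a \<in> zs \<Longrightarrow> nilp a \<in> generated_by zs"
proof -
  show add: "x + y \<in> generated_by zs" if "x \<in> generated_by zs" "y \<in> generated_by zs" for x y
    using that keys_add[of x y] by (auto simp: generated_by_def)
  show "x * y \<in> generated_by zs" if xy: "x \<in> generated_by zs" "y \<in> generated_by zs" for x y
    unfolding generated_by_def
  proof (intro CollectI ballI)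
    fix k assume "k \<in> Poly_Mapping.keys (x * y)"
    then obtain a b where "k = a + b" "a \<in> Poly_Mapping.keys x" "b \<in> Poly_Mapping.keys y"
      using keys_mult[of x y] by auto
    then show "Poly_Mapping.keys k \<subseteq> zs" using keys_add[of a b] xy by (auto simp: generated_by_def)
  qed
  show one: "1 \<in> generated_by zs" by (simp add: generated_by_def)
  show "nilp a \<in> generated_by zs" if "a \<in> zs"
    unfolding nilp_def by (rule add[OF one]) (use that in \<open>simp add: generated_by_def\<close>)
qed (simp add: generated_by_def)

lemma generated_by_mono: "zs \<subseteq> zs' \<Longrightarrow> x \<in> generated_by zs \<Longrightarrow> x \<in> generated_by zs'"
  by (auto simp: generated_by_def)

lemma add_closed_generated_by: "add_closed (generated_by zs)"
  by (auto simp: add_closed_def mod2_minus generated_by_closed)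

lemma lookup_single_mult:
  fixes y :: mod2_ring
  shows "Poly_Mapping.lookup (Poly_Mapping.single k 1 * y) (k + l) = Poly_Mapping.lookup y l"
  by (simp only: lookup_mult lookup_single when_mult mult_1 Sum_any_when_equal' add_left_cancel)

lemma nilp_split:
  assumes "x \<in> generated_by zs" "y \<in> generated_by zs" "z \<notin> zs" "x + nilp z * y = 0"
  shows "x = 0" "y = 0"
proof -
  let ?e = "Poly_Mapping.single z (1::bit)"
  have eq: "Poly_Mapping.single ?e 1 * y = x + y"
  proof -
    have "(x + y) + Poly_Mapping.single ?e 1 * y = 0" using assms(4) by (simp add: nilp_def algebra_simps)
    then show ?thesis by (metis mod2_add_left add.right_neutral)
  qed
  have "Poly_Mapping.lookup y l = 0" for l
  proof (rule ccontr)
    assume "Poly_Mapping.lookup y l \<noteq> 0"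
    then have l: "l \<in> Poly_Mapping.keys y" by (simp add: in_keys_iff)
    have "Poly_Mapping.lookup (x + y) (?e + l) \<noteq> 0"
      using lookup_single_mult[of ?e y l] \<open>Poly_Mapping.lookup y l \<noteq> 0\<close> unfolding eq by simp
    then have "?e + l \<in> Poly_Mapping.keys (x + y)" by (simp add: in_keys_iff)
    then have "Poly_Mapping.keys (?e + l) \<subseteq> zs"
      using generated_by_closed(3)[OF assms(1,2)] by (auto simp: generated_by_def)
    moreover have "z \<in> Poly_Mapping.keys (?e + l)"
    proof -
      have "Poly_Mapping.lookup l z = 0"
        using l assms(2,3) unfolding generated_by_def mem_Collect_eq by (metis in_keys_iff subsetD)
      then show ?thesis by (simp add: in_keys_iff lookup_add)
    qed
    ultimately show False using assms(3) by auto
  qed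
  then show y: "y = 0" by (intro poly_mapping_eqI) simp
  then show "x = 0" using assms(4) by simp
qed

lemma nilp_eq_0: "y \<in> generated_by zs \<Longrightarrow> z \<notin> zs \<Longrightarrow> nilp z * y = 0 \<Longrightarrow> y = 0"
  using nilp_split(2)[of 0 zs y z] generated_by_closed(1) by simp

lemma inversions_generated: "set u \<subseteq> zs \<Longrightarrow> set v \<subseteq> zs \<Longrightarrow> inversions u v \<in> generated_by zs"
proof (induction u)
  case (Cons a u)
  have "inversions [a] v \<in> generated_by zs" using Cons.prems
  proof (induction v)
    case (Cons b v)
    then show ?case unfolding inversions_Cons2[of _ b v] inversions_single
      by (auto simp: inversion_def intro!: generated_by_closed)
  qed (simp add: generated_by_closed)
  then show ?case using Cons unfolding inversions_Cons1[of a u] by (auto intro: generated_by_closed)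
qed (simp add: generated_by_closed)

lemma mod2_word_generated: "set w \<subseteq> zs \<Longrightarrow> mod2_word w \<in> generated_by zs"
  by (induction w) (auto intro!: generated_by_closed inversions_generated)

lemma nilp_inversions:
  "nilp z * inversions (replicate c z) v = nilp z" "nilp z * inversions v (replicate c z) = nilp z"
proof -
  have 1: "nilp z * inversions [z] v = nilp z"
  proof (induction v)
    case (Cons b v)
    have "nilp z * inversions [z] (b # v) = (nilp z * inversions [z] v) * inversion z b"
      unfolding inversions_Cons2[of _ b v] inversions_single by (simp only: ac_simps)
    then show ?case unfolding Cons by (simp add: inversion_def algebra_simps)
  qed simp
  show "nilp z * inversions (replicate c z) v = nilp z"
  proof (induction c)
    case (Suc c)
    have "nilp z * inversions (replicate (Suc c) z) v = (nilp z * inversions [z] v) * inversions (replicate c z) v"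
      by (simp add: inversions_Cons1[of z "replicate c z"] ac_simps)
    then show ?case unfolding 1 Suc .
  qed simp
  have 2: "nilp z * inversions v [z] = nilp z"
  proof (induction v)
    case (Cons b v)
    have "nilp z * inversions (b # v) [z] = (nilp z * inversions v [z]) * inversion b z"
      unfolding inversions_Cons1[of b v] inversions_single by (simp only: ac_simps)
    then show ?case unfolding Cons by (simp add: inversion_def algebra_simps)
  qed simp
  show "nilp z * inversions v (replicate c z) = nilp z"
  proof (induction c)
    case (Suc c)
    have "nilp z * inversions v (replicate (Suc c) z) = (nilp z * inversions v [z]) * inversions v (replicate c z)"
      by (simp add: inversions_Cons2[of v z "replicate c z"] ac_simps)
    then show ?case unfolding 2 Suc .
  qed simp
qed

lemma mod2_word_replicate [simp]: "mod2_word (replicate c z) = 1"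
proof (induction c)
  case (Suc c)
  have "inversions [z] (replicate c z) = 1"
    by (induction c) (simp_all add: inversions_def inversion_def)
  then show ?case using Suc by simp
qed simp

lemma nilp_mod2_word_power: "nilp z * mod2_word (replicate c z @ w) = nilp z * mod2_word w"
proof -
  have "nilp z * mod2_word (replicate c z @ w) = (nilp z * inversions (replicate c z) w) * mod2_word w"
    by (simp add: mod2_word_append ac_simps)
  then show ?thesis unfolding nilp_inversions .
qed

lemma nilp_mod2_word_Cons: "nilp z * mod2_word (z # w) = nilp z * mod2_word w"
  using nilp_mod2_word_power[of z 1 w] by (simp only: One_nat_def replicate_Suc replicate_0 append_Cons append_Nil)

lemma mod2_symbol_oneform: "mod2_symbol (bracket n [v] [a] * frag_of g) = nilp v * (nilp a * mod2_word (a # g))"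
proof -
  have "mod2_symbol (bracket n [v] [a] * frag_of g) = mod2_word (v # a # g) * (nilp v * nilp a)"
    using mod2_symbol_bracket[of "[]" n "[v]" "[a]" g] by (simp add: frag_of_Nil del: mod2_word.simps)
  also have "\<dots> = nilp a * (nilp v * mod2_word (v # a # g))" by (simp only: ac_simps)
  finally show ?thesis unfolding nilp_mod2_word_Cons[of v] by (simp only: ac_simps)
qed

lemma mod2_symbol_power_oneform:
  "mod2_symbol (frag_of (replicate c z) * (bracket n [v] [z] * frag_of g)) = nilp v * (nilp z * mod2_word g)"
proof -
  have "mod2_symbol (frag_of (replicate c z) * (bracket n [v] [z] * frag_of g))
     = mod2_word (replicate c z @ v # z # g) * (nilp v * nilp z)"
    using mod2_symbol_bracket[of "replicate c z" n "[v]" "[z]" g] by (simp add: mult.assoc del: mod2_word.simps)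
  also have "\<dots> = nilp v * (nilp z * mod2_word (replicate c z @ v # z # g))" by (simp only: ac_simps)
  also have "\<dots> = nilp z * (nilp v * mod2_word (v # z # g))"
    unfolding nilp_mod2_word_power by (simp only: ac_simps)
  also have "\<dots> = nilp v * (nilp z * mod2_word (z # g))"
    unfolding nilp_mod2_word_Cons[of v] by (simp only: ac_simps)
  finally show ?thesis unfolding nilp_mod2_word_Cons[of z] .
qed

lemma mod2_symbol_oneforms:
  assumes "w \<in> oneforms n zs v m"
  shows "\<exists>y\<in>generated_by zs. mod2_symbol w = nilp v * y"
proof -
  have "mod2_symbol w \<in> (\<lambda>y. nilp v * y) ` generated_by zs"
  proof (rule zspan_image[OF assms[unfolded oneforms_def] additive_mod2_symbol])
    show "add_closed ((\<lambda>y. nilp v * y) ` generated_by zs)"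
      unfolding add_closed_def
    proof (intro conjI ballI)
      show "0 \<in> (\<lambda>y. nilp v * y) ` generated_by zs"
        by (rule image_eqI[of _ _ 0]) (simp_all add: generated_by_closed)
      fix x y assume "x \<in> (\<lambda>y. nilp v * y) ` generated_by zs" "y \<in> (\<lambda>y. nilp v * y) ` generated_by zs"
      then obtain x' y' where "x' \<in> generated_by zs" "y' \<in> generated_by zs" "x = nilp v * x'" "y = nilp v * y'" by auto
      then show "x - y \<in> (\<lambda>y. nilp v * y) ` generated_by zs"
        by (intro image_eqI[of _ _ "x' + y'"]) (simp_all add: generated_by_closed mod2_minus distrib_left)
    qed
    fix s assume "s \<in> oneform_words n zs v m"
    then obtain a g where s: "s = bracket n [v] [a] * frag_of g" and "set (a # g) \<subseteq> zs" by (auto simp: words_of_def)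
    then show "mod2_symbol s \<in> (\<lambda>y. nilp v * y) ` generated_by zs"
      unfolding s mod2_symbol_oneform by (intro imageI generated_by_closed mod2_word_generated) auto
  qed
  then show ?thesis by auto
qed

lemma mod2_symbol_word_span: "x \<in> word_span zs m \<Longrightarrow> mod2_symbol x \<in> generated_by zs"
  unfolding word_span_def
  by (erule zspan_image[OF _ additive_mod2_symbol add_closed_generated_by])
     (auto simp: words_of_def intro: mod2_word_generated)

definition homogeneous :: "nat multiset \<Rightarrow> free_ring set" where
  "homogeneous M = zspan (frag_of ` {w. mset w = M})"

lemma word_span_homogeneous:
  assumes "x \<in> word_span zs m" shows "\<exists>M. set_mset M \<subseteq> zs \<and> x \<in> homogeneous M"
proof (cases "words_of zs m = {}")
  case True
  then have "x \<in> zspan {}" using assms by (simp add: word_span_def)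
  then have "x = 0" by (induction rule: zspan.induct) auto
  then show ?thesis by (intro exI[of _ "{#}"]) (simp add: homogeneous_def zspan.zero)
next
  case False
  then obtain w0 where w0: "w0 \<in> words_of zs m" by auto
  have "mset w = mset w0" if "w \<in> words_of zs m" for w
  proof (rule multiset_eqI)
    fix i
    have "count_list w i = count_list w0 i"
    proof (cases "i \<in> zs")
      case False
      then have "i \<notin> set w" "i \<notin> set w0" using that w0 by (auto simp: words_of_def)
      then show ?thesis by (metis count_list_0_iff)
    qed (use that w0 in \<open>simp add: words_of_def\<close>)
    then show "count (mset w) i = count (mset w0) i" by (simp add: count_mset)
  qed
  then have "frag_of ` words_of zs m \<subseteq> homogeneous (mset w0)"
    unfolding homogeneous_def by (auto intro: zspan.base)
  then have "x \<in> homogeneous (mset w0)"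
    using zspan_least[OF assms[unfolded word_span_def]] by (simp add: homogeneous_def add_closed_zspan)
  then show ?thesis using w0 by (intro exI[of _ "mset w0"]) (auto simp: words_of_def)
qed

lemma word_span_insert_one:
  assumes "v \<notin> zs" "w \<in> oneforms n zs v m" shows "w \<in> word_span (insert v zs) (m(v := 1))"
  using assms(2) unfolding oneforms_def
proof (rule zspan_least[OF _ add_closed_word_span], safe)
  fix a g assume "a # g \<in> words_of zs m"
  then have "v # a # g \<in> words_of (insert v zs) (m(v := 1))"
    using assms(1) by (auto simp: words_of_def count_list_0_iff)
  then show "bracket n [v] [a] * frag_of g \<in> word_span (insert v zs) (m(v := 1))" by (rule word_span_bracket)
qed

text \<open>The inversions between \<open>z\<^sup>c\<close> and a word depend on the letters of the word alone, not on their order.\<close>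

lemma mod2_symbol_power:
  assumes "x \<in> homogeneous M"
  shows "\<exists>\<tau>\<in>generated_by (set_mset M). mod2_symbol (frag_of (replicate c z) * x) = (1 + nilp z * \<tau>) * mod2_symbol x"
    "even c \<Longrightarrow> mod2_symbol (frag_of (replicate c z) * x) = mod2_symbol x"
proof -
  define \<sigma> where "\<sigma> = sum_mset (image_mset (\<lambda>b. if b < z then nilp b else 0) M)"
  have \<sigma>: "\<sigma> \<in> generated_by (set_mset M)" unfolding \<sigma>_def
    by (induction M) (auto intro!: generated_by_closed intro: generated_by_mono[rotated])
  have row: "inversions [z] g = 1 + nilp z * \<sigma>" if g: "mset g = M" for g
  proof -
    have "inversions [z] h = 1 + nilp z * sum_mset (image_mset (\<lambda>b. if b < z then nilp b else 0) (mset h))" for h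
    proof (induction h)
      case (Cons b h)
      then show ?case unfolding inversions_Cons2[of _ b h] inversions_single
        by (simp add: inversion_def algebra_simps)
    qed simp
    from this[of g] show ?thesis unfolding g \<sigma>_def .
  qed
  define \<tau> where "\<tau> = (if even c then 0 else \<sigma>)"
  have pow: "inversions (replicate c z) g = 1 + nilp z * \<tau>" if g: "mset g = M" for g
    unfolding \<tau>_def
  proof (induction c)
    case (Suc c)
    then show ?case unfolding replicate_Suc inversions_Cons1[of z "replicate c z"] row[OF g]
      by (auto simp: algebra_simps)
  qed simp
  have *: "mod2_symbol (frag_of (replicate c z) * x) = (1 + nilp z * \<tau>) * mod2_symbol x"
    using assms unfolding homogeneous_def
  proof induction
    case (base y)
    then show ?case by (auto simp: frag_of_mult mod2_word_append pow)
  qed (auto simp: mod2_symbol_diff mod2_symbol_zero right_diff_distrib algebra_simps)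
  have "\<tau> \<in> generated_by (set_mset M)" using \<sigma> by (simp add: \<tau>_def generated_by_closed)
  with * show "\<exists>\<tau>\<in>generated_by (set_mset M). mod2_symbol (frag_of (replicate c z) * x) = (1 + nilp z * \<tau>) * mod2_symbol x"
    by blast
  show "even c \<Longrightarrow> mod2_symbol (frag_of (replicate c z) * x) = mod2_symbol x"
    using * by (simp add: \<tau>_def)
qed

lemma mod2_symbol_power_oneforms:
  assumes "w \<in> oneforms n zs z m"
  shows "mod2_symbol (frag_of (replicate c z) * w) = mod2_symbol w"
  using assms unfolding oneforms_def
proof induction
  case (base y)
  then obtain a g where y: "y = bracket n [z] [a] * frag_of g" by auto
  have "mod2_symbol (frag_of (replicate c z) * y) = mod2_word (replicate c z @ z # a # g) * (nilp z * nilp a)"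
    using mod2_symbol_bracket[of "replicate c z" n "[z]" "[a]" g]
    by (simp add: y mult.assoc del: mod2_word.simps)
  also have "\<dots> = nilp a * (nilp z * mod2_word (replicate c z @ z # a # g))" by (simp only: ac_simps)
  also have "\<dots> = mod2_symbol y"
    unfolding y nilp_mod2_word_power nilp_mod2_word_Cons[of z] mod2_symbol_oneform by (simp only: ac_simps)
  finally show ?case .
qed (auto simp: mod2_symbol_diff mod2_symbol_zero right_diff_distrib)

lemma mod2_symbol_power_bracket_word_span:
  assumes "f \<in> word_span zs m"
  shows "mod2_symbol (frag_of (replicate c z) * bracket n [v] [z] * f) = nilp v * (nilp z * mod2_symbol f)"
  using assms unfolding word_span_def
proof induction
  case (base y)
  then show ?case using mod2_symbol_power_oneform by (auto simp: mult.assoc)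
qed (auto simp: mod2_symbol_diff mod2_symbol_zero right_diff_distrib distrib_left)

definition M3_mod2 :: "nat \<Rightarrow> free_ring set" where
  "M3_mod2 n = {x. \<exists>y. x - 2 * y \<in> M3 n}"

lemma two_sided_M3_mod2: "two_sided (M3_mod2 n)"
proof -
  note ts = two_sidedD[OF two_sided_M3[of n]]
  have "x - x' \<in> M3_mod2 n" if x: "x \<in> M3_mod2 n" "x' \<in> M3_mod2 n" for x x'
  proof -
    obtain y y' where "x - 2 * y \<in> M3 n" "x' - 2 * y' \<in> M3 n" using x by (auto simp: M3_mod2_def)
    then have "(x - 2 * y) - (x' - 2 * y') \<in> M3 n" by (rule add_closedD(2)[OF ts(1)])
    then have "(x - x') - 2 * (y - y') \<in> M3 n" by (simp add: algebra_simps)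
    then show ?thesis unfolding M3_mod2_def by blast
  qed
  moreover have "a * x \<in> M3_mod2 n \<and> x * a \<in> M3_mod2 n" if x: "x \<in> M3_mod2 n" for a x
  proof -
    obtain y where y: "x - 2 * y \<in> M3 n" using x by (auto simp: M3_mod2_def)
    have "a * (x - 2 * y) = a * x - 2 * (a * y)" "(x - 2 * y) * a = x * a - 2 * (y * a)"
      by (simp_all add: algebra_simps mult_2 mult_2_right)
    then show ?thesis using ts(2)[OF y, of a] ts(3)[OF y, of a] unfolding M3_mod2_def by auto
  qed
  moreover have "0 \<in> M3_mod2 n"
    using add_closedD(1)[OF ts(1)] by (auto simp: M3_mod2_def intro!: exI[of _ 0])
  ultimately show ?thesis by (auto simp: two_sided_def add_closed_def)
qed

lemma M3_subset_mod2: "M3 n \<subseteq> M3_mod2 n"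
  by (auto simp: M3_mod2_def intro!: exI[of _ 0])

lemma double_in_M3_mod2: "2 * x \<in> M3_mod2 n"
  using add_closedD(1)[OF add_closed_M3] by (auto simp: M3_mod2_def intro!: exI[of _ x])

lemma mod2_symbol_M3_mod2: "x \<in> M3_mod2 n \<Longrightarrow> mod2_symbol x = 0"
proof -
  assume "x \<in> M3_mod2 n"
  then obtain y where "x - 2 * y \<in> M3 n" by (auto simp: M3_mod2_def)
  from mod2_symbol_M3[OF this] have "mod2_symbol x + mod2_symbol (2 * y) = 0" by (simp add: mod2_symbol_diff)
  moreover have "mod2_symbol (2 * y) = 0" by (simp add: mult_2 mod2_symbol_add)
  ultimately show ?thesis by simp
qed

lemma mod2_symbol_faithful:
  assumes "finite zs" "\<And>i. i \<in> zs \<Longrightarrow> m i > 0"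
  shows "x \<in> word_span zs m \<Longrightarrow> mod2_symbol x = 0 \<Longrightarrow> x \<in> M3_mod2 n"
    "v \<notin> zs \<Longrightarrow> w \<in> oneforms n zs v m \<Longrightarrow> mod2_symbol w = 0 \<Longrightarrow> w \<in> M3_mod2 n"
proof -
  have "(\<forall>x\<in>word_span zs m. mod2_symbol x = 0 \<longrightarrow> x \<in> M3_mod2 n) \<and>
      (\<forall>v. v \<notin> zs \<longrightarrow> (\<forall>x\<in>oneforms n zs v m. mod2_symbol x = 0 \<longrightarrow> x \<in> M3_mod2 n))"
  proof (rule kernel_detection[OF additive_mod2_symbol two_sided_M3_mod2 M3_subset_mod2 mod2_symbol_M3])
    fix k assume "mod2_symbol (of_int k) = 0"
    moreover have "mod2_symbol (of_int k) = of_int k"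
    proof -
      have "mod2_symbol 1 = 1" by (simp flip: frag_of_Nil)
      then show ?thesis by (induction k rule: int_induct[of _ 0])
        (simp_all add: mod2_symbol_zero mod2_symbol_add mod2_symbol_diff mod2_minus)
    qed
    ultimately have "even k" by (simp add: mod2_of_int split: if_splits)
    then have "of_int k = 2 * (of_int (k div 2) :: free_ring)" by (metis dvd_mult_div_cancel of_int_mult of_int_numeral)
    then show "of_int k \<in> M3_mod2 n" using double_in_M3_mod2 by simp
  next
    fix zs z m c f w
    assume z: "z \<notin> zs" and f: "f \<in> word_span zs m" and w: "w \<in> oneforms n zs z m"
      and eq: "mod2_symbol (frag_of (replicate c z) * f + frag_of (replicate (c - 1) z) * w) = 0"
    obtain M where M: "set_mset M \<subseteq> zs" "f \<in> homogeneous M" using word_span_homogeneous[OF f] by auto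
    obtain \<tau> where \<tau>: "\<tau> \<in> generated_by (set_mset M)"
      "mod2_symbol (frag_of (replicate c z) * f) = (1 + nilp z * \<tau>) * mod2_symbol f"
      using mod2_symbol_power(1)[OF M(2), of c z] by auto
    obtain y where y: "y \<in> generated_by zs" "mod2_symbol w = nilp z * y" using mod2_symbol_oneforms[OF w] by auto
    note F = mod2_symbol_word_span[OF f]
    have "mod2_symbol f + nilp z * (\<tau> * mod2_symbol f + y) = 0"
      using eq by (simp add: mod2_symbol_add \<tau>(2) mod2_symbol_power_oneforms[OF w] y(2) algebra_simps)
    from nilp_split[OF F _ z this] have "mod2_symbol f = 0" "\<tau> * mod2_symbol f + y = 0"
      using generated_by_mono[OF M(1) \<tau>(1)] F y(1) by (simp_all add: generated_by_closed)
    then show "mod2_symbol f = 0 \<and> mod2_symbol w = 0" using y(2) by simp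
  next
    fix zs v z m c f w
    assume z: "z \<notin> zs" and v: "v \<notin> insert z zs" and w: "w \<in> oneforms n zs v m" and f: "f \<in> word_span zs m"
      and eq: "mod2_symbol (frag_of (replicate c z) * w + frag_of (replicate (c - 1) z) * bracket n [v] [z] * f) = 0"
    have v': "v \<notin> zs" and z': "z \<notin> insert v zs" using z v by auto
    note w' = word_span_insert_one[OF v' w]
    obtain M where M: "set_mset M \<subseteq> insert v zs" "w \<in> homogeneous M" using word_span_homogeneous[OF w'] by auto
    obtain \<tau> where \<tau>: "\<tau> \<in> generated_by (set_mset M)"
      "mod2_symbol (frag_of (replicate c z) * w) = (1 + nilp z * \<tau>) * mod2_symbol w"
      using mod2_symbol_power(1)[OF M(2), of c z] by auto
    note W = mod2_symbol_word_span[OF w']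
    have F: "mod2_symbol f \<in> generated_by zs" by (rule mod2_symbol_word_span[OF f])
    have "mod2_symbol w + nilp z * (\<tau> * mod2_symbol w + nilp v * mod2_symbol f) = 0"
      using eq unfolding mod2_symbol_add \<tau>(2) mod2_symbol_power_bracket_word_span[OF f]
      by (simp add: algebra_simps)
    moreover have "\<tau> * mod2_symbol w + nilp v * mod2_symbol f \<in> generated_by (insert v zs)"
      using generated_by_mono[OF M(1) \<tau>(1)] W generated_by_mono[OF _ F, of "insert v zs"]
      by (auto intro!: generated_by_closed)
    ultimately have "mod2_symbol w = 0" "nilp v * mod2_symbol f = 0"
      using nilp_split[OF W _ z', of "\<tau> * mod2_symbol w + nilp v * mod2_symbol f"] by auto
    then show "mod2_symbol w = 0 \<and> mod2_symbol f = 0" using nilp_eq_0[OF F v'] by simp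
  qed (assumption | fact assms)+
  then show "x \<in> word_span zs m \<Longrightarrow> mod2_symbol x = 0 \<Longrightarrow> x \<in> M3_mod2 n"
    "v \<notin> zs \<Longrightarrow> w \<in> oneforms n zs v m \<Longrightarrow> mod2_symbol w = 0 \<Longrightarrow> w \<in> M3_mod2 n" by auto
qed

section \<open>Projection to a multidegree\<close>

definition relations :: "nat \<Rightarrow> free_ring set" where
  "relations n = mod_set (L2 n) (M3 n)"

lemma add_closed_L2: "add_closed (L2 n)" by (simp add: L2_def add_closed_zspan)

lemma bracket_in_L2: "bracket n u v \<in> L2 n"
  unfolding L2_def by (rule zspan.base) blast

lemma add_closed_relations: "add_closed (relations n)"
  unfolding relations_def by (intro add_closed_mod_set add_closed_L2 add_closed_M3)

lemma L2_subset_relations: "L2 n \<subseteq> relations n" and M3_subset_relations: "M3 n \<subseteq> relations n"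
  unfolding relations_def by (auto intro: mod_set_left add_closed_M3 mod_set_right add_closed_L2)



lemma homogeneous_word: "frag_of w \<in> homogeneous (mset w)"
  unfolding homogeneous_def by (rule zspan.base) simp

lemma add_closed_homogeneous: "add_closed (homogeneous M)"
  by (simp add: homogeneous_def add_closed_zspan)

lemma homogeneous_word_eq: "mset w = M \<Longrightarrow> frag_of w \<in> homogeneous M"
  using homogeneous_word by blast

lemma homogeneous_bracket: "bracket n u v \<in> homogeneous (mset u + mset v)"
  unfolding bracket_def
  by (intro add_closedD(2)[OF add_closed_homogeneous] add_closed_sign[OF add_closed_homogeneous] homogeneous_word_eq)
     (simp_all add: ac_simps)

lemma homogeneous_mult:
  assumes "x \<in> homogeneous M" shows "frag_of p * x * frag_of q \<in> homogeneous (mset p + M + mset q)"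
  using assms unfolding homogeneous_def[of M]
proof (induction rule: zspan.induct)
  case zero then show ?case by (simp add: add_closedD(1)[OF add_closed_homogeneous])
next
  case (base x) then show ?case by (auto simp: frag_of_mult intro!: homogeneous_word_eq)
next
  case (diff x y) then show ?case
    using add_closedD(2)[OF add_closed_homogeneous] by (simp add: algebra_simps)
qed

lemma homogeneous_triple:
  "frag_of p * triple_bracket n a b c * frag_of q \<in> homogeneous (mset (p @ a @ b @ c @ q))"
proof -
  have "triple_bracket n a b c \<in> homogeneous (mset a + (mset b + mset c))"
    unfolding triple_bracket_def
  proof (intro add_closedD(2)[OF add_closed_homogeneous] add_closed_sign[OF add_closed_homogeneous])
    show "frag_of a * bracket n b c \<in> homogeneous (mset a + (mset b + mset c))"
      using homogeneous_mult[OF homogeneous_bracket, of a n b c "[]"] by (simp add: frag_of_Nil)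
    show "bracket n b c * frag_of a \<in> homogeneous (mset a + (mset b + mset c))"
      using homogeneous_mult[OF homogeneous_bracket, of "[]" n b c a] by (simp add: frag_of_Nil ac_simps)
  qed
  from homogeneous_mult[OF this, of p q] show ?thesis by (simp add: ac_simps)
qed

text \<open>The projection onto a multidegree. It keeps or kills each of the multihomogeneous generators of \<open>M\<^sub>3\<close> and
\<open>L\<^sub>2\<close>, so membership in these subgroups can be tested within one multidegree.\<close>

definition component :: "nat set \<Rightarrow> (nat \<Rightarrow> nat) \<Rightarrow> free_ring \<Rightarrow> free_ring" where
  "component zs m = linear_ext (\<lambda>w. if w \<in> words_of zs m then frag_of w else 0)"

lemma additive_component: "additive (component zs m)"
  unfolding component_def by (rule additive_linear_ext)

lemma component_in_word_span: "component zs m x \<in> word_span zs m"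
  by (induction x rule: frag_induct)
     (auto simp: component_def additive.zero[OF additive_linear_ext] additive.diff[OF additive_linear_ext]
        word_span_base intro: add_closedD[OF add_closed_word_span])

lemma component_word_span: "x \<in> word_span zs m \<Longrightarrow> component zs m x = x"
  unfolding word_span_def
  by (induction rule: zspan.induct)
     (auto simp: component_def additive.zero[OF additive_linear_ext] additive.diff[OF additive_linear_ext])

lemma words_of_mset: "mset u = mset v \<Longrightarrow> u \<in> words_of zs m \<longleftrightarrow> v \<in> words_of zs m"
  unfolding words_of_def mem_Collect_eq by (metis count_mset set_mset_mset)

lemma component_homogeneous:
  assumes "x \<in> homogeneous (mset w)"
  shows "component zs m x = (if w \<in> words_of zs m then x else 0)"
  using assms unfolding homogeneous_def
proof (induction rule: zspan.induct)
  case (base x)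
  then obtain u where "x = frag_of u" "mset u = mset w" by auto
  then show ?case using words_of_mset[of u w zs m] by (simp add: component_def)
qed (simp_all add: additive.zero[OF additive_component] additive.diff[OF additive_component])

lemma component_M3: "x \<in> M3 n \<Longrightarrow> component zs m x \<in> M3 n"
proof -
  assume "x \<in> M3 n"
  then show ?thesis unfolding M3_def[of n]
  proof (rule zspan_image[OF _ additive_component add_closed_zspan])
    fix s assume s: "s \<in> triple_products n"
    then obtain w where "s \<in> homogeneous (mset w)" using homogeneous_triple by blast
    from component_homogeneous[OF this, of zs m]
    show "component zs m s \<in> zspan (triple_products n)"
      using zspan.base[OF s] by (simp add: zspan.zero)
  qed
qed

lemma component_L2: "x \<in> L2 n \<Longrightarrow> component zs m x \<in> zspan {bracket n u v |u v. u @ v \<in> words_of zs m}"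
  unfolding L2_def
proof (erule zspan_image[OF _ additive_component add_closed_zspan])
  fix s assume "s \<in> {bracket n u v |u v. True}"
  then obtain u v where s: "s = bracket n u v" by auto
  have "bracket n u v \<in> homogeneous (mset (u @ v))" using homogeneous_bracket by simp
  from component_homogeneous[OF this, of zs m]
  show "component zs m s \<in> zspan {bracket n u v |u v. u @ v \<in> words_of zs m}"
    using zspan.base[of s "{bracket n u v |u v. u @ v \<in> words_of zs m}"] unfolding s by (auto simp: zspan.zero)
qed

lemma component_L2': "x \<in> L2 n \<Longrightarrow> component zs m x \<in> L2 n"
  using zspan_least[OF component_L2 add_closed_L2] bracket_in_L2 by blast

lemma relations_component:
  assumes "x \<in> relations n" "x \<in> word_span zs m"
  obtains l where "l \<in> zspan {bracket n u v |u v. u @ v \<in> words_of zs m}" "x - l \<in> M3 n"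
proof -
  obtain l where "l \<in> L2 n" "x - l \<in> M3 n" using assms(1) by (auto simp: relations_def mod_set_def)
  then have "component zs m l \<in> zspan {bracket n u v |u v. u @ v \<in> words_of zs m}"
    "x - component zs m l \<in> M3 n"
    using component_L2 component_M3[of "x - l" n zs m] component_word_span[OF assms(2)]
    by (auto simp: additive.diff[OF additive_component])
  then show ?thesis by (rule that)
qed



section \<open>The trace\<close>

definition odd_degree :: "nat \<Rightarrow> nat set \<Rightarrow> (nat \<Rightarrow> nat) \<Rightarrow> nat" where
  "odd_degree n zs m = (\<Sum>i\<in>zs. if n \<le> i then m i else 0)"

lemma odd_count_words_of:
  assumes "finite zs" "w \<in> words_of zs m" shows "odd_count n w = odd_degree n zs m"
proof -
  have "odd_count n w = (\<Sum>i\<in>zs. if n \<le> i then count_list w i else 0)" if "set w \<subseteq> zs" for w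
    using that
  proof (induction w)
    case (Cons a w)
    have "(\<Sum>i\<in>zs. if n \<le> i then count_list (a # w) i else 0)
       = (\<Sum>i\<in>zs. (if n \<le> i then count_list w i else 0) + (if i = a then if n \<le> a then 1 else 0 else 0))"
      by (rule sum.cong) auto
    also have "\<dots> = odd_count n (a # w)"
      using Cons assms(1) by (simp add: sum.distrib odd_count_def)
    finally show ?case by simp
  qed (simp cong: if_cong)
  then show ?thesis using assms(2) by (auto simp: odd_degree_def words_of_def intro: sum.cong)
qed

text \<open>The kernel of the trace on elements with \<open>d\<close> odd letters.\<close>

definition traceless :: "nat \<Rightarrow> nat \<Rightarrow> free_ring set" where
  "traceless n d = {x. \<forall>S. even (card S) \<noteq> even d \<longrightarrow> symbol n x S = 0}"

lemma add_closed_traceless: "add_closed (traceless n d)"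
  unfolding add_closed_def traceless_def mem_Collect_eq
  by (simp add: additive.zero[OF additive_symbol] additive.diff[OF additive_symbol])

lemma relations_traceless:
  assumes "finite zs" "x \<in> relations n" "x \<in> word_span zs m"
  shows "x \<in> traceless n (odd_degree n zs m)"
proof -
  obtain l where l: "l \<in> zspan {bracket n u v |u v. u @ v \<in> words_of zs m}" "x - l \<in> M3 n"
    using relations_component[OF assms(2,3)] .
  have "l \<in> traceless n (odd_degree n zs m)"
  proof (rule zspan_least[OF l(1) add_closed_traceless], safe)
    fix u v assume "u @ v \<in> words_of zs m"
    from odd_count_words_of[OF assms(1) this, of n] show "bracket n u v \<in> traceless n (odd_degree n zs m)"
      unfolding traceless_def by (auto simp flip: odd_count_append intro!: symbol_bracket_parity)
  qed
  moreover have "symbol n x = symbol n l" using symbol_M3[OF l(2)] by (simp add: additive.diff[OF additive_symbol])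
  ultimately show ?thesis by (simp add: traceless_def)
qed

lemma multiple_traceless:
  assumes "of_nat k * x \<in> traceless n d" "k > 0" shows "x \<in> traceless n d"
proof -
  have "symbol n (of_nat k * x) S = int k * symbol n x S" for S
    by (induction k) (simp_all add: additive.zero[OF additive_symbol] additive.add[OF additive_symbol] algebra_simps)
  then show ?thesis using assms by (auto simp: traceless_def)
qed

text \<open>For each set \<open>S\<close> that does not contain \<open>y\<close>, exactly one of \<open>S\<close> and \<open>S \<union> {y}\<close> has the parity seen by the trace, and both have the
same coefficient up to sign.\<close>

lemma traceless_leading_zero:
  assumes A: "A \<in> supported zs" and y: "y \<notin> zs"
    and tr: "\<And>S. even (card S) \<noteq> even d \<Longrightarrow> app ((1 + wedge y) * parity) A S = 0"
  shows "A = 0"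
proof
  fix S show "A S = 0 S"
  proof (rule ccontr)
    assume "A S \<noteq> 0 S"
    then have AS: "A S \<noteq> 0" by simp
    then have S: "finite S" "S \<subseteq> zs" using supportedD[OF A] by blast+
    have yS: "y \<notin> S" using S y by auto
    show False
    proof (cases "even (card S) = even d")
      case False
      have "app ((1 + wedge y) * parity) A S = (-1) ^ card S * A S"
        using yS by (simp add: app_wedge app_parity)
      then show False using tr[OF False] AS by simp
    next
      case True
      have c: "card (insert y S) = Suc (card S)" using S yS by simp
      have "A (insert y S) = 0" using supportedD[OF A, of "insert y S"] y by blast
      moreover have "insert y S - {y} = S" using yS by auto
      ultimately have "app ((1 + wedge y) * parity) A (insert y S)
         = (-1) ^ card {j \<in> insert y S. j < y} * ((-1) ^ card S * A S)"
        using S by (simp add: app_wedge app_parity)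
      moreover have "app ((1 + wedge y) * parity) A (insert y S) = 0" using tr[of "insert y S"] True c by simp
      ultimately show False using AS by simp
    qed
  qed
qed

lemma traceless_leading_word_span:
  assumes "f \<in> word_span zs m" "y \<notin> zs" "n \<le> y" "odd c" "frag_of (replicate c y) * f \<in> traceless n d"
  shows "symbol n f = 0"
  using assms(4,5) word_op_power_odd[OF assms(3), of c]
  by (intro traceless_leading_zero[OF symbol_word_span_supported[OF assms(1)] assms(2), of d])
     (simp add: traceless_def symbol_word_mult)

lemma traceless_leading_oneforms:
  assumes "w \<in> oneforms n zs y m" "y \<notin> zs" "n \<le> y" "even c" "c > 0" "frag_of (replicate (c - 1) y) * w \<in> traceless n d"
  shows "symbol n w = 0"
  using assms(4-6) word_op_power_odd[OF assms(3), of "c - 1"]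
  by (intro traceless_leading_zero[OF symbol_oneforms(2)[OF assms(1,3)] assms(2), of d])
     (simp add: traceless_def symbol_word_mult)



section \<open>Relations between the expansions\<close>

definition adjoint :: "nat \<Rightarrow> nat list \<Rightarrow> free_ring \<Rightarrow> free_ring" where
  "adjoint n u = linear_ext (bracket n u)"

lemma additive_adjoint: "additive (adjoint n u)"
  unfolding adjoint_def by (rule additive_linear_ext)

lemma adjoint_word [simp]: "adjoint n u (frag_of w) = bracket n u w"
  by (simp add: adjoint_def)

lemma adjoint_homogeneous:
  assumes "x \<in> homogeneous (mset w)"
  shows "adjoint n u x = frag_of u * x - (-1) ^ (odd_count n u * odd_count n w) * (x * frag_of u)"
  using assms unfolding homogeneous_def
proof (induction rule: zspan.induct)
  case (base x)
  then obtain v where v: "x = frag_of v" "mset v = mset w" by auto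
  have "odd_count n v = odd_count n w" unfolding odd_count_def
    by (metis mset_filter size_mset v(2))
  then show ?case by (simp add: v bracket_def frag_of_mult)
qed (simp_all add: additive.zero[OF additive_adjoint] additive.diff[OF additive_adjoint] algebra_simps)

lemma adjoint_M3: "x \<in> M3 n \<Longrightarrow> adjoint n u x \<in> M3 n"
proof -
  assume "x \<in> M3 n"
  then have "x \<in> zspan (triple_products n)" by (simp only: M3_def)
  then show ?thesis
  proof (rule zspan_image[OF _ additive_adjoint add_closed_M3])
    fix s assume s: "s \<in> triple_products n"
    then have m: "s \<in> M3 n" unfolding M3_def by (rule zspan.base)
    obtain w where "s \<in> homogeneous (mset w)" using s homogeneous_triple by blast
    from adjoint_homogeneous[OF this, of n u] show "adjoint n u s \<in> M3 n"
      using two_sidedD[OF two_sided_M3] m by (simp add: add_closedD add_closed_sign)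
  qed
qed

lemma adjoint_bracket: "adjoint n a (bracket n u v) = triple_bracket n a u v"
proof -
  have "bracket n u v \<in> homogeneous (mset (u @ v))" using homogeneous_bracket by simp
  from adjoint_homogeneous[OF this, of n a] show ?thesis by (simp add: triple_bracket_def)
qed

lemma adjoint_L2: "x \<in> L2 n \<Longrightarrow> adjoint n u x \<in> M3 n"
  unfolding L2_def
  by (erule zspan_image[OF _ additive_adjoint add_closed_M3]) (auto simp: adjoint_bracket triple_bracket_in_M3)

lemma adjoint_oneforms:
  assumes "f \<in> word_span zs m" shows "\<exists>w\<in>oneforms n zs y m. adjoint n [y] f - w \<in> M3 n"
proof -
  have "adjoint n [y] f \<in> mod_set (oneforms n zs y m) (M3 n)"
    using assms unfolding word_span_def
  proof (rule zspan_image[OF _ additive_adjoint add_closed_mod_set[OF add_closed_oneforms add_closed_M3]])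
    fix s assume "s \<in> frag_of ` words_of zs m"
    then obtain w where w: "s = frag_of w" "w \<in> words_of zs m" by auto
    then have "oneforms n zs y (count_list w) = oneforms n zs y m"
      by (intro oneforms_cong) (auto simp: words_of_def)
    then show "adjoint n [y] s \<in> mod_set (oneforms n zs y m) (M3 n)"
      using bracket_letter_in_oneforms[of w zs n y] w by (simp add: words_of_def)
  qed
  then show ?thesis by (simp add: mod_set_def)
qed

text \<open>The difference is the bracket of \<open>y\<close> with \<open>y\<^sup>c\<^sup>-\<^sup>1 f\<close>.\<close>

lemma double_power_relation:
  assumes "n \<le> y" "even c" "c > 0"
  shows "2 * (frag_of (replicate c y) * f) - frag_of (replicate (c - 1) y) * adjoint n [y] f \<in> L2 n"
proof (induction f rule: frag_induct)
  case (word w)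
  have y1: "odd_count n [y] = 1" using assms(1) by (simp add: odd_count_single)
  have oc: "odd_count n (replicate k y) = k" for k
    using assms(1) by (simp add: odd_count_def)
  have c: "replicate c y = y # replicate (c - 1) y" "replicate (c - 1) y @ [y] = replicate c y"
    using assms(3) by (cases c; simp add: replicate_append_same)+
  have "2 * (frag_of (replicate c y) * frag_of w) - frag_of (replicate (c - 1) y) * adjoint n [y] (frag_of w)
      = bracket n [y] (replicate (c - 1) y @ w)"
  proof -
    have "frag_of (replicate (c - 1) y) * adjoint n [y] (frag_of w)
       = frag_of (replicate c y @ w) - (-1) ^ odd_count n w * frag_of (replicate (c - 1) y @ w @ [y])"
    proof -
      have r: "replicate (c - Suc 0) y @ y # w = replicate c y @ w" using c(1) by (simp add: replicate_app_Cons_same)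
      show ?thesis unfolding adjoint_word bracket_def y1
        by (simp add: right_diff_distrib frag_of_mult sign_left_comm r)
    qed
    moreover have "bracket n [y] (replicate (c - 1) y @ w)
       = frag_of (replicate c y @ w) + (-1) ^ odd_count n w * frag_of (replicate (c - 1) y @ w @ [y])"
    proof -
      obtain k where k: "c = Suc k" "odd k" using assms(2,3) by (cases c) auto
      have "(-1::free_ring) ^ (odd_count n [y] * odd_count n (replicate (c - 1) y @ w)) = - ((-1) ^ odd_count n w)"
        using k by (simp add: y1 oc power_add)
      then show ?thesis unfolding bracket_def c(1) by simp
    qed
    ultimately show ?thesis by (simp add: frag_of_mult mult_2)
  qed
  then show ?case using bracket_in_L2 by simp
next
  case (diff x y)
  from add_closedD(2)[OF add_closed_L2 this] show ?case
    by (simp add: additive.diff[OF additive_adjoint] algebra_simps)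
qed (simp add: additive.zero[OF additive_adjoint] add_closedD(1)[OF add_closed_L2])

lemma odd_square_central: "n \<le> y \<Longrightarrow> frag_of [y, y, a] - frag_of [a, y, y] \<in> M3 n"
proof -
  assume "n \<le> y"
  then have "triple_bracket n [y] [y] [a] = frag_of [y, y, a] - frag_of [a, y, y]"
    by (simp add: triple_bracket_def bracket_def odd_count_single algebra_simps frag_of_mult)
  then show ?thesis using triple_bracket_in_M3[of n "[y]" "[y]" "[a]"] by simp
qed

text \<open>For an even letter \<open>[z, [z, a]] = z\<^sup>2 a - 2 z a z + a z\<^sup>2\<close>, and \<open>-1 = 1\<close> modulo two.\<close>

lemma square_central_mod2: "frag_of [z, z, a] - frag_of [a, z, z] \<in> M3_mod2 n"
proof (cases "n \<le> z")
  case True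
  then show ?thesis using odd_square_central M3_subset_mod2 by blast
next
  case False
  then have "frag_of [z, z, a] - frag_of [a, z, z] = triple_bracket n [z] [z] [a] + 2 * (frag_of [z, a, z] - frag_of [a, z, z])"
    by (simp add: triple_bracket_def bracket_def odd_count_single algebra_simps frag_of_mult mult_2)
  moreover have "triple_bracket n [z] [z] [a] \<in> M3_mod2 n" using triple_bracket_in_M3 M3_subset_mod2 by blast
  ultimately show ?thesis
    using add_closedD(4)[OF two_sidedD(1)[OF two_sided_M3_mod2] _ double_in_M3_mod2] by (simp only:)
qed

lemma even_power_central:
  assumes I: "two_sided I" and sq: "\<And>a. frag_of [z, z, a] - frag_of [a, z, z] \<in> I" and "even c"
  shows "frag_of (replicate c z @ w) - frag_of (w @ replicate c z) \<in> I"
proof -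
  note ts = two_sidedD[OF I] and cl = add_closedD[OF two_sidedD(1)[OF I]]
  have 1: "frag_of (replicate c z @ [a]) - frag_of (a # replicate c z) \<in> I" for a
    using \<open>even c\<close>
  proof (induction c rule: nat_less_induct)
    case (1 c)
    show ?case
    proof (cases "c = 0")
      case True then show ?thesis by (simp add: cl)
    next
      case False
      have "c = Suc (Suc (c - 2))" using False 1(2) by presburger
      then obtain k where k: "c = Suc (Suc k)" "even k" using 1(2) by (metis even_Suc)
      then have "frag_of (replicate k z @ [a]) - frag_of (a # replicate k z) \<in> I" using 1(1) by simp
      from ts(2)[OF this, of "frag_of [z, z]"] ts(3)[OF sq[of a], of "frag_of (replicate k z)"]
      have "frag_of [z, z] * (frag_of (replicate k z @ [a]) - frag_of (a # replicate k z))
        + (frag_of [z, z, a] - frag_of [a, z, z]) * frag_of (replicate k z) \<in> I" by (rule cl(4))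
      then show ?thesis by (simp add: k(1) algebra_simps frag_of_mult)
    qed
  qed
  show ?thesis
  proof (induction w)
    case (Cons a w)
    have "(frag_of (replicate c z @ [a]) - frag_of (a # replicate c z)) * frag_of w
      + frag_of [a] * (frag_of (replicate c z @ w) - frag_of (w @ replicate c z)) \<in> I"
      using 1 Cons by (intro cl(4) ts)
    then show ?case by (simp add: algebra_simps frag_of_mult)
  qed (simp add: cl)
qed

text \<open>In \<open>z\<^sup>c\<^sup>-\<^sup>1 [z, a] g\<close> the even power \<open>z\<^sup>c\<^sup>-\<^sup>1\<close> is central, so the second term of the bracket becomes \<open>a z\<^sup>c g\<close>,
which is \<open>\<plusminus> z\<^sup>c g a\<close> modulo \<open>L\<^sub>2\<close>.\<close>

lemma rotate_oneforms:
  assumes I: "two_sided I" and sq: "\<And>a. frag_of [z, z, a] - frag_of [a, z, z] \<in> I" and c: "odd c"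
    and w: "w \<in> oneforms n zs z m"
  shows "\<exists>f\<in>word_span zs m. frag_of (replicate (c - 1) z) * w - frag_of (replicate c z) * f \<in> mod_set (L2 n) I"
proof -
  note ts = two_sidedD[OF I] and cl = add_closedD[OF two_sidedD(1)[OF I]]
  let ?H = "(\<lambda>f. frag_of (replicate c z) * f) ` word_span zs m"
  let ?R = "mod_set (L2 n) I"
  have R: "add_closed ?R" by (intro add_closed_mod_set add_closed_L2 ts)
  have H: "add_closed ?H" unfolding add_closed_def
  proof (intro conjI ballI)
    show "0 \<in> ?H" by (rule image_eqI[of _ _ 0]) (simp_all add: add_closedD(1)[OF add_closed_word_span])
    fix x y assume "x \<in> ?H" "y \<in> ?H"
    then obtain f g where "f \<in> word_span zs m" "g \<in> word_span zs m" "x = frag_of (replicate c z) * f" "y = frag_of (replicate c z) * g" by auto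
    then show "x - y \<in> ?H"
      by (intro image_eqI[of _ _ "f - g"]) (simp_all add: algebra_simps add_closedD(2)[OF add_closed_word_span])
  qed
  have "frag_of (replicate (c - 1) z) * w \<in> mod_set ?H ?R"
    using w unfolding oneforms_def
  proof (rule zspan_image[OF _ additive_left add_closed_mod_set[OF H R]])
    fix s assume "s \<in> oneform_words n zs z m"
    then obtain a g where s: "s = bracket n [z] [a] * frag_of g" and ag: "a # g \<in> words_of zs m" by auto
    have ga: "g @ [a] \<in> words_of zs m" using ag words_of_mset[of "g @ [a]" "a # g" zs m] by simp
    define k1 where "k1 = odd_count n [z] * odd_count n [a]"
    define k2 where "k2 = odd_count n [a] * odd_count n (replicate c z @ g)"
    define f where "f = frag_of (a # g) - (-1) ^ k1 * ((-1) ^ k2 * frag_of (g @ [a]))"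
    have f: "f \<in> word_span zs m" unfolding f_def
      using ag ga by (intro add_closedD(2)[OF add_closed_word_span] add_closed_sign[OF add_closed_word_span] word_span_base)
    have cz: "replicate (c - 1) z @ [z] = replicate c z" "z # replicate (c - 1) z = replicate c z"
      using c by (cases c; simp add: replicate_append_same)+
    have r: "replicate (c - Suc 0) z @ z # h = replicate c z @ h" for h
      using cz(2)[symmetric] by (simp add: replicate_app_Cons_same)
    have e: "frag_of (replicate (c - 1) z) * s
        = frag_of (replicate c z @ a # g) - (-1) ^ k1 * frag_of (replicate (c - 1) z @ a # z # g)"
      by (simp add: s bracket_def k1_def left_diff_distrib right_diff_distrib sign_left_comm frag_of_mult mult.assoc r)
    have com: "frag_of (replicate (c - 1) z @ [a]) - frag_of ([a] @ replicate (c - 1) z) \<in> I"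
      using c by (intro even_power_central[OF I sq]) simp
    have "frag_of (replicate (c - 1) z @ a # z # g) - frag_of (a # replicate c z @ g) \<in> I"
      using ts(3)[OF com, of "frag_of (z # g)"] by (simp add: left_diff_distrib frag_of_mult r)
    then have I1: "frag_of (replicate (c - 1) z @ a # z # g) - frag_of (a # replicate c z @ g) \<in> ?R"
      by (rule mod_set_right[OF add_closed_L2])
    have "bracket n [a] (replicate c z @ g) \<in> ?R" by (rule mod_set_left[OF ts(1) bracket_in_L2])
    then have I2: "frag_of (a # replicate c z @ g) - (-1) ^ k2 * frag_of (replicate c z @ g @ [a]) \<in> ?R"
      by (simp add: bracket_def k2_def)
    have zf: "frag_of (replicate c z) * f
       = frag_of (replicate c z @ a # g) - (-1) ^ k1 * ((-1) ^ k2 * frag_of (replicate c z @ g @ [a]))"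
      unfolding f_def
      by (cases "even k1"; cases "even k2") (simp_all add: right_diff_distrib distrib_left frag_of_mult)
    have "frag_of (replicate (c - 1) z) * s - frag_of (replicate c z) * f
       = - ((-1) ^ k1 * ((frag_of (replicate (c - 1) z @ a # z # g) - frag_of (a # replicate c z @ g))
          + (frag_of (a # replicate c z @ g) - (-1) ^ k2 * frag_of (replicate c z @ g @ [a]))))"
      unfolding e zf by (simp add: right_diff_distrib)
    then have "frag_of (replicate (c - 1) z) * s - frag_of (replicate c z) * f \<in> ?R"
      using I1 I2 by (simp only: add_closedD(3,4)[OF R] add_closed_sign[OF R])
    then show "frag_of (replicate (c - 1) z) * s \<in> mod_set ?H ?R" using f by (auto simp: mod_set_def)
  qed
  then show ?thesis by (auto simp: mod_set_def)
qed

text \<open>Multiplication by an even power of \<open>y\<close> preserves the relations: this power is central modulo \<open>M\<^sub>3\<close> and does not change parities, so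
it can be absorbed into one argument of a bracket.\<close>

lemma even_power_L2:
  assumes "n \<le> y" "even c" "l \<in> L2 n" shows "frag_of (replicate c y) * l \<in> relations n"
  using assms(3) unfolding L2_def
proof (rule zspan_image[OF _ additive_left add_closed_relations])
  fix s assume "s \<in> {bracket n u v |u v. True}"
  then obtain u v where s: "s = bracket n u v" by auto
  have oc: "odd_count n (replicate c y @ u) = c + odd_count n u" using assms(1) by (simp add: odd_count_def)
  define k where "k = odd_count n u * odd_count n v"
  have k: "(-1::free_ring) ^ (odd_count n (replicate c y @ u) * odd_count n v) = (-1) ^ k"
    unfolding oc k_def using assms(2) by (simp add: minus_one_power_iff)
  have "frag_of (replicate c y) * s = bracket n (replicate c y @ u) v
     - (-1) ^ k * ((frag_of (replicate c y @ v) - frag_of (v @ replicate c y)) * frag_of u)"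
    unfolding s bracket_def k k_def[symmetric]
    by (simp add: left_diff_distrib right_diff_distrib sign_left_comm frag_of_mult)
  moreover have "(frag_of (replicate c y @ v) - frag_of (v @ replicate c y)) * frag_of u \<in> M3 n"
    by (intro two_sidedD(3)[OF two_sided_M3] even_power_central[OF two_sided_M3 odd_square_central[OF assms(1)] assms(2)])
  moreover have "bracket n (replicate c y @ u) v \<in> relations n" using bracket_in_L2 L2_subset_relations by blast
  ultimately show "frag_of (replicate c y) * s \<in> relations n"
    using M3_subset_relations by (auto intro!: add_closedD(2)[OF add_closed_relations] add_closed_sign[OF add_closed_relations])
qed

section \<open>Torsion in the presence of an odd exponent\<close>

lemma word_span_power:
  assumes "x \<in> word_span zs m" "z \<in> zs"
  shows "frag_of (replicate k z) * x \<in> word_span zs (m(z := k + m z))"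
  using assms(1) unfolding word_span_def
proof (rule zspan_image[OF _ additive_left add_closed_zspan])
  fix s assume "s \<in> frag_of ` words_of zs m"
  then obtain w where w: "s = frag_of w" "w \<in> words_of zs m" by auto
  have "count_list (replicate k z) i = (if i = z then k else 0)" for i by (induction k) auto
  then have "replicate k z @ w \<in> words_of zs (m(z := k + m z))" using w(2) assms(2) by (auto simp: words_of_def)
  then show "frag_of (replicate k z) * s \<in> zspan (frag_of ` words_of zs (m(z := k + m z)))"
    by (simp add: w(1) frag_of_mult zspan.base)
qed

lemma word_span_insert_zero:
  assumes "x \<in> word_span zs m" "z \<notin> zs" shows "x \<in> word_span (insert z zs) (m(z := 0))"
  using assms(1) unfolding word_span_def
proof (rule zspan_least[OF _ add_closed_zspan])
  show "frag_of ` words_of zs m \<subseteq> zspan (frag_of ` words_of (insert z zs) (m(z := 0)))"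
  proof (rule image_subsetI)
    fix w assume w: "w \<in> words_of zs m"
    then have "z \<notin> set w" using assms(2) by (auto simp: words_of_def)
    then have "count_list w z = 0" by (simp add: count_list_0_iff)
    then have "w \<in> words_of (insert z zs) (m(z := 0))" using w by (auto simp: words_of_def)
    then show "frag_of w \<in> zspan (frag_of ` words_of (insert z zs) (m(z := 0)))" by (intro zspan.base imageI)
  qed
qed

lemma word_span_power_insert:
  assumes "x \<in> word_span zs m" "z \<notin> zs"
  shows "frag_of (replicate (m z) z) * x \<in> word_span (insert z zs) m"
  using word_span_power[OF word_span_insert_zero[OF assms], of z "m z"] by simp

lemma oneforms_power_insert:
  assumes "w \<in> oneforms n zs z m" "z \<notin> zs" "m z > 0"
  shows "frag_of (replicate (m z - 1) z) * w \<in> word_span (insert z zs) m"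
  using word_span_power[OF word_span_insert_one[OF assms(2,1)], of z "m z - 1"] assms(3) by simp

text \<open>Modulo the relations \<open>x = y\<^sup>c f\<close>; since the trace of \<open>y\<^sup>c f\<close> vanishes, so does the symbol of \<open>f\<close>.\<close>

lemma odd_exponent_no_torsion:
  assumes fin: "finite zs" and y: "y \<notin> zs" "n \<le> y" and pos: "\<And>i. i \<in> insert y zs \<Longrightarrow> m i > 0" and odd: "odd (m y)"
    and x: "x \<in> word_span (insert y zs) m" and tr: "x \<in> traceless n (odd_degree n (insert y zs) m)"
  shows "x \<in> relations n"
proof -
  let ?c = "m y" and ?d = "odd_degree n (insert y zs) m"
  note R = add_closedD[OF add_closed_relations[of n]]
  have my: "?c > 0" using pos by simp
  obtain f w where f: "f \<in> word_span zs m" and w: "w \<in> oneforms n zs y m"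
    and d: "x - (frag_of (replicate ?c y) * f + frag_of (replicate (?c - 1) y) * w) \<in> M3 n"
    using word_span_in_expansions[OF y(1) x my, of n] by (auto simp: expansions_def mod_set_def)
  obtain g where g: "g \<in> word_span zs m" and r: "frag_of (replicate (?c - 1) y) * w - frag_of (replicate ?c y) * g \<in> relations n"
    using rotate_oneforms[OF two_sided_M3 odd_square_central[OF y(2)] odd w] by (auto simp: relations_def)
  have fg: "f + g \<in> word_span zs m" by (rule add_closedD(4)[OF add_closed_word_span f g])
  have D: "x - frag_of (replicate ?c y) * (f + g) \<in> relations n"
  proof -
    have "(x - (frag_of (replicate ?c y) * f + frag_of (replicate (?c - 1) y) * w))
        + (frag_of (replicate (?c - 1) y) * w - frag_of (replicate ?c y) * g) \<in> relations n"
      using d M3_subset_relations by (intro R(4) r) auto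
    then show ?thesis by (simp add: algebra_simps)
  qed
  have P: "frag_of (replicate ?c y) * (f + g) \<in> word_span (insert y zs) m" by (rule word_span_power_insert[OF fg y(1)])
  have "x - frag_of (replicate ?c y) * (f + g) \<in> traceless n ?d"
    using fin by (intro relations_traceless[OF _ D] add_closedD(2)[OF add_closed_word_span x P]) auto
  from add_closedD(2)[OF add_closed_traceless tr this]
  have "frag_of (replicate ?c y) * (f + g) \<in> traceless n ?d" by simp
  from traceless_leading_word_span[OF fg y odd this] have "f + g \<in> M3 n"
    using symbol_faithful(1)[OF fin _ fg] pos by simp
  then have "frag_of (replicate ?c y) * (f + g) \<in> relations n"
    using two_sidedD(2)[OF two_sided_M3] M3_subset_relations by blast
  from R(4)[OF D this] show ?thesis by simp
qed

text \<open>Write \<open>f = l + 2 h\<close> with \<open>l\<close> in \<open>L\<^sub>2\<close>. Then \<open>y\<^sup>c l\<close> is a relation and \<open>2 y\<^sup>c h\<close> is \<open>y\<^sup>c\<^sup>-\<^sup>1 [y, h]\<close>, so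
\<open>x\<close> becomes \<open>y\<^sup>c\<^sup>-\<^sup>1\<close> times a one-form, on which the trace is injective.\<close>

lemma even_exponent_criterion:
  assumes fin: "finite zs" and y: "y \<notin> zs" "n \<le> y" and pos: "\<And>i. i \<in> insert y zs \<Longrightarrow> m i > 0" and even: "even (m y)"
    and x: "x \<in> word_span (insert y zs) m" and tr: "x \<in> traceless n (odd_degree n (insert y zs) m)"
    and f: "f \<in> word_span zs m" and w: "w \<in> oneforms n zs y m"
    and d: "x - (frag_of (replicate (m y) y) * f + frag_of (replicate (m y - 1) y) * w) \<in> M3 n"
    and fI: "f \<in> mod_set (L2 n) (M3_mod2 n)"
  shows "x \<in> relations n"
proof -
  let ?c = "m y" and ?d = "odd_degree n (insert y zs) m"
  let ?Y = "frag_of (replicate ?c y)" and ?Y' = "frag_of (replicate (?c - 1) y)"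
  note R = add_closedD[OF add_closed_relations[of n]]
  have my: "?c > 0" using pos by simp
  obtain l h where l: "l \<in> L2 n" and h: "f - l - 2 * h \<in> M3 n" using fI by (auto simp: mod_set_def M3_mod2_def)
  \<comment> \<open>The decomposition of \<open>f\<close> need not be multihomogeneous; its component is.\<close>
  let ?h = "component zs m h" and ?l = "component zs m l"
  have hp: "?h \<in> word_span zs m" by (rule component_in_word_span)
  have "component zs m (f - l - 2 * h) = f - ?l - 2 * ?h"
    using component_word_span[OF f] additive.add[OF additive_component] by (simp add: additive.diff[OF additive_component] mult_2)
  then have fh: "f - ?l - 2 * ?h \<in> M3 n" using component_M3[OF h, of zs m] by simp
  obtain v where v: "v \<in> oneforms n zs y m" "adjoint n [y] ?h - v \<in> M3 n" using adjoint_oneforms[OF hp, of n y] by auto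
  have vw: "v + w \<in> oneforms n zs y m" by (rule add_closedD(4)[OF add_closed_oneforms v(1) w])
  have D: "x - ?Y' * (v + w) \<in> relations n"
  proof -
    have 1: "x - (?Y * f + ?Y' * w) \<in> relations n" using d M3_subset_relations by auto
    have 2: "?Y * (f - ?l - 2 * ?h) \<in> relations n"
      using two_sidedD(2)[OF two_sided_M3 fh] M3_subset_relations by auto
    have 3: "?Y * ?l \<in> relations n" by (rule even_power_L2[OF y(2) even component_L2'[OF l]])
    have 4: "2 * (?Y * ?h) - ?Y' * adjoint n [y] ?h \<in> relations n"
      using double_power_relation[OF y(2) even my] L2_subset_relations by auto
    have 5: "?Y' * (adjoint n [y] ?h - v) \<in> relations n"
      using two_sidedD(2)[OF two_sided_M3 v(2)] M3_subset_relations by auto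
    have "(x - (?Y * f + ?Y' * w)) + ?Y * (f - ?l - 2 * ?h) + ?Y * ?l + (2 * (?Y * ?h) - ?Y' * adjoint n [y] ?h)
       + ?Y' * (adjoint n [y] ?h - v) \<in> relations n"
      by (rule R(4)[OF R(4)[OF R(4)[OF R(4)[OF 1 2] 3] 4] 5])
    then show ?thesis by (simp add: algebra_simps mult_2 mult_2_right)
  qed
  have P: "?Y' * (v + w) \<in> word_span (insert y zs) m" by (rule oneforms_power_insert[OF vw y(1) my])
  have "x - ?Y' * (v + w) \<in> traceless n ?d"
    using fin by (intro relations_traceless[OF _ D] add_closedD(2)[OF add_closed_word_span x P]) auto
  from add_closedD(2)[OF add_closed_traceless tr this]
  have "?Y' * (v + w) \<in> traceless n ?d" by simp
  from traceless_leading_oneforms[OF vw y even my this] have "v + w \<in> M3 n"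
    using symbol_faithful(2)[OF fin _ y(1) vw] pos by simp
  then have "?Y' * (v + w) \<in> relations n"
    using two_sidedD(2)[OF two_sided_M3] M3_subset_relations by blast
  from R(4)[OF D this] show ?thesis by simp
qed

lemma mod2_symbol_adjoint:
  assumes "x \<in> homogeneous (mset g)"
  shows "mod2_symbol (adjoint n [y] x) = nilp y * (degree_sum g * mod2_symbol x)"
  using assms unfolding homogeneous_def
proof (induction rule: zspan.induct)
  case (base x)
  then obtain u where u: "x = frag_of u" "mset u = mset g" by auto
  have "degree_sum u = degree_sum g"
    unfolding degree_sum_def by (metis mset_map sum_mset_sum_list u(2))
  have "mod2_symbol (adjoint n [y] x) = mod2_word (y # u) * (nilp y * degree_sum u)"
    using mod2_symbol_bracket[of "[]" n "[y]" u "[]"] by (simp add: u frag_of_Nil del: mod2_word.simps)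
  also have "\<dots> = degree_sum u * (nilp y * mod2_word (y # u))" by (simp only: ac_simps)
  also have "\<dots> = nilp y * (degree_sum u * mod2_word u)"
    unfolding nilp_mod2_word_Cons[of y] by (simp only: ac_simps)
  finally show ?case using \<open>degree_sum u = degree_sum g\<close> by (simp add: u)
qed (simp_all add: mod2_symbol_zero additive.zero[OF additive_adjoint] additive.diff[OF additive_adjoint]
    mod2_symbol_diff distrib_left)

lemma adjoint_mod2:
  assumes "x \<in> mod_set (L2 n) (M3_mod2 n)" shows "adjoint n [y] x \<in> M3_mod2 n"
proof -
  obtain l h where l: "l \<in> L2 n" and h: "x - l - 2 * h \<in> M3 n" using assms by (auto simp: mod_set_def M3_mod2_def)
  have "adjoint n [y] x = adjoint n [y] l + adjoint n [y] (x - l - 2 * h) + 2 * adjoint n [y] h"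
    by (simp add: additive.diff[OF additive_adjoint] additive.add[OF additive_adjoint] mult_2)
  moreover have "adjoint n [y] l \<in> M3_mod2 n" "adjoint n [y] (x - l - 2 * h) \<in> M3_mod2 n"
    using adjoint_L2[OF l] adjoint_M3[OF h] M3_subset_mod2 by auto
  ultimately show ?thesis
    using double_in_M3_mod2 by (simp only: add_closedD(4)[OF two_sidedD(1)[OF two_sided_M3_mod2]])
qed

lemma degree_sum_generated: "set w \<subseteq> zs \<Longrightarrow> degree_sum w \<in> generated_by zs"
  by (induction w) (auto intro: generated_by_closed)

text \<open>Exactness of the mod-two de Rham complex when a letter \<open>j\<close> has an odd exponent. Twice \<open>x\<close> is \<open>y\<^sup>c\<^sup>-\<^sup>1\<close> times the
one-form \<open>[y, f] + 2 w\<close>; as its trace vanishes, \<open>[y, f]\<close> is divisible by two. Rotating as in the case of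
an odd exponent of \<open>y\<close>, now modulo two, replaces \<open>f\<close> by \<open>j\<^sup>c F\<close> with \<open>F\<close> free of \<open>j\<close>. The symbol of \<open>[y, j\<^sup>c F]\<close> is
\<open>t\<^sub>y (t\<^sub>j + t\<^sub>F)\<close> times that of \<open>j\<^sup>c F\<close>, where \<open>t\<^sub>F\<close> is the sum of the \<open>m\<^sub>i t\<^sub>i\<close> over the letters of \<open>F\<close>. Since the
coefficient of \<open>t\<^sub>j\<close> is \<open>1\<close>, it can vanish only if the symbol of \<open>F\<close> does.\<close>

lemma even_exponent_no_torsion:
  assumes fin: "finite zs" and y: "y \<notin> zs" "n \<le> y" and pos: "\<And>i. i \<in> insert y zs \<Longrightarrow> m i > 0" and even: "even (m y)"
    and j: "j \<in> zs" "odd (m j)"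
    and x: "x \<in> word_span (insert y zs) m" and tr: "x \<in> traceless n (odd_degree n (insert y zs) m)"
  shows "x \<in> relations n"
proof -
  let ?c = "m y" and ?d = "odd_degree n (insert y zs) m"
  let ?Y = "frag_of (replicate ?c y)" and ?Y' = "frag_of (replicate (?c - 1) y)"
  note R = add_closedD[OF add_closed_relations[of n]]
  have my: "?c > 0" using pos by simp
  obtain f w where f: "f \<in> word_span zs m" and w: "w \<in> oneforms n zs y m"
    and d: "x - (?Y * f + ?Y' * w) \<in> M3 n"
    using word_span_in_expansions[OF y(1) x my, of n] by (auto simp: expansions_def mod_set_def)
  obtain v where v: "v \<in> oneforms n zs y m" "adjoint n [y] f - v \<in> M3 n" using adjoint_oneforms[OF f, of n y] by auto
  have vw: "v + (w + w) \<in> oneforms n zs y m" by (intro add_closedD(4)[OF add_closed_oneforms] v(1) w)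
  have D: "(x + x) - ?Y' * (v + (w + w)) \<in> relations n"
  proof -
    have 1: "x - (?Y * f + ?Y' * w) \<in> relations n" using d M3_subset_relations by auto
    have 2: "2 * (?Y * f) - ?Y' * adjoint n [y] f \<in> relations n"
      using double_power_relation[OF y(2) even my] L2_subset_relations by auto
    have 3: "?Y' * (adjoint n [y] f - v) \<in> relations n"
      using two_sidedD(2)[OF two_sided_M3 v(2)] M3_subset_relations by auto
    have "(x - (?Y * f + ?Y' * w)) + (x - (?Y * f + ?Y' * w)) + (2 * (?Y * f) - ?Y' * adjoint n [y] f)
       + ?Y' * (adjoint n [y] f - v) \<in> relations n"
      by (rule R(4)[OF R(4)[OF R(4)[OF 1 1] 2] 3])
    then show ?thesis by (simp add: algebra_simps mult_2)
  qed
  have P: "?Y' * (v + (w + w)) \<in> word_span (insert y zs) m" by (rule oneforms_power_insert[OF vw y(1) my])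
  have "(x + x) - ?Y' * (v + (w + w)) \<in> traceless n ?d"
    using fin by (intro relations_traceless[OF _ D] add_closedD(2)[OF add_closed_word_span _ P] add_closedD(4)[OF add_closed_word_span x x]) auto
  from add_closedD(2)[OF add_closed_traceless add_closedD(4)[OF add_closed_traceless tr tr] this]
  have "?Y' * (v + (w + w)) \<in> traceless n ?d" by simp
  from traceless_leading_oneforms[OF vw y even my this] have vM: "v + (w + w) \<in> M3 n"
    using symbol_faithful(2)[OF fin _ y(1) vw] pos by simp
  have "adjoint n [y] f - 2 * (- w) = (adjoint n [y] f - v) + (v + (w + w))" by (simp add: mult_2)
  then have "adjoint n [y] f - 2 * (- w) \<in> M3 n" using add_closedD(4)[OF add_closed_M3 v(2) vM] by (simp only:)
  then have af: "adjoint n [y] f \<in> M3_mod2 n" unfolding M3_mod2_def by blast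
  define zs0 where "zs0 = zs - {j}"
  have zs: "zs = insert j zs0" "j \<notin> zs0" "finite zs0" using j fin by (auto simp: zs0_def)
  let ?J = "frag_of (replicate (m j) j)" and ?J' = "frag_of (replicate (m j - 1) j)"
  have mj: "m j > 0" using j pos by simp
  obtain f0 w0 where f0: "f0 \<in> word_span zs0 m" and w0: "w0 \<in> oneforms n zs0 j m" and d0: "f - (?J * f0 + ?J' * w0) \<in> M3 n"
    using word_span_in_expansions[OF zs(2) f[unfolded zs(1)] mj, of n] by (auto simp: expansions_def mod_set_def)
  let ?T = "mod_set (L2 n) (M3_mod2 n)"
  have T: "add_closed ?T" by (intro add_closed_mod_set add_closed_L2 two_sidedD[OF two_sided_M3_mod2])
  have MT: "M3_mod2 n \<subseteq> ?T" by (auto intro: mod_set_right add_closed_L2)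
  obtain g where g: "g \<in> word_span zs0 m" and r: "?J' * w0 - ?J * g \<in> ?T"
    using rotate_oneforms[OF two_sided_M3_mod2 square_central_mod2 j(2) w0] by auto
  define F where "F = f0 + g"
  have F: "F \<in> word_span zs0 m" unfolding F_def by (rule add_closedD(4)[OF add_closed_word_span f0 g])
  have DF: "f - ?J * F \<in> ?T"
  proof -
    have "(f - (?J * f0 + ?J' * w0)) + (?J' * w0 - ?J * g) \<in> ?T"
      using d0 M3_subset_mod2 MT by (intro add_closedD(4)[OF T _ r]) auto
    then show ?thesis by (simp add: F_def algebra_simps)
  qed
  have "adjoint n [y] (?J * F) \<in> M3_mod2 n"
    using add_closedD(2)[OF two_sidedD(1)[OF two_sided_M3_mod2] af adjoint_mod2[OF DF, of y]]
    by (simp add: additive.diff[OF additive_adjoint])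
  then have z: "mod2_symbol (adjoint n [y] (?J * F)) = 0" by (rule mod2_symbol_M3_mod2)
  obtain M where M: "set_mset M \<subseteq> zs0" "F \<in> homogeneous M" using word_span_homogeneous[OF F] by auto
  obtain u where u: "mset u = M" using ex_mset by blast
  have JF: "?J * F \<in> homogeneous (mset (replicate (m j) j @ u))"
    using homogeneous_mult[OF M(2), of "replicate (m j) j" "[]"] u by (simp add: frag_of_Nil)
  obtain \<tau> where \<tau>: "\<tau> \<in> generated_by (set_mset M)" "mod2_symbol (?J * F) = (1 + nilp j * \<tau>) * mod2_symbol F"
    using mod2_symbol_power(1)[OF M(2), of "m j" j] by auto
  have \<tau>z: "\<tau> \<in> generated_by zs0" by (rule generated_by_mono[OF M(1) \<tau>(1)])
  have D0: "degree_sum u \<in> generated_by zs0" using u M(1) by (intro degree_sum_generated) auto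
  have \<mu>: "mod2_symbol F \<in> generated_by zs0" by (rule mod2_symbol_word_span[OF F])
  have dJ: "degree_sum (replicate (m j) j @ u) = nilp j + degree_sum u"
  proof -
    have "degree_sum (replicate k j) = (if even k then 0 else nilp j)" for k by (induction k) auto
    then show ?thesis using j(2) by simp
  qed
  have "nilp y * ((nilp j + degree_sum u) * ((1 + nilp j * \<tau>) * mod2_symbol F)) = 0"
    using z unfolding mod2_symbol_adjoint[OF JF] dJ \<tau>(2) .
  moreover have "(nilp j + degree_sum u) * ((1 + nilp j * \<tau>) * mod2_symbol F) \<in> generated_by zs"
    using generated_by_mono[of zs0 zs] zs(1) \<tau>z D0 \<mu> by (intro generated_by_closed) auto
  ultimately have "(nilp j + degree_sum u) * ((1 + nilp j * \<tau>) * mod2_symbol F) = 0"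
    using nilp_eq_0 y(1) by blast
  then have e: "degree_sum u * mod2_symbol F + nilp j * ((1 + degree_sum u * \<tau>) * mod2_symbol F) = 0"
    by (simp add: algebra_simps)
  have "degree_sum u * mod2_symbol F \<in> generated_by zs0" "(1 + degree_sum u * \<tau>) * mod2_symbol F \<in> generated_by zs0"
    using \<tau>z D0 \<mu> by (auto intro!: generated_by_closed)
  from nilp_split[OF this zs(2) e] have e1: "degree_sum u * mod2_symbol F = 0"
    and e2: "(1 + degree_sum u * \<tau>) * mod2_symbol F = 0" .
  \<comment> \<open>The two components of the equation have been separated; a combination of them is the symbol of \<open>F\<close>.\<close>
  have "mod2_symbol F = (1 + degree_sum u * \<tau>) * mod2_symbol F + \<tau> * (degree_sum u * mod2_symbol F)"
    by (simp add: algebra_simps)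
  then have "mod2_symbol F = 0" using e1 e2 by simp
  then have "F \<in> M3_mod2 n" using mod2_symbol_faithful(1)[OF zs(3) _ F] pos zs(1) by simp
  then have "?J * F \<in> ?T" using two_sidedD(2)[OF two_sided_M3_mod2] MT by blast
  then have fT: "f \<in> ?T" using add_closedD(4)[OF T DF] by fastforce
  show ?thesis by (rule even_exponent_criterion[OF fin y pos even x tr f w d fT])
qed



section \<open>A basis of the torsion for even exponents\<close>

text \<open>Recursion on the letters, parallel to the expansions: a set that contains \<open>z\<close> comes from a one-form
with auxiliary letter \<open>z\<close>. Even exponents ensure that \<open>z\<^sup>c\<close> has no effect on the symbol.\<close>

lemma monomial_realization:
  assumes "finite zs" and "\<And>i. i \<in> zs \<Longrightarrow> even (m i) \<and> m i > 0"
  shows "(\<forall>S\<subseteq>zs. even (card S) \<longrightarrow> (\<exists>f\<in>word_span zs m. mod2_symbol f = prod nilp S)) \<and>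
     (\<forall>v. v \<notin> zs \<longrightarrow> (\<forall>S\<subseteq>zs. odd (card S) \<longrightarrow>
        (\<exists>w\<in>word_span (insert v zs) (m(v := 1)). mod2_symbol w = nilp v * prod nilp S)))"
  using assms
proof (induction zs rule: finite_induct)
  case empty
  have "[] \<in> words_of {} m" by (simp add: words_of_def)
  from word_span_base[OF this] have "\<exists>f\<in>word_span {} m. mod2_symbol f = 1"
    by (intro bexI[of _ "frag_of []"]) auto
  then show ?case by auto
next
  case (insert z zs)
  have mz: "even (m z)" "m z > 0" using insert.prems by auto
  note z = \<open>z \<notin> zs\<close>
  have IH1: "\<exists>f\<in>word_span zs m. mod2_symbol f = prod nilp S" if "S \<subseteq> zs" "even (card S)" for S
    using insert.IH insert.prems that by auto
  have IH2: "\<exists>w\<in>word_span (insert v zs) (m(v := 1)). mod2_symbol w = nilp v * prod nilp S"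
    if "v \<notin> zs" "S \<subseteq> zs" "odd (card S)" for v S
    using insert.IH insert.prems that by blast
  have split: "S - {z} \<subseteq> zs \<and> card S = Suc (card (S - {z})) \<and> prod nilp S = nilp z * prod nilp (S - {z})"
    if "S \<subseteq> insert z zs" "z \<in> S" for S
  proof -
    have fin: "finite S" using that(1) insert.hyps(1) finite_subset by blast
    have "card S = Suc (card (S - {z}))" using card_Suc_Diff1[OF fin that(2)] by simp
    then show ?thesis using prod.remove[OF fin that(2), of nilp] that by auto
  qed
  have pow: "mod2_symbol (frag_of (replicate (m z) z) * f) = mod2_symbol f" if f: "f \<in> word_span zs' m'" for f zs' m'
  proof -
    obtain M where "f \<in> homogeneous M" using word_span_homogeneous[OF f] by auto
    then show ?thesis using mz(1) by (rule mod2_symbol_power(2))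
  qed
  show ?case
  proof (intro conjI allI impI)
    fix S assume S: "S \<subseteq> insert z zs" "even (card S)"
    show "\<exists>f\<in>word_span (insert z zs) m. mod2_symbol f = prod nilp S"
    proof (cases "z \<in> S")
      case False
      then have "S \<subseteq> zs" using S by auto
      then obtain f where f: "f \<in> word_span zs m" "mod2_symbol f = prod nilp S" using IH1 S(2) by auto
      then show ?thesis using pow[OF f(1)] word_span_power_insert[OF f(1) z] by auto
    next
      case True
      note s = split[OF S(1) True]
      then have "odd (card (S - {z}))" using S(2) by simp
      then obtain w where w: "w \<in> word_span (insert z zs) (m(z := 1))" "mod2_symbol w = nilp z * prod nilp (S - {z})"
        using IH2[OF z] s by blast
      obtain M where M: "w \<in> homogeneous M" using word_span_homogeneous[OF w(1)] by auto
      obtain \<tau> where "mod2_symbol (frag_of (replicate (m z - 1) z) * w) = (1 + nilp z * \<tau>) * mod2_symbol w"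
        using mod2_symbol_power(1)[OF M] by blast
      then have "mod2_symbol (frag_of (replicate (m z - 1) z) * w) = prod nilp S"
        using s w(2) by (simp add: algebra_simps)
      moreover have "frag_of (replicate (m z - 1) z) * w \<in> word_span (insert z zs) m"
        using word_span_power[OF w(1), of z "m z - 1"] mz(2) by simp
      ultimately show ?thesis by blast
    qed
  next
    fix v S assume v: "v \<notin> insert z zs" and S: "S \<subseteq> insert z zs" "odd (card S)"
    then have v': "v \<notin> zs" "v \<noteq> z" by auto
    show "\<exists>w\<in>word_span (insert v (insert z zs)) (m(v := 1)). mod2_symbol w = nilp v * prod nilp S"
    proof (cases "z \<in> S")
      case False
      then have "S \<subseteq> zs" using S by auto
      then obtain w where w: "w \<in> word_span (insert v zs) (m(v := 1))" "mod2_symbol w = nilp v * prod nilp S"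
        using IH2[OF v'(1)] S(2) by auto
      have "frag_of (replicate (m z) z) * w \<in> word_span (insert v (insert z zs)) (m(v := 1))"
        using word_span_power_insert[OF w(1), of z] z v'(2) by (simp add: insert_commute)
      then show ?thesis using pow[OF w(1)] w(2) by auto
    next
      case True
      note s = split[OF S(1) True]
      then have "even (card (S - {z}))" using S(2) by simp
      then obtain f where f: "f \<in> word_span zs m" "mod2_symbol f = prod nilp (S - {z})" using IH1 s by blast
      have "mod2_symbol (frag_of (replicate (m z - 1) z) * bracket n [v] [z] * f) = nilp v * prod nilp S" for n
        unfolding mod2_symbol_power_bracket_word_span[OF f(1)] using f(2) s by simp
      moreover have "frag_of (replicate (m z - 1) z) * bracket n [v] [z] * f \<in> word_span (insert v (insert z zs)) (m(v := 1))" for n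
        using f(1) unfolding word_span_def[of zs]
      proof (rule zspan_image[OF _ additive_left add_closed_word_span])
        fix t assume "t \<in> frag_of ` words_of zs m"
        then obtain g where g: "t = frag_of g" "g \<in> words_of zs m" by auto
        have c: "count_list (replicate k z) i = (if i = z then k else 0)" for k i by (induction k) auto
        have "replicate (m z - 1) z @ v # z # g \<in> words_of (insert v (insert z zs)) (m(v := 1))"
          "replicate (m z - 1) z @ z # v # g \<in> words_of (insert v (insert z zs)) (m(v := 1))"
          using g(2) z v' mz(2) by (auto simp: words_of_def c count_list_0_iff)
        moreover have "frag_of (replicate (m z - 1) z) * bracket n [v] [z] * t
          = frag_of (replicate (m z - 1) z @ v # z # g)
            - (-1) ^ (odd_count n [v] * odd_count n [z]) * frag_of (replicate (m z - 1) z @ z # v # g)"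
          by (simp add: g(1) bracket_def left_diff_distrib right_diff_distrib sign_left_comm frag_of_mult mult.assoc)
        ultimately show "frag_of (replicate (m z - 1) z) * bracket n [v] [z] * t \<in> word_span (insert v (insert z zs)) (m(v := 1))"
          by (simp only: add_closedD(2)[OF add_closed_word_span] add_closed_sign[OF add_closed_word_span] word_span_base)
      qed
      ultimately show ?thesis by blast
    qed
  qed
qed

lemma even_monomials_span:
  assumes "finite zs" "f \<in> word_span zs m"
  shows "\<exists>c :: nat set \<Rightarrow> int. mod2_symbol f = (\<Sum>S | S \<subseteq> zs \<and> even (card S). of_int (c S) * prod nilp S)"
proof -
  let ?E = "{S. S \<subseteq> zs \<and> even (card S)}"
  let ?H = "zspan (prod nilp ` ?E)"
  have fin: "finite ?E" using assms(1) by simp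
  note H = add_closedD[OF add_closed_zspan[of "prod nilp ` ?E"]]
  have step: "nilp a * (nilp b * x) \<in> ?H" if "x \<in> ?H" and ab: "a \<in> zs" "b \<in> zs" for a b x
    using that(1)
  proof induction
    case (base x)
    then obtain S where S: "S \<subseteq> zs" "even (card S)" "x = prod nilp S" by auto
    have fS: "finite S" using S(1) assms(1) finite_subset by blast
    show ?case
    proof (cases "a = b \<or> a \<in> S \<or> b \<in> S")
      case True
      have "nilp i * prod nilp S = 0" if "i \<in> S" for i
        using prod.remove[OF fS that, of nilp] by simp
      then have "nilp a * (nilp b * x) = 0" using True S(3) nilp_square_left
        by (metis mult.left_commute mult_zero_right)
      then show ?thesis by (simp add: H)
    next
      case False
      then have "nilp a * (nilp b * x) = prod nilp (insert a (insert b S))" "even (card (insert a (insert b S)))"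
        using S fS by auto
      then show ?thesis using S(1) ab by (auto intro!: zspan.base imageI)
    qed
  qed (simp_all add: H right_diff_distrib)
  have word: "mod2_word w \<in> ?H" if "set w \<subseteq> zs" for w
    using that
  proof (induction w)
    case Nil
    have "prod nilp {} \<in> ?H" by (intro zspan.base imageI) simp
    then show ?case by simp
  next
    case (Cons a w)
    have "x * inversions [a] v \<in> ?H" if "x \<in> ?H" "a \<in> zs" "set v \<subseteq> zs" for v x
      using that(1,3)
    proof (induction v arbitrary: x)
      case (Cons b v)
      have "x * inversion a b \<in> ?H"
      proof (cases "b < a")
        case True
        have "x + nilp a * (nilp b * x) \<in> ?H"
          using Cons.prems by (intro H(4) step that(2)) auto
        then show ?thesis using True by (simp add: inversion_def algebra_simps)
      qed (use Cons.prems in \<open>simp add: inversion_def\<close>)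
      from Cons.IH[OF this] show ?case using Cons.prems(2)
        unfolding inversions_Cons2[of _ b v] inversions_single by (simp add: mult.assoc)
    qed simp
    then show ?case using Cons by simp
  qed
  have "mod2_symbol f \<in> ?H"
    using assms(2) unfolding word_span_def
    by (rule zspan_image[OF _ additive_mod2_symbol add_closed_zspan]) (auto simp: words_of_def intro: word)
  then show ?thesis
  proof induction
    case zero
    show ?case by (intro exI[of _ "\<lambda>_. 0"]) simp
  next
    case (base x)
    then obtain S where S: "S \<in> ?E" "x = prod nilp S" by auto
    have "(\<Sum>T\<in>?E. of_int (if T = S then 1 else 0) * prod nilp T) = (\<Sum>T\<in>?E. if T = S then prod nilp T else 0)"
      by (rule sum.cong) auto
    also have "\<dots> = x" using S fin by simp
    finally show ?case by (intro exI[of _ "\<lambda>T. if T = S then 1 else 0"]) simp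
  next
    case (diff x y)
    then obtain c c' where "x = (\<Sum>S\<in>?E. of_int (c S) * prod nilp S)" "y = (\<Sum>S\<in>?E. of_int (c' S) * prod nilp S)"
      by auto
    then have "x - y = (\<Sum>S\<in>?E. of_int (c S - c' S) * prod nilp S)"
      by (simp only: of_int_diff left_diff_distrib sum_subtractf)
    then show ?case by (intro exI[of _ "\<lambda>S. c S - c' S"])
  qed
qed

lemma add_closed_sum:
  assumes "add_closed H" "\<And>i. i \<in> I \<Longrightarrow> g i \<in> H" shows "sum g I \<in> H"
  using assms(2) by (induction I rule: infinite_finite_induct) (auto intro: add_closedD[OF assms(1)])

lemma monomials_independent:
  assumes "finite zs" "(\<Sum>S\<in>Pow zs. of_int (c S) * prod nilp S) = (0::mod2_ring)" "S \<subseteq> zs"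
  shows "even (c S)"
  using assms
proof (induction zs arbitrary: c S rule: finite_induct)
  case empty
  then show ?case by (simp add: mod2_of_int split: if_splits)
next
  case (insert z zs)
  have gen: "(\<Sum>S\<in>Pow zs. of_int (b S) * prod nilp S) \<in> generated_by zs" for b :: "nat set \<Rightarrow> int"
  proof -
    have "prod nilp S \<in> generated_by zs" if "S \<subseteq> zs" for S
      using finite_subset[OF that insert.hyps(1)] that
      by (induction S rule: finite_induct) (auto intro!: generated_by_closed)
    then have "of_int (b S) * prod nilp S \<in> generated_by zs" if "S \<in> Pow zs" for S
      using that by (intro add_closed_scale[OF add_closed_generated_by]) auto
    then show ?thesis
      by (rule add_closed_sum[OF add_closed_generated_by])
  qed
  have "(\<Sum>S\<in>Pow (insert z zs). of_int (c S) * prod nilp S)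
      = (\<Sum>S\<in>Pow zs. of_int (c S) * prod nilp S) + (\<Sum>S\<in>insert z ` Pow zs. of_int (c S) * prod nilp S)"
    unfolding Pow_insert using insert.hyps by (intro sum.union_disjoint) auto
  also have "(\<Sum>S\<in>insert z ` Pow zs. of_int (c S) * prod nilp S)
      = (\<Sum>S\<in>Pow zs. of_int (c (insert z S)) * prod nilp (insert z S))"
    using insert.hyps by (intro sum.reindex_cong[of "insert z"]) (auto simp: inj_on_def)
  also have "\<dots> = (\<Sum>S\<in>Pow zs. nilp z * (of_int (c (insert z S)) * prod nilp S))"
  proof (rule sum.cong[OF refl])
    fix S assume "S \<in> Pow zs"
    then have "finite S" "z \<notin> S" using insert.hyps finite_subset by auto
    then show "of_int (c (insert z S)) * prod nilp (insert z S) = nilp z * (of_int (c (insert z S)) * prod nilp S)"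
      by (simp add: ac_simps)
  qed
  finally have e: "(\<Sum>S\<in>Pow zs. of_int (c S) * prod nilp S)
      + nilp z * (\<Sum>S\<in>Pow zs. of_int (c (insert z S)) * prod nilp S) = 0"
    using insert.prems(1) by (simp add: sum_distrib_left)
  from nilp_split[OF gen gen insert.hyps(2) e]
  have 1: "(\<Sum>S\<in>Pow zs. of_int (c S) * prod nilp S) = 0"
    and 2: "(\<Sum>S\<in>Pow zs. of_int (c (insert z S)) * prod nilp S) = 0" .
  show ?case
  proof (cases "z \<in> S")
    case False
    then show ?thesis using insert.IH[OF 1] insert.prems(2) by auto
  next
    case True
    then have "insert z (S - {z}) = S" "S - {z} \<subseteq> zs" using insert.prems(2) by auto
    then show ?thesis using insert.IH[OF 2, of "S - {z}"] by simp
  qed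
qed

lemma relations_mod2_symbol:
  assumes "\<And>i. i \<in> zs \<Longrightarrow> even (m i)" "x \<in> relations n" "x \<in> word_span zs m"
  shows "mod2_symbol x = 0"
proof -
  obtain l where l: "l \<in> zspan {bracket n u v |u v. u @ v \<in> words_of zs m}" "x - l \<in> M3 n"
    using relations_component[OF assms(2,3)] .
  have "mod2_symbol l = 0"
  proof (rule zspan_kernel[OF l(1) additive_mod2_symbol])
    fix s assume "s \<in> {bracket n u v |u v. u @ v \<in> words_of zs m}"
    then obtain u v where s: "s = bracket n u v" and uv: "u @ v \<in> words_of zs m" by auto
    have "even (count_list (u @ v) i)" for i
    proof (cases "i \<in> zs")
      case True
      then have "count_list (u @ v) i = m i" using uv unfolding words_of_def by blast
      then show ?thesis using assms(1)[OF True] by (simp only:)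
    next
      case False
      then have "i \<notin> set (u @ v)" using uv by (auto simp: words_of_def)
      then have "count_list (u @ v) i = 0" by (rule count_notin)
      then show ?thesis by (metis even_zero)
    qed
    then show "mod2_symbol s = 0" unfolding s by (rule mod2_symbol_bracket_even)
  qed
  then show ?thesis using mod2_symbol_M3[OF l(2)] by (simp add: mod2_symbol_diff)
qed

lemma mod2_symbol_power_even:
  assumes "f \<in> word_span zs m" "even c" shows "mod2_symbol (frag_of (replicate c z) * f) = mod2_symbol f"
  using word_span_homogeneous[OF assms(1)] mod2_symbol_power(2)[OF _ assms(2)] by blast

lemma additive_of_int:
  fixes h :: "'a::ring_1 \<Rightarrow> 'b::ring_1"
  assumes "additive h" shows "h (of_int k * x) = of_int k * h x"
  by (induction k rule: int_induct[of _ 0])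
     (simp_all add: additive.zero[OF assms] additive.add[OF assms] additive.diff[OF assms] algebra_simps)

lemma of_int_left_comm: "x * (of_int k * y) = of_int k * (x * y :: 'a::ring_1)"
proof -
  have "x * of_int k = of_int k * x" by (rule mult_of_int_commute[symmetric])
  then show ?thesis by (simp only: mult.assoc[symmetric])
qed

text \<open>The differential vanishes modulo two, since its symbol is a multiple of \<open>\<Sum> m\<^sub>i t\<^sub>i\<close>, which is zero for even exponents. Faithfulness gives \<open>[y, f] = 2 h\<close>
for some \<open>h\<close>, which may be taken of degree one in \<open>y\<close>; the part \<open>y g\<close> of its expansion
vanishes because twice it is a one-form modulo \<open>M\<^sub>3\<close>, and the symbol separates \<open>y g\<close> from one-forms.\<close>

lemma adjoint_divisible:
  assumes fin: "finite zs" and y: "y \<notin> zs" and pos: "\<And>i. i \<in> zs \<Longrightarrow> m i > 0" and even: "\<And>i. i \<in> zs \<Longrightarrow> even (m i)"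
    and f: "f \<in> word_span zs m"
  obtains w where "w \<in> oneforms n zs y m" "adjoint n [y] f - (w + w) \<in> M3 n"
proof -
  obtain v where v: "v \<in> oneforms n zs y m" "adjoint n [y] f - v \<in> M3 n" using adjoint_oneforms[OF f, of n y] by auto
  have "mod2_symbol (adjoint n [y] f) = 0"
    using f unfolding word_span_def
  proof (rule zspan_kernel)
    show "additive (\<lambda>f. mod2_symbol (adjoint n [y] f))"
      by (simp add: additive_def additive.add[OF additive_adjoint] mod2_symbol_add)
    fix s assume "s \<in> frag_of ` words_of zs m"
    then obtain g where g: "s = frag_of g" "g \<in> words_of zs m" by auto
    have "degree_sum g = 0"
      using degree_sum_count[OF fin, of g] g(2) even by (simp add: words_of_def mod2_of_nat)
    then show "mod2_symbol (adjoint n [y] s) = 0"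
      using mod2_symbol_adjoint[OF homogeneous_word, of n y g] by (simp add: g(1))
  qed
  then have "mod2_symbol v = 0" using mod2_symbol_M3[OF v(2)] by (simp add: mod2_symbol_diff)
  then have "v \<in> M3_mod2 n" using mod2_symbol_faithful(2)[OF fin _ y v(1)] pos by simp
  then obtain h where h: "v - 2 * h \<in> M3 n" by (auto simp: M3_mod2_def)
  let ?zs = "insert y zs" and ?m = "m(y := 1)"
  have vp: "v \<in> word_span ?zs ?m" by (rule word_span_insert_one[OF y v(1)])
  have "component ?zs ?m (v - 2 * h) = v - 2 * component ?zs ?m h"
    using component_word_span[OF vp] additive.add[OF additive_component] by (simp add: additive.diff[OF additive_component] mult_2)
  then have h': "v - 2 * component ?zs ?m h \<in> M3 n" using component_M3[OF h, of ?zs ?m] by simp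
  have "component ?zs ?m h \<in> expansions n zs y (?m y) ?m"
    by (rule word_span_in_expansions[OF y component_in_word_span]) simp
  then obtain g w where g: "g \<in> word_span zs ?m" and w: "w \<in> oneforms n zs y ?m"
    and d: "component ?zs ?m h - (frag_of (replicate 1 y) * g + frag_of (replicate (1 - 1) y) * w) \<in> M3 n"
    by (auto simp: expansions_def mod_set_def)
  have "word_span zs ?m = word_span zs m" "oneforms n zs y ?m = oneforms n zs y m"
    using y by (auto intro!: word_span_cong oneforms_cong)
  with g w have g: "g \<in> word_span zs m" and w: "w \<in> oneforms n zs y m" by auto
  let ?Y = "frag_of (replicate 1 y)"
  have w2: "(w + w) - v \<in> oneforms n zs y m"
    by (intro add_closedD(2,4)[OF add_closed_oneforms] w v(1))
  have g2: "g + g \<in> word_span zs m" by (intro add_closedD(4)[OF add_closed_word_span] g)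
  have e: "v - ((?Y * (g + g)) + (w + w)) \<in> M3 n"
  proof -
    have "(v - 2 * component ?zs ?m h) + (component ?zs ?m h - (?Y * g + frag_of (replicate (1 - 1) y) * w))
       + (component ?zs ?m h - (?Y * g + frag_of (replicate (1 - 1) y) * w)) \<in> M3 n"
      by (rule add_closedD(4)[OF add_closed_M3 add_closedD(4)[OF add_closed_M3 h' d] d])
    then show ?thesis by (simp add: frag_of_Nil algebra_simps mult_2)
  qed
  then have "symbol n (?Y * (g + g) + frag_of (replicate (1 - 1) y) * ((w + w) - v)) = 0"
    using symbol_M3[OF add_closedD(3)[OF add_closed_M3 e]] by (simp add: frag_of_Nil algebra_simps)
  from symbol_split_word_span[OF y g2 w2 this] have "symbol n (g + g) = 0" by simp
  then have "symbol n g S + symbol n g S = 0" for S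
    by (metis additive.add[OF additive_symbol] plus_fun_apply zero_fun_apply)
  then have "symbol n g = 0" by (simp add: fun_eq_iff)
  then have "g \<in> M3 n" using symbol_faithful(1)[OF fin _ g] pos by simp
  then have gM: "?Y * (g + g) \<in> M3 n"
    by (intro two_sidedD(2)[OF two_sided_M3] add_closedD(4)[OF add_closed_M3])
  have "(adjoint n [y] f - v) + (v - ((?Y * (g + g)) + (w + w))) + ?Y * (g + g) \<in> M3 n"
    by (rule add_closedD(4)[OF add_closed_M3 add_closedD(4)[OF add_closed_M3 v(2) e] gM])
  then have "adjoint n [y] f - (w + w) \<in> M3 n" by (simp add: algebra_simps)
  then show ?thesis by (rule that[OF w])
qed

text \<open>The element \<open>T S\<close> is \<open>y\<^sup>c f - y\<^sup>c\<^sup>-\<^sup>1 w\<close>, where \<open>f\<close> has symbol \<open>t\<^sub>S\<close> and \<open>[y, f] = 2 w\<close>; twice it is a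
relation. The part of the mod-two symbol that is free of \<open>t\<^sub>y\<close> is the symbol of \<open>f\<close> and
vanishes on relations, which shows independence. A torsion element whose \<open>f\<close> has symbol zero
is a relation by \<open>even_exponent_criterion\<close>, which shows that the \<open>T S\<close> generate.\<close>

lemma torsion_basis:
  assumes fin: "finite zs" and y: "y \<notin> zs" "n \<le> y" and pos: "\<And>i. i \<in> insert y zs \<Longrightarrow> m i > 0"
    and even: "\<And>i. i \<in> insert y zs \<Longrightarrow> even (m i)"
  defines "E \<equiv> {S. S \<subseteq> zs \<and> even (card S)}"
  obtains T where "\<And>S. S \<in> E \<Longrightarrow> T S \<in> word_span (insert y zs) m" "\<And>S. S \<in> E \<Longrightarrow> T S + T S \<in> relations n"
    "\<And>c :: nat set \<Rightarrow> int. (\<Sum>S\<in>E. of_int (c S) * T S) \<in> relations n \<Longrightarrow> \<forall>S\<in>E. even (c S)"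
    "\<And>x k. x \<in> word_span (insert y zs) m \<Longrightarrow> k > 0 \<Longrightarrow> of_nat k * x \<in> relations n \<Longrightarrow>
       \<exists>c :: nat set \<Rightarrow> int. x - (\<Sum>S\<in>E. of_int (c S) * T S) \<in> relations n"
proof -
  let ?c = "m y" and ?zs = "insert y zs"
  let ?d = "odd_degree n ?zs m"
  let ?Y = "frag_of (replicate ?c y)" and ?Y' = "frag_of (replicate (?c - 1) y)"
  note R = add_closedD[OF add_closed_relations[of n]] and P = add_closedD[OF add_closed_word_span[of ?zs m]]
  have my: "?c > 0" "even ?c" using pos even by auto
  have finE: "finite E" using fin by (simp add: E_def)
  have "\<exists>f w. f \<in> word_span zs m \<and> mod2_symbol f = prod nilp S \<and> w \<in> oneforms n zs y m \<and>
      adjoint n [y] f - (w + w) \<in> M3 n" if S: "S \<in> E" for S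
  proof -
    obtain f where f: "f \<in> word_span zs m" "mod2_symbol f = prod nilp S"
      using monomial_realization[OF fin, of m] pos even S by (auto simp: E_def)
    obtain w where "w \<in> oneforms n zs y m" "adjoint n [y] f - (w + w) \<in> M3 n"
      using adjoint_divisible[OF fin y(1) _ _ f(1), of n] pos even by auto
    with f show ?thesis by blast
  qed
  then obtain f w where fw: "\<And>S. S \<in> E \<Longrightarrow> f S \<in> word_span zs m" "\<And>S. S \<in> E \<Longrightarrow> mod2_symbol (f S) = prod nilp S"
     "\<And>S. S \<in> E \<Longrightarrow> w S \<in> oneforms n zs y m" "\<And>S. S \<in> E \<Longrightarrow> adjoint n [y] (f S) - (w S + w S) \<in> M3 n"
    by metis
  define T where "T S = ?Y * f S - ?Y' * w S" for S
  have TP: "T S \<in> word_span ?zs m" if "S \<in> E" for S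
    unfolding T_def using fw(1,3)[OF that] y(1) my
    by (intro P(2) word_span_power_insert oneforms_power_insert) auto
  \<comment> \<open>By the relation for \<open>2 y\<^sup>c f\<close> and the choice of \<open>w S\<close> as half of the differential of \<open>f S\<close>.\<close>
  have T2: "T S + T S \<in> relations n" if "S \<in> E" for S
  proof -
    have "2 * (?Y * f S) - ?Y' * adjoint n [y] (f S) \<in> relations n"
      using double_power_relation[OF y(2) my(2,1)] L2_subset_relations by auto
    moreover have "?Y' * (adjoint n [y] (f S) - (w S + w S)) \<in> relations n"
      using two_sidedD(2)[OF two_sided_M3 fw(4)[OF that]] M3_subset_relations by auto
    ultimately have "(2 * (?Y * f S) - ?Y' * adjoint n [y] (f S)) + ?Y' * (adjoint n [y] (f S) - (w S + w S)) \<in> relations n"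
      by (rule R(4))
    then show ?thesis by (simp add: T_def algebra_simps mult_2)
  qed
  define F W where "F c = (\<Sum>S\<in>E. of_int (c S) * f S)" and "W c = (\<Sum>S\<in>E. of_int (c S) * w S)" for c :: "nat set \<Rightarrow> int"
  have FP: "F c \<in> word_span zs m" and WP: "W c \<in> oneforms n zs y m" for c
    unfolding F_def W_def using fw
    by (auto intro!: add_closed_sum[OF add_closed_word_span] add_closed_sum[OF add_closed_oneforms]
        add_closed_scale[OF add_closed_word_span] add_closed_scale[OF add_closed_oneforms])
  have TFW: "(\<Sum>S\<in>E. of_int (c S) * T S) = ?Y * F c - ?Y' * W c" for c
  proof -
    have "of_int (c S) * T S = ?Y * (of_int (c S) * f S) - ?Y' * (of_int (c S) * w S)" for S
      unfolding T_def right_diff_distrib of_int_left_comm ..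
    then show ?thesis by (simp add: F_def W_def sum_subtractf sum_distrib_left)
  qed
  have TcP: "(\<Sum>S\<in>E. of_int (c S) * T S) \<in> word_span ?zs m" for c
    using TP by (intro add_closed_sum[OF add_closed_word_span] add_closed_scale[OF add_closed_word_span])
  have Fc: "mod2_symbol (F c) = (\<Sum>S\<in>E. of_int (c S) * prod nilp S)" for c
    unfolding F_def additive.sum[OF additive_mod2_symbol] additive_of_int[OF additive_mod2_symbol]
    using fw(2) by (intro sum.cong) auto
  have indep: "\<forall>S\<in>E. even (c S)" if c: "(\<Sum>S\<in>E. of_int (c S) * T S) \<in> relations n" for c
  proof -
    have "mod2_symbol (?Y * F c - ?Y' * W c) = 0"
      using relations_mod2_symbol[OF even c TcP] TFW by simp
    moreover obtain b where b: "b \<in> generated_by zs" "mod2_symbol (W c) = nilp y * b"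
      using mod2_symbol_oneforms[OF WP] by auto
    ultimately have "mod2_symbol (F c) + nilp y * b = 0"
      using mod2_symbol_power_even[OF FP my(2)] mod2_symbol_power_oneforms[OF WP] by (simp add: mod2_symbol_diff)
    from nilp_split(1)[OF mod2_symbol_word_span[OF FP] b(1) y(1) this]
    have 0: "(\<Sum>S\<in>E. of_int (c S) * prod nilp S) = 0" by (simp add: Fc)
    have "(\<Sum>S\<in>Pow zs. of_int (if S \<in> E then c S else 0) * prod nilp S) = (\<Sum>S\<in>E. of_int (c S) * prod nilp S)"
      using fin by (intro sum.mono_neutral_cong_right) (auto simp: E_def)
    then have "even (if S \<in> E then c S else 0)" if "S \<subseteq> zs" for S
      using monomials_independent[OF fin, of "\<lambda>S. if S \<in> E then c S else 0" S] 0 that by simp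
    then show ?thesis unfolding E_def by (metis (mono_tags, lifting) mem_Collect_eq)
  qed
  have gen: "\<exists>c. x - (\<Sum>S\<in>E. of_int (c S) * T S) \<in> relations n"
    if x: "x \<in> word_span ?zs m" "k > 0" "of_nat k * x \<in> relations n" for x and k :: nat
  proof -
    have tr: "x \<in> traceless n ?d"
    proof (rule multiple_traceless[OF relations_traceless[OF _ x(3)] x(2)])
      show "of_nat k * x \<in> word_span ?zs m" using add_closed_scale[OF add_closed_word_span x(1), of "int k"] by simp
    qed (use fin in simp)
    obtain g v where g: "g \<in> word_span zs m" and v: "v \<in> oneforms n zs y m" and d: "x - (?Y * g + ?Y' * v) \<in> M3 n"
      using word_span_in_expansions[OF y(1) x(1) my(1), of n] by (auto simp: expansions_def mod_set_def)
    obtain c where c: "mod2_symbol g = (\<Sum>S\<in>E. of_int (c S) * prod nilp S)"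
      using even_monomials_span[OF fin g] unfolding E_def by auto
    let ?T = "\<Sum>S\<in>E. of_int (c S) * T S"
    have Ttr: "?T \<in> traceless n ?d"
    proof (intro add_closed_sum[OF add_closed_traceless] add_closed_scale[OF add_closed_traceless])
      fix S assume S: "S \<in> E"
      have "T S + T S \<in> traceless n ?d"
        using fin by (intro relations_traceless[OF _ T2[OF S]] P(4) TP S) auto
      then show "T S \<in> traceless n ?d" using multiple_traceless[of 2 "T S" n ?d] by (simp add: mult_2)
    qed
    have x': "x - ?T \<in> word_span ?zs m" "x - ?T \<in> traceless n ?d"
      using P(2)[OF x(1) TcP] add_closedD(2)[OF add_closed_traceless tr Ttr] .
    have g': "g - F c \<in> word_span zs m" by (rule add_closedD(2)[OF add_closed_word_span g FP])
    have v': "v + W c \<in> oneforms n zs y m" by (rule add_closedD(4)[OF add_closed_oneforms v WP])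
    have d': "(x - ?T) - (?Y * (g - F c) + ?Y' * (v + W c)) \<in> M3 n"
      using d unfolding TFW by (simp add: algebra_simps)
    have "mod2_symbol (g - F c) = 0" by (simp add: mod2_symbol_diff Fc c)
    then have "g - F c \<in> M3_mod2 n" using mod2_symbol_faithful(1)[OF fin _ g'] pos by simp
    then have "g - F c \<in> mod_set (L2 n) (M3_mod2 n)" by (rule mod_set_right[OF add_closed_L2])
    from even_exponent_criterion[OF fin y pos my(2) x' g' v' d' this]
    show ?thesis by blast
  qed
  show ?thesis by (rule that[of T, OF TP T2 indep gen])
qed

lemma card_even_subsets:
  assumes "finite A" "A \<noteq> {}" shows "card {S. S \<subseteq> A \<and> even (card S)} = 2 ^ (card A - 1)"
proof -
  obtain a where a: "a \<in> A" using assms(2) by auto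
  \<comment> \<open>An even subset of \<open>A\<close> is determined by its elements other than \<open>a\<close>.\<close>
  let ?g = "\<lambda>S. if even (card S) then S else insert a S"
  have fin: "finite S" if "S \<subseteq> A" for S using that assms(1) finite_subset by auto
  have "bij_betw ?g (Pow (A - {a})) {S. S \<subseteq> A \<and> even (card S)}"
  proof (rule bij_betw_byWitness[of _ "\<lambda>S. S - {a}"])
    show "\<forall>S\<in>{S. S \<subseteq> A \<and> even (card S)}. ?g (S - {a}) = S"
    proof (intro ballI)
      fix S assume "S \<in> {S. S \<subseteq> A \<and> even (card S)}"
      then have S: "S \<subseteq> A" "even (card S)" by auto
      show "?g (S - {a}) = S"
      proof (cases "a \<in> S")
        case True
        then have "card S = Suc (card (S - {a}))" using card_Suc_Diff1[OF fin[OF S(1)]] by simp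
        then show ?thesis using S(2) True by (auto simp: insert_absorb)
      qed (use S in simp)
    qed
    show "?g ` Pow (A - {a}) \<subseteq> {S. S \<subseteq> A \<and> even (card S)}"
    proof (rule image_subsetI)
      fix S assume "S \<in> Pow (A - {a})"
      then have "a \<notin> S" "finite S" "S \<subseteq> A" using fin[of S] by auto
      then show "?g S \<in> {S. S \<subseteq> A \<and> even (card S)}" using a by auto
    qed
  qed auto
  from bij_betw_same_card[OF this] have "card {S. S \<subseteq> A \<and> even (card S)} = card (Pow (A - {a}))"
    by (rule sym)
  also have "\<dots> = 2 ^ (card A - 1)" using assms(1) a by (simp add: card_Pow)
  finally show ?thesis .
qed

section \<open>Comparison with the finitely generated superring\<close>

lemma carrier_free_superring: "carrier (free_superring n k) = {a. Poly_Mapping.keys a \<subseteq> lists {..<n + k}}"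
  by (simp add: free_superring_def)

lemma add_monoid_free_superring: "add_monoid (free_superring n k) = free_Abelian_group (lists {..<n + k})"
  by (simp add: free_superring_def free_Abelian_group_def)

lemma mult_free_superring: "a \<otimes>\<^bsub>free_superring n k\<^esub> b = a * b"
proof -
  have "bilinear_extension (\<lambda>u v. frag_of (u @ v)) a b = a * b"
  proof (induction a rule: frag_induct)
    case (word u)
    show ?case unfolding bilinear_extension_def frag_extend_of
      by (induction b rule: frag_induct) (simp_all add: frag_of_mult frag_extend_diff algebra_simps)
  qed (simp_all add: bilinear_extension_def frag_extend_diff algebra_simps)
  then show ?thesis by (simp add: free_superring_def)
qed

lemma frag_cmul_sign: "frag_cmul ((-1) ^ j) x = (-1) ^ j * (x :: free_ring)"
  by (cases "even j") simp_all

lemma supercommutator_word: "supercommutator n (frag_of u) x = adjoint n u x"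
  unfolding supercommutator_def bilinear_extension_def frag_extend_of
  by (induction x rule: frag_induct)
     (simp_all add: frag_extend_diff additive.zero[OF additive_adjoint] additive.diff[OF additive_adjoint]
        bracket_def frag_cmul_sign)

lemma additive_supercommutator: "additive (\<lambda>a. supercommutator n a x)"
  by (simp add: additive_def supercommutator_def bilinear_extension_def frag_extend_add)

lemma carrier_zspan: "carrier (free_superring n k) = zspan (frag_of ` lists {..<n + k})"
proof
  show "carrier (free_superring n k) \<subseteq> zspan (frag_of ` lists {..<n + k})"
  proof
    fix a assume "a \<in> carrier (free_superring n k)"
    then have "Poly_Mapping.keys a \<subseteq> lists {..<n + k}" by (simp add: carrier_free_superring)
    then show "a \<in> zspan (frag_of ` lists {..<n + k})"
      by (induction a rule: frag_induction) (auto intro: zspan.intros)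
  qed
  have "add_closed (carrier (free_superring n k))"
    unfolding carrier_free_superring add_closed_def using keys_diff by fastforce
  then show "zspan (frag_of ` lists {..<n + k}) \<subseteq> carrier (free_superring n k)"
    using zspan_least[of _ "frag_of ` lists {..<n + k}"] by (fastforce simp: carrier_free_superring)
qed

lemma add_closed_carrier: "add_closed (carrier (free_superring n k))"
  by (simp add: carrier_zspan add_closed_zspan)

lemma additive_span_zspan:
  assumes "S \<subseteq> carrier (free_superring n k)"
  shows "additive_span (free_superring n k) S = zspan S"
proof -
  have keys: "Poly_Mapping.keys x \<subseteq> lists {..<n + k}" if "x \<in> S" for x
    using that assms by (auto simp: carrier_free_superring)
  let ?G = "free_Abelian_group (lists {..<n + k})"
  have "x \<in> zspan S" if "x \<in> generate ?G S" for x
    using that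
  proof induction
    case (inv h)
    then show ?case using keys[OF inv] add_closedD(3)[OF add_closed_zspan] zspan.base by fastforce
  next
    case (eng h1 h2)
    then show ?case using add_closedD(4)[OF add_closed_zspan] by simp
  qed (auto intro: zspan.intros)
  moreover have "x \<in> generate ?G S \<and> - x \<in> generate ?G S" if "x \<in> zspan S" for x
    using that
  proof induction
    case zero
    then show ?case using generate.one[of ?G S] by simp
  next
    case (base x)
    then show ?case using generate.incl[of x S ?G] generate.inv[of x S ?G] keys[OF base] by simp
  next
    case (diff x y)
    then show ?case using generate.eng[of x ?G S "- y"] generate.eng[of y ?G S "- x"] by simp
  qed
  ultimately show ?thesis unfolding additive_span_def add_monoid_free_superring by blast
qed

lemma carrier_word: "set w \<subseteq> {..<n + k} \<Longrightarrow> frag_of w \<in> carrier (free_superring n k)"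
  by (auto simp: carrier_free_superring)

lemma carrier_mult:
  assumes "a \<in> carrier (free_superring n k)" "b \<in> carrier (free_superring n k)"
  shows "a * b \<in> carrier (free_superring n k)"
proof -
  have "frag_of u * b \<in> carrier (free_superring n k)" if "set u \<subseteq> {..<n + k}" for u
    using assms(2) unfolding carrier_zspan
    by (rule zspan_image[OF _ additive_left add_closed_zspan])
       (use that in \<open>auto simp: frag_of_mult in_lists_conv_set subset_iff intro!: zspan.base imageI\<close>)
  then show ?thesis
    using assms(1) unfolding carrier_zspan
    by (elim zspan_image[OF _ additive_right add_closed_zspan]) (auto simp: in_lists_conv_set subset_iff)
qed

lemma carrier_bracket: "set u \<subseteq> {..<n + k} \<Longrightarrow> set v \<subseteq> {..<n + k} \<Longrightarrow> bracket n u v \<in> carrier (free_superring n k)"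
  unfolding bracket_def
  by (intro add_closedD(2)[OF add_closed_carrier] add_closed_sign[OF add_closed_carrier] carrier_word) auto

lemma carrier_supercommutator:
  assumes "a \<in> carrier (free_superring n k)" "b \<in> carrier (free_superring n k)"
  shows "supercommutator n a b \<in> carrier (free_superring n k)"
  using assms(1) unfolding carrier_zspan[of n k]
proof (rule zspan_image[OF _ additive_supercommutator add_closed_zspan, folded carrier_zspan])
  fix s assume "s \<in> frag_of ` lists {..<n + k}"
  then obtain u where u: "s = frag_of u" "set u \<subseteq> {..<n + k}" by auto
  show "supercommutator n s b \<in> zspan (frag_of ` lists {..<n + k})"
    using assms(2) unfolding u(1) supercommutator_word carrier_zspan
    by (rule zspan_image[OF _ additive_adjoint add_closed_zspan])
       (use carrier_bracket[OF u(2)] in \<open>auto simp: carrier_zspan[symmetric] in_lists_conv_set subset_iff\<close>)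
qed

lemma lower_central_carrier: "i > 0 \<Longrightarrow> lower_central n k i \<subseteq> carrier (free_superring n k)"
proof (induction n k i rule: lower_central.induct)
  case (3 n k i)
  have S: "{supercommutator n a b |a b. a \<in> carrier (free_superring n k) \<and> b \<in> lower_central n k (Suc i)}
     \<subseteq> carrier (free_superring n k)" (is "?S \<subseteq> _")
    using 3 by (auto intro!: carrier_supercommutator)
  then show ?case
    using zspan_least[OF _ add_closed_carrier, of _ ?S] additive_span_zspan[OF S] by auto
qed auto

lemma lower_central_Suc:
  "lower_central n k (Suc (Suc i)) = zspan {supercommutator n a b |a b. a \<in> carrier (free_superring n k) \<and> b \<in> lower_central n k (Suc i)}"
  unfolding lower_central.simps
  by (rule additive_span_zspan) (use lower_central_carrier[of "Suc i" n k] in \<open>auto intro!: carrier_supercommutator\<close>)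

lemma supercommutator_in_lower_central:
  "a \<in> carrier (free_superring n k) \<Longrightarrow> b \<in> lower_central n k (Suc i) \<Longrightarrow> supercommutator n a b \<in> lower_central n k (Suc (Suc i))"
  unfolding lower_central_Suc by (rule zspan.base) blast

lemma lower_central_two_L2: "lower_central n k 2 \<subseteq> L2 n"
proof -
  have "supercommutator n a b \<in> L2 n" for a b
  proof (induction a rule: frag_induct)
    case (word u)
    show ?case unfolding supercommutator_word
      by (induction b rule: frag_induct)
         (simp_all add: additive.zero[OF additive_adjoint] additive.diff[OF additive_adjoint] add_closedD[OF add_closed_L2] bracket_in_L2)
  qed (simp_all add: additive.zero[OF additive_supercommutator] additive.diff[OF additive_supercommutator] add_closedD[OF add_closed_L2])
  then show ?thesis
    using zspan_least[OF _ add_closed_L2] unfolding numeral_2_eq_2 lower_central_Suc by blast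
qed

lemma lower_central_three_M3: "lower_central n k 3 \<subseteq> M3 n"
proof -
  have "supercommutator n a b \<in> M3 n" if b: "b \<in> L2 n" for a b
    by (induction a rule: frag_induct)
       (simp_all add: additive.zero[OF additive_supercommutator] additive.diff[OF additive_supercommutator]
          add_closedD[OF add_closed_M3] supercommutator_word adjoint_L2[OF b])
  then show ?thesis
    using zspan_least[OF _ add_closed_M3] lower_central_two_L2[of n k]
    unfolding numeral_3_eq_3 numeral_2_eq_2 lower_central_Suc[of n k 1, unfolded One_nat_def] by blast
qed

lemma lower_central_ideal_zspan:
  "lower_central_ideal n k 3 = zspan {a * b |a b. a \<in> carrier (free_superring n k) \<and> b \<in> lower_central n k 3}"
  unfolding lower_central_ideal_def mult_free_superring
  by (rule additive_span_zspan) (use lower_central_carrier[of 3 n k] in \<open>auto intro!: carrier_mult\<close>)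

lemma product_in_lower_central_ideal:
  "a \<in> carrier (free_superring n k) \<Longrightarrow> b \<in> lower_central n k 3 \<Longrightarrow> a * b \<in> lower_central_ideal n k 3"
  unfolding lower_central_ideal_zspan by (rule zspan.base) blast

text \<open>A right factor \<open>q\<close> of \<open>t = [a, [b, c]]\<close> is moved to the left by \<open>t q = \<plusminus> (q t - [q, t])\<close>; here \<open>[q, t]\<close> again
lies in \<open>L\<^sub>3\<close>, as \<open>t\<close> lies in \<open>L\<^sub>2\<close>.\<close>

lemma triple_in_lower_central_ideal:
  assumes "set (p @ a @ b @ c @ q) \<subseteq> {..<n + k}"
  shows "frag_of p * triple_bracket n a b c * frag_of q \<in> lower_central_ideal n k 3"
proof -
  let ?C = "carrier (free_superring n k)"
  have w: "frag_of p \<in> ?C" "frag_of q \<in> ?C" "frag_of a \<in> ?C" "frag_of b \<in> ?C" "frag_of c \<in> ?C"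
    using assms by (auto intro!: carrier_word)
  have bc: "bracket n b c \<in> lower_central n k (Suc (Suc 0))" "bracket n b c \<in> ?C"
    using supercommutator_in_lower_central[OF w(4), of "frag_of c" 0] w(5) carrier_bracket[of b n k c] assms
    by (simp_all add: supercommutator_word)
  have t3: "triple_bracket n a b c \<in> lower_central n k (Suc (Suc (Suc 0)))"
    using supercommutator_in_lower_central[OF w(3) bc(1)] by (simp add: supercommutator_word adjoint_bracket)
  have t2: "triple_bracket n a b c \<in> lower_central n k (Suc (Suc 0))"
    using supercommutator_in_lower_central[OF w(3), of "bracket n b c" 0] bc(2)
    by (simp add: supercommutator_word adjoint_bracket)
  have t3q: "adjoint n q (triple_bracket n a b c) \<in> lower_central n k (Suc (Suc (Suc 0)))"
    using supercommutator_in_lower_central[OF w(2) t2] by (simp add: supercommutator_word)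
  define j where "j = odd_count n q * odd_count n (a @ b @ c)"
  have "triple_bracket n a b c \<in> homogeneous (mset (a @ b @ c))"
    using homogeneous_triple[of "[]" n a b c "[]"] by (simp add: frag_of_Nil)
  from adjoint_homogeneous[OF this, of n q]
  have "triple_bracket n a b c * frag_of q
      = (-1) ^ j * (frag_of q * triple_bracket n a b c - adjoint n q (triple_bracket n a b c))"
    unfolding j_def[symmetric] by (cases "even j") simp_all
  then have e: "frag_of p * triple_bracket n a b c * frag_of q
      = (-1) ^ j * ((frag_of p * frag_of q) * triple_bracket n a b c - frag_of p * adjoint n q (triple_bracket n a b c))"
    by (simp add: mult.assoc sign_left_comm right_diff_distrib)
  have I: "add_closed (lower_central_ideal n k 3)" unfolding lower_central_ideal_zspan by (rule add_closed_zspan)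
  show ?thesis unfolding e
    by (intro add_closed_sign[OF I] add_closedD(2)[OF I] product_in_lower_central_ideal carrier_mult w)
       (use t3 t3q in \<open>simp_all add: numeral_3_eq_3\<close>)
qed

text \<open>The inclusion from right to left retracts the free ring on all letters onto that on the first \<open>n + k\<close>
letters by sending words with other letters to zero; this respects the generators of \<open>L\<^sub>2\<close> and \<open>M\<^sub>3\<close>.\<close>

lemma B1_relations_eq: "B1_relations n k = relations n \<inter> carrier (free_superring n k)"
proof -
  let ?C = "carrier (free_superring n k)"
  have B: "B1_relations n k = {x + y |x y. x \<in> lower_central n k 2 \<and> y \<in> lower_central_ideal n k 3}"
    unfolding B1_relations_def set_add_def set_mult_def add_monoid_free_superring by auto
  have I: "lower_central_ideal n k 3 \<subseteq> M3 n \<inter> ?C"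
  proof -
    have "a * b \<in> M3 n \<inter> ?C" if "a \<in> ?C" "b \<in> lower_central n k 3" for a b
      using that lower_central_three_M3[of n k] lower_central_carrier[of 3 n k] two_sidedD(2)[OF two_sided_M3]
      by (auto intro!: carrier_mult)
    moreover have "add_closed (M3 n \<inter> ?C)"
      using add_closed_M3[of n] add_closed_carrier[of n k] by (auto simp: add_closed_def)
    ultimately show ?thesis
      unfolding lower_central_ideal_zspan using zspan_least by blast
  qed
  show ?thesis
  proof
    show "B1_relations n k \<subseteq> relations n \<inter> ?C"
    proof
      fix z assume "z \<in> B1_relations n k"
      then obtain x y where z: "z = x + y" and x: "x \<in> lower_central n k 2" and y: "y \<in> lower_central_ideal n k 3"
        using B by auto
      have "x \<in> L2 n" "x \<in> ?C" using x lower_central_two_L2 lower_central_carrier[of 2 n k] by auto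
      moreover have "y \<in> M3 n" "y \<in> ?C" using y I by auto
      ultimately show "z \<in> relations n \<inter> ?C"
        unfolding z using L2_subset_relations M3_subset_relations
        by (blast intro: add_closedD(4)[OF add_closed_relations] add_closedD(4)[OF add_closed_carrier])
    qed
    show "relations n \<inter> ?C \<subseteq> B1_relations n k"
    proof
      fix x assume x: "x \<in> relations n \<inter> ?C"
      define \<rho> :: "free_ring \<Rightarrow> free_ring" where "\<rho> = linear_ext (\<lambda>w. if w \<in> lists {..<n + k} then frag_of w else 0)"
      have add: "additive \<rho>" unfolding \<rho>_def by (rule additive_linear_ext)
      have \<rho>h: "\<rho> y = (if w \<in> lists {..<n + k} then y else 0)" if "y \<in> homogeneous (mset w)" for y w
        using that unfolding homogeneous_def
      proof (induction rule: zspan.induct)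
        case (base y)
        then obtain u where u: "y = frag_of u" "mset u = mset w" by auto
        then have "set u = set w" by (metis set_mset_mset)
        then show ?case by (simp add: u(1) \<rho>_def in_lists_conv_set)
      qed (simp_all add: additive.zero[OF add] additive.diff[OF add])
      obtain l where l: "l \<in> L2 n" "x - l \<in> M3 n" using x by (auto simp: relations_def mod_set_def)
      have "x \<in> zspan (frag_of ` lists {..<n + k})" using x by (simp add: carrier_zspan)
      then have \<rho>x: "\<rho> x = x"
      proof induction
        case (base y)
        then show ?case by (auto simp: \<rho>_def)
      qed (simp_all add: additive.zero[OF add] additive.diff[OF add])
      have c2: "lower_central n k 2 = zspan {supercommutator n a b |a b. a \<in> ?C \<and> b \<in> ?C}"
        unfolding numeral_2_eq_2 lower_central_Suc by simp
      have "\<rho> l \<in> lower_central n k 2"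
        using l(1) unfolding L2_def c2
      proof (rule zspan_image[OF _ add add_closed_zspan])
        fix s assume "s \<in> {bracket n u v |u v. True}"
        then obtain u v where s: "s = bracket n u v" by auto
        have "s \<in> homogeneous (mset (u @ v))" unfolding s using homogeneous_bracket by simp
        note r = \<rho>h[OF this]
        show "\<rho> s \<in> zspan {supercommutator n a b |a b. a \<in> ?C \<and> b \<in> ?C}"
        proof (cases "u @ v \<in> lists {..<n + k}")
          case True
          then have "frag_of u \<in> ?C" "frag_of v \<in> ?C" by (auto intro!: carrier_word)
          moreover have "s = supercommutator n (frag_of u) (frag_of v)" by (simp add: s supercommutator_word)
          ultimately show ?thesis using r True by (auto intro!: zspan.base)
        next
          case False
          then have "\<rho> s = 0" unfolding r by (rule if_not_P)
          then show ?thesis by (simp add: zspan.zero)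
        qed
      qed
      moreover have "\<rho> (x - l) \<in> lower_central_ideal n k 3"
        using l(2) unfolding M3_def
      proof (rule zspan_image[OF _ add])
        show I: "add_closed (lower_central_ideal n k 3)" unfolding lower_central_ideal_zspan by (rule add_closed_zspan)
        fix s assume "s \<in> triple_products n"
        then obtain p a b c q where s: "s = frag_of p * triple_bracket n a b c * frag_of q" by auto
        have r: "\<rho> s = (if p @ a @ b @ c @ q \<in> lists {..<n + k} then s else 0)"
          unfolding s by (rule \<rho>h[OF homogeneous_triple])
        show "\<rho> s \<in> lower_central_ideal n k 3"
        proof (cases "p @ a @ b @ c @ q \<in> lists {..<n + k}")
          case True
          then have "set (p @ a @ b @ c @ q) \<subseteq> {..<n + k}" by auto
          from triple_in_lower_central_ideal[OF this] show ?thesis using True unfolding r by (simp only: if_True s)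
        next
          case False
          then show ?thesis using add_closedD(1)[OF I] unfolding r by (simp only: if_False)
        qed
      qed
      moreover have "x = \<rho> l + \<rho> (x - l)" using \<rho>x by (simp add: additive.diff[OF add])
      ultimately show "x \<in> B1_relations n k" unfolding B by blast
    qed
  qed
qed

lemma multidegree_component_word_span: "multidegree_component n k m = word_span {..<n + k} m"
proof
  show "multidegree_component n k m \<subseteq> word_span {..<n + k} m"
  proof
    fix a assume a: "a \<in> multidegree_component n k m"
    have "Poly_Mapping.keys a \<subseteq> words_of {..<n + k} m"
    proof
      fix w assume w: "w \<in> Poly_Mapping.keys a"
      then have "w \<in> lists {..<n + k}" using a by (auto simp: multidegree_component_def carrier_free_superring)
      then show "w \<in> words_of {..<n + k} m" using a w by (auto simp: multidegree_component_def words_of_def)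
    qed
    then show "a \<in> word_span {..<n + k} m"
      by (induction a rule: frag_induction) (auto simp: word_span_base add_closedD[OF add_closed_word_span])
  qed
  show "word_span {..<n + k} m \<subseteq> multidegree_component n k m"
  proof
    fix a assume "a \<in> word_span {..<n + k} m"
    then have "Poly_Mapping.keys a \<subseteq> words_of {..<n + k} m"
      unfolding word_span_def
    proof induction
      case (diff x y)
      then show ?case using keys_diff[of x y] by blast
    qed auto
    then show "a \<in> multidegree_component n k m"
      by (fastforce simp: multidegree_component_def carrier_free_superring words_of_def)
  qed
qed

section \<open>The torsion group\<close>

abbreviation coset :: "nat \<Rightarrow> nat \<Rightarrow> free_ring \<Rightarrow> free_ring set" where
  "coset n k a \<equiv> B1_relations n k +>\<^bsub>free_superring n k\<^esub> a"

lemma coset_eq: "coset n k a = (\<lambda>h. h + a) ` B1_relations n k"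
  by (auto simp: a_r_coset_def r_coset_def free_superring_def)

lemma add_closed_B1_relations: "add_closed (B1_relations n k)"
  using add_closed_relations[of n] add_closed_carrier[of n k] by (auto simp: add_closed_def B1_relations_eq)

lemma coset_eq_iff:
  assumes "a \<in> carrier (free_superring n k)" "b \<in> carrier (free_superring n k)"
  shows "coset n k a = coset n k b \<longleftrightarrow> a - b \<in> relations n"
proof
  note H = add_closedD[OF add_closed_B1_relations[of n k]]
  show "a - b \<in> relations n" if eq: "coset n k a = coset n k b"
  proof -
    have "0 + a \<in> coset n k a" unfolding coset_eq using H(1) by blast
    then obtain h where "h \<in> B1_relations n k" "0 + a = h + b" unfolding eq unfolding coset_eq by blast
    then show ?thesis by (simp add: B1_relations_eq)
  qed
  have sub: "coset n k a \<subseteq> coset n k b" if "a - b \<in> B1_relations n k" for a b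
  proof
    fix x assume "x \<in> coset n k a"
    then obtain h where h: "h \<in> B1_relations n k" "x = h + a" unfolding coset_eq by blast
    then have "x = (h + (a - b)) + b" "h + (a - b) \<in> B1_relations n k" using H(4)[OF h(1) that] by simp_all
    then show "x \<in> coset n k b" unfolding coset_eq by blast
  qed
  assume "a - b \<in> relations n"
  then have ab: "a - b \<in> B1_relations n k"
    using add_closedD(2)[OF add_closed_carrier assms] by (simp add: B1_relations_eq)
  moreover have "b - a \<in> B1_relations n k" using H(3)[OF ab] by simp
  ultimately show "coset n k a = coset n k b" using sub by blast
qed

lemma B1_bar_component_mult: "coset n k a \<otimes>\<^bsub>B1_bar_component n k m\<^esub> coset n k b = coset n k (a + b)"
proof -
  note H = add_closedD[OF add_closed_B1_relations[of n k]]
  have "(\<Union>x\<in>coset n k a. \<Union>y\<in>coset n k b. {x + y}) = coset n k (a + b)"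
  proof
    show "(\<Union>x\<in>coset n k a. \<Union>y\<in>coset n k b. {x + y}) \<subseteq> coset n k (a + b)"
    proof safe
      fix x y assume "x \<in> coset n k a" "y \<in> coset n k b"
      then obtain h h' where h: "h \<in> B1_relations n k" "h' \<in> B1_relations n k" "x = h + a" "y = h' + b"
        unfolding coset_eq by blast
      then have "x + y = (h + h') + (a + b)" by (simp add: algebra_simps)
      then show "x + y \<in> coset n k (a + b)" unfolding coset_eq using H(4)[OF h(1,2)] by blast
    qed
    show "coset n k (a + b) \<subseteq> (\<Union>x\<in>coset n k a. \<Union>y\<in>coset n k b. {x + y})"
    proof
      fix x assume "x \<in> coset n k (a + b)"
      then obtain h where h: "h \<in> B1_relations n k" "x = h + (a + b)" unfolding coset_eq by blast
      have "h + a \<in> coset n k a" "0 + b \<in> coset n k b" unfolding coset_eq using h(1) H(1) by blast+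
      moreover have "x = (h + a) + (0 + b)" by (simp add: h(2))
      ultimately show "x \<in> (\<Union>x\<in>coset n k a. \<Union>y\<in>coset n k b. {x + y})" by blast
    qed
  qed
  then show ?thesis
    unfolding B1_bar_component_def B1_bar_def FactGroup_def by (simp add: set_mult_def free_superring_def)
qed

lemma B1_bar_component_one: "\<one>\<^bsub>B1_bar_component n k m\<^esub> = coset n k 0"
  by (simp add: coset_eq B1_bar_component_def B1_bar_def FactGroup_def)

lemma B1_bar_component_pow: "coset n k a [^]\<^bsub>B1_bar_component n k m\<^esub> (d::nat) = coset n k (of_nat d * a)"
  by (induction d) (simp_all add: nat_pow_def B1_bar_component_one B1_bar_component_mult algebra_simps)

lemma word_span_carrier: "x \<in> word_span {..<n + k} m \<Longrightarrow> x \<in> carrier (free_superring n k)"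
  unfolding multidegree_component_word_span[symmetric] by (simp add: multidegree_component_def)

lemma torsion_carrier:
  "carrier (torsion_group (B1_bar_component n k m)) =
     {coset n k a |a. a \<in> word_span {..<n + k} m \<and> (\<exists>d::nat. d > 0 \<and> of_nat d * a \<in> relations n)}"
proof -
  have tors: "coset n k a [^]\<^bsub>B1_bar_component n k m\<^esub> d = \<one>\<^bsub>B1_bar_component n k m\<^esub> \<longleftrightarrow> of_nat d * a \<in> relations n"
    if "a \<in> word_span {..<n + k} m" for a and d :: nat
  proof -
    have a: "a \<in> carrier (free_superring n k)" by (rule word_span_carrier[OF that])
    have "of_nat d * a \<in> carrier (free_superring n k)"
      using add_closed_scale[OF add_closed_carrier a, of "int d"] by simp
    from coset_eq_iff[OF this add_closedD(1)[OF add_closed_carrier]] show ?thesis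
      by (simp add: B1_bar_component_pow B1_bar_component_one)
  qed
  have "carrier (B1_bar_component n k m) = {coset n k a |a. a \<in> word_span {..<n + k} m}"
    by (simp add: B1_bar_component_def multidegree_component_word_span)
  then have "carrier (torsion_group (B1_bar_component n k m)) =
    {x. \<exists>a. x = coset n k a \<and> a \<in> word_span {..<n + k} m \<and>
       (\<exists>d::nat. d > 0 \<and> x [^]\<^bsub>B1_bar_component n k m\<^esub> d = \<one>\<^bsub>B1_bar_component n k m\<^esub>)}"
    by (auto simp: torsion_group_def)
  also have "\<dots> = {coset n k a |a. a \<in> word_span {..<n + k} m \<and> (\<exists>d::nat. d > 0 \<and> of_nat d * a \<in> relations n)}"
    by (intro Collect_cong ex_cong1 conj_cong refl) (simp only: tors)
  finally show ?thesis .
qed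

lemma torsion_mult: "coset n k a \<otimes>\<^bsub>torsion_group (B1_bar_component n k m)\<^esub> coset n k b = coset n k (a + b)"
  using B1_bar_component_mult[where n=n and k=k and a=a and m=m and b=b] by (simp add: torsion_group_def)

lemma torsion_one: "\<one>\<^bsub>torsion_group (B1_bar_component n k m)\<^esub> = coset n k 0"
  using B1_bar_component_one[of n k m] by (simp add: torsion_group_def)

lemma trivial_torsionI:
  assumes "\<And>x d. x \<in> word_span {..<n + k} m \<Longrightarrow> d > 0 \<Longrightarrow> of_nat d * x \<in> relations n \<Longrightarrow> x \<in> relations n"
  shows "trivial_group (torsion_group (B1_bar_component n k m))"
proof -
  let ?G = "torsion_group (B1_bar_component n k m)"
  have car: "carrier ?G = {coset n k 0}"
  proof
    show "carrier ?G \<subseteq> {coset n k 0}"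
    proof
      fix Q assume "Q \<in> carrier ?G"
      then obtain a and d :: nat where a: "Q = coset n k a" "a \<in> word_span {..<n + k} m" "d > 0" "of_nat d * a \<in> relations n"
        unfolding torsion_carrier by blast
      then have "a - 0 \<in> relations n" using assms by simp
      then show "Q \<in> {coset n k 0}"
        using coset_eq_iff[OF word_span_carrier[OF a(2)] add_closedD(1)[OF add_closed_carrier]] a(1) by simp
    qed
    have "0 \<in> word_span {..<n + k} m" "of_nat 1 * 0 \<in> relations n"
      using add_closedD(1)[OF add_closed_word_span] add_closedD(1)[OF add_closed_relations] by auto
    then show "{coset n k 0} \<subseteq> carrier ?G" unfolding torsion_carrier by (blast intro: zero_less_one)
  qed
  have "group ?G"
    by (rule groupI) (simp_all add: car torsion_one torsion_mult)
  then show ?thesis by (simp add: trivial_group_def car torsion_one)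
qed

lemma torsion_iso:
  fixes T :: "nat \<Rightarrow> free_ring"
  assumes TP: "\<And>i. i < r \<Longrightarrow> T i \<in> word_span {..<n + k} m"
    and T2: "\<And>i. i < r \<Longrightarrow> T i + T i \<in> relations n"
    and indep: "\<And>c. (\<Sum>i<r. of_int (c i) * T i) \<in> relations n \<Longrightarrow> \<forall>i<r. even (c i)"
    and gen: "\<And>x d. x \<in> word_span {..<n + k} m \<Longrightarrow> d > 0 \<Longrightarrow> of_nat d * x \<in> relations n \<Longrightarrow>
       \<exists>c. x - (\<Sum>i<r. of_int (c i) * T i) \<in> relations n"
  shows "torsion_group (B1_bar_component n k m) \<cong> product_group {..<r} (\<lambda>_. integer_mod_group 2)"
proof -
  let ?G = "torsion_group (B1_bar_component n k m)" and ?P = "product_group {..<r} (\<lambda>_. integer_mod_group 2)"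
  define \<Sigma> where "\<Sigma> c = (\<Sum>i<r. of_int (c i) * T i)" for c :: "nat \<Rightarrow> int"
  define \<phi> where "\<phi> c = coset n k (\<Sigma> c)" for c
  have \<Sigma>P: "\<Sigma> c \<in> word_span {..<n + k} m" for c
    unfolding \<Sigma>_def using TP by (intro add_closed_sum[OF add_closed_word_span] add_closed_scale[OF add_closed_word_span]) auto
  note \<Sigma>C = word_span_carrier[OF \<Sigma>P]
  have \<Sigma>diff: "\<Sigma> c - \<Sigma> d = \<Sigma> (\<lambda>i. c i - d i)" and \<Sigma>add: "\<Sigma> c + \<Sigma> d = \<Sigma> (\<lambda>i. c i + d i)" for c d
    by (simp_all add: \<Sigma>_def sum_subtractf left_diff_distrib sum.distrib distrib_right)
  have \<Sigma>even: "\<Sigma> c \<in> relations n" if "\<And>i. i < r \<Longrightarrow> even (c i)" for c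
    unfolding \<Sigma>_def
  proof (rule add_closed_sum[OF add_closed_relations])
    fix i assume "i \<in> {..<r}"
    then have i: "i < r" by simp
    then obtain b where "c i = 2 * b" using \<open>\<And>i. i < r \<Longrightarrow> even (c i)\<close> by (metis evenE)
    then have "of_int (c i) * T i = of_int b * (T i + T i)" by (simp add: algebra_simps mult_2)
    then show "of_int (c i) * T i \<in> relations n" using add_closed_scale[OF add_closed_relations T2[OF i]] by simp
  qed
  have congr: "\<phi> c = \<phi> d \<longleftrightarrow> (\<forall>i<r. even (c i - d i))" for c d
  proof
    assume "\<phi> c = \<phi> d"
    then have "\<Sigma> (\<lambda>i. c i - d i) \<in> relations n"
      unfolding \<phi>_def coset_eq_iff[OF \<Sigma>C \<Sigma>C] \<Sigma>diff .
    then show "\<forall>i<r. even (c i - d i)" unfolding \<Sigma>_def by (rule indep)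
  next
    assume "\<forall>i<r. even (c i - d i)"
    then have "\<Sigma> (\<lambda>i. c i - d i) \<in> relations n" by (intro \<Sigma>even) simp
    then show "\<phi> c = \<phi> d" unfolding \<phi>_def coset_eq_iff[OF \<Sigma>C \<Sigma>C] \<Sigma>diff .
  qed
  have carP: "carrier ?P = (\<Pi>\<^sub>E i\<in>{..<r}. {0..<2})" by (simp add: carrier_integer_mod_group)
  have \<phi>G: "\<phi> c \<in> carrier ?G" for c
  proof -
    have "of_nat 2 * \<Sigma> c \<in> relations n"
    proof -
      have "of_nat 2 * \<Sigma> c = \<Sigma> (\<lambda>i. c i + c i)" unfolding \<Sigma>add[symmetric] by (simp add: mult_2)
      then show ?thesis using \<Sigma>even[of "\<lambda>i. c i + c i"] by simp
    qed
    then show ?thesis unfolding torsion_carrier \<phi>_def using \<Sigma>P zero_less_numeral by blast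
  qed
  have "\<phi> \<in> hom ?P ?G"
  proof (rule homI)
    show "\<phi> c \<in> carrier ?G" for c by (rule \<phi>G)
    fix c d
    have "\<phi> (c \<otimes>\<^bsub>?P\<^esub> d) = \<phi> (\<lambda>i. c i + d i)"
      unfolding congr
    proof (intro allI impI)
      fix i assume "i < r"
      then have "(c \<otimes>\<^bsub>?P\<^esub> d) i = (c i + d i) mod 2" by simp
      then show "even ((c \<otimes>\<^bsub>?P\<^esub> d) i - (c i + d i))" by presburger
    qed
    also have "\<dots> = \<phi> c \<otimes>\<^bsub>?G\<^esub> \<phi> d" unfolding \<phi>_def torsion_mult \<Sigma>add ..
    finally show "\<phi> (c \<otimes>\<^bsub>?P\<^esub> d) = \<phi> c \<otimes>\<^bsub>?G\<^esub> \<phi> d" .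
  qed
  moreover have "bij_betw \<phi> (carrier ?P) (carrier ?G)"
    unfolding bij_betw_def
  proof
    show "inj_on \<phi> (carrier ?P)"
    proof (rule inj_onI)
      fix c d assume cd: "c \<in> carrier ?P" "d \<in> carrier ?P" "\<phi> c = \<phi> d"
      have "c i = d i" if "i < r" for i
      proof -
        have "c i \<in> {0..<2}" "d i \<in> {0..<2}"
          using PiE_mem[OF cd(1)[unfolded carP]] PiE_mem[OF cd(2)[unfolded carP]] that by simp_all
        moreover have "even (c i - d i)" using cd(3) that unfolding congr by blast
        ultimately show ?thesis unfolding atLeastLessThan_iff by presburger
      qed
      then show "c = d" by (intro PiE_ext[OF cd(1,2)[unfolded carP]]) simp
    qed
    show "\<phi> ` carrier ?P = carrier ?G"
    proof
      show "\<phi> ` carrier ?P \<subseteq> carrier ?G" using \<phi>G by blast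
      show "carrier ?G \<subseteq> \<phi> ` carrier ?P"
      proof
        fix Q assume "Q \<in> carrier ?G"
        then obtain a and d :: nat where a: "Q = coset n k a" "a \<in> word_span {..<n + k} m" "d > 0" "of_nat d * a \<in> relations n"
          unfolding torsion_carrier by blast
        obtain c where "a - \<Sigma> c \<in> relations n" using gen[OF a(2-4)] unfolding \<Sigma>_def by blast
        then have "Q = \<phi> c" unfolding a(1) \<phi>_def coset_eq_iff[OF word_span_carrier[OF a(2)] \<Sigma>C] .
        also have "\<phi> c = \<phi> (\<lambda>i\<in>{..<r}. c i mod 2)"
          unfolding congr by (simp add: even_iff_mod_2_eq_zero mod_diff_right_eq)
        finally have "Q = \<phi> (\<lambda>i\<in>{..<r}. c i mod 2)" .
        moreover have "(\<lambda>i\<in>{..<r}. c i mod 2) \<in> carrier ?P" unfolding carP by auto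
        ultimately show "Q \<in> \<phi> ` carrier ?P" by blast
      qed
    qed
  qed
  ultimately have "?P \<cong> ?G" unfolding is_iso_def iso_def by blast
  moreover have "group ?P" by simp
  ultimately show ?thesis using group.iso_sym by blast
qed

theorem theorem6p1:
  fixes n k :: nat and m :: "nat \<Rightarrow> nat"
  assumes "k \<ge> 1" and "n + k \<ge> 2" and "\<forall>i<n + k. m i > 0"
  shows "((\<forall>i<n + k. even (m i)) \<longrightarrow>
            torsion_group (B1_bar_component n k m)
              \<cong> product_group {..<(2::nat) ^ (n + k - 2)} (\<lambda>_. integer_mod_group 2))
       \<and> (\<not> (\<forall>i<n + k. even (m i)) \<longrightarrow>
            trivial_group (torsion_group (B1_bar_component n k m)))"
proof -
  \<comment> \<open>The last letter is odd because \<open>k \<ge> 1\<close>, and \<open>n + k \<ge> 2\<close> leaves at least one further letter.\<close>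
  define y zs where "y = n + k - 1" and "zs = {..<n + k - 1}"
  have zs: "finite zs" "insert y zs = {..<n + k}" "y \<notin> zs" "n \<le> y"
    using assms(1,2) by (auto simp: y_def zs_def)
  have pos: "m i > 0" if "i \<in> insert y zs" for i using that assms(3) zs(2) by auto
  have tr: "x \<in> traceless n (odd_degree n (insert y zs) m)"
    if "x \<in> word_span {..<n + k} m" "d > 0" "of_nat d * x \<in> relations n" for x d
  proof (rule multiple_traceless[OF relations_traceless[OF _ that(3)] that(2)])
    show "of_nat d * x \<in> word_span (insert y zs) m"
      using add_closed_scale[OF add_closed_word_span that(1), of "int d"] by (simp add: zs(2))
  qed (simp add: zs(1))
  show ?thesis
  proof (intro conjI impI)
    assume "\<not> (\<forall>i<n + k. even (m i))"
    then obtain j where j: "j \<in> insert y zs" "odd (m j)" unfolding zs(2) by auto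
    show "trivial_group (torsion_group (B1_bar_component n k m))"
    proof (rule trivial_torsionI)
      fix x and d :: nat
      assume x: "x \<in> word_span {..<n + k} m" "d > 0" "of_nat d * x \<in> relations n"
      show "x \<in> relations n"
      proof (cases "odd (m y)")
        case True
        show ?thesis
          by (rule odd_exponent_no_torsion[OF zs(1,3,4) pos True x(1)[folded zs(2)] tr[OF x]])
      next
        case False
        then have "even (m y)" "j \<in> zs" using j by auto
        then show ?thesis
          using even_exponent_no_torsion[OF zs(1,3,4) pos _ _ j(2) x(1)[folded zs(2)] tr[OF x]] by blast
      qed
    qed
  next
    assume even: "\<forall>i<n + k. even (m i)"
    define E where "E = {S. S \<subseteq> zs \<and> even (card S)}"
    let ?r = "2 ^ (n + k - 2) :: nat"
    have "0 \<in> zs" using assms(2) by (simp add: zs_def)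
    then have "card E = 2 ^ (card zs - 1)"
      unfolding E_def using zs(1) by (intro card_even_subsets) auto
    then have "card E = ?r" by (simp add: zs_def numeral_2_eq_2)
    moreover have "finite E" using zs(1) by (simp add: E_def)
    ultimately obtain e where e: "bij_betw e {..<?r} E" using ex_bij_betw_nat_finite[of E] by (auto simp: atLeast0LessThan)
    obtain T where T: "\<And>S. S \<in> E \<Longrightarrow> T S \<in> word_span (insert y zs) m" "\<And>S. S \<in> E \<Longrightarrow> T S + T S \<in> relations n"
      "\<And>c :: nat set \<Rightarrow> int. (\<Sum>S\<in>E. of_int (c S) * T S) \<in> relations n \<Longrightarrow> \<forall>S\<in>E. even (c S)"
      "\<And>x d. x \<in> word_span (insert y zs) m \<Longrightarrow> d > 0 \<Longrightarrow> of_nat d * x \<in> relations n \<Longrightarrow>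
         \<exists>c :: nat set \<Rightarrow> int. x - (\<Sum>S\<in>E. of_int (c S) * T S) \<in> relations n"
      using torsion_basis[OF zs(1,3,4), of m, folded E_def] pos even zs(2) by auto
    have eE: "e i \<in> E" if "i < ?r" for i using e that by (auto simp: bij_betw_def)
    have reindex: "(\<Sum>i<?r. h (e i)) = (\<Sum>S\<in>E. h S)" for h :: "nat set \<Rightarrow> free_ring"
      by (rule sum.reindex_bij_betw[OF e])
    show "torsion_group (B1_bar_component n k m) \<cong> product_group {..<?r} (\<lambda>_. integer_mod_group 2)"
    proof (rule torsion_iso[of _ "\<lambda>i. T (e i)"])
      show "T (e i) \<in> word_span {..<n + k} m" "T (e i) + T (e i) \<in> relations n" if "i < ?r" for i
        using T(1,2)[OF eE[OF that]] zs(2) by auto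
    next
      fix c :: "nat \<Rightarrow> int" assume c: "(\<Sum>i<?r. of_int (c i) * T (e i)) \<in> relations n"
      let ?f = "inv_into {..<?r} e"
      have f: "?f (e i) = i" if "i < ?r" for i using e that by (simp add: bij_betw_def inv_into_f_f)
      have "(\<Sum>i<?r. of_int (c i) * T (e i)) = (\<Sum>i<?r. of_int (c (?f (e i))) * T (e i))"
        by (rule sum.cong) (simp_all add: f)
      also have "\<dots> = (\<Sum>S\<in>E. of_int (c (?f S)) * T S)" by (rule reindex)
      finally have "\<forall>S\<in>E. even (c (?f S))" using c T(3) by simp
      then show "\<forall>i<?r. even (c i)" using eE f by (metis)
    next
      fix x and d :: nat assume "x \<in> word_span {..<n + k} m" "d > 0" "of_nat d * x \<in> relations n"
      then obtain c :: "nat set \<Rightarrow> int" where "x - (\<Sum>S\<in>E. of_int (c S) * T S) \<in> relations n"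
        using T(4) unfolding zs(2) by blast
      then show "\<exists>c. x - (\<Sum>i<?r. of_int (c i) * T (e i)) \<in> relations n"
        unfolding reindex[of "\<lambda>S. of_int (c S) * T S", symmetric] by (intro exI[of _ "\<lambda>i. c (e i)"])
    qed
  qed
qed

end
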